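(* Let $k$ be an algebraically closed field of characteristic $2$. Then $kA_4$ has exactly three projective indecomposable modules up to isomorphism, $Q_1,Q_2,Q_3$, where $Q_i=P_{T_i}$ is the projective cover of the simple module $T_i$, and $$kA_4\cong Q_1\oplus Q_2\oplus Q_3$$ as left $kA_4$-modules. The radical layers, from top to bottom, are: $Q_1$: $T_1,\ T_2\oplus T_3,\ T_1$; $Q_2$: $T_2,\ T_1\oplus T_3,\ T_2$; $Q_3$: $T_3,\ T_1\oplus T_2,\ T_3$.
   Context: Modules are finitely generated left modules. Let $\omega\in k$ be a primitive cube root of unity (a root of $x^2+x+1$) and let $V_4=\langle(1,2)(3,4),(1,3)(2,4)\rangle\trianglelefteq A_4$. The simple $kA_4$-modules are the one-dimensional modules $T_1,T_2,T_3$ on which $V_4$ acts trivially and $(1,2,3)$ acts as multiplication by $1$, $\omega$, $\omega^2$ respectively. The radical layers of a module $U$ are the quotients $\operatorname{rad}^{n-1}U/\operatorname{rad}^{n}U$ ($n\ge 1$, $\operatorname{rad}^0U=U$), listed from top to bottom in order of increasing $n$, where $\operatorname{rad}^nU=\operatorname{rad}(\operatorname{rad}^{n-1}U)$ and $\operatorname{rad}U$ is the intersection of all maximal submodules of $U$. *)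

theory Defs
  imports
    "HOL-Algebra.AbelCoset"
    "HOL-Algebra.Module"
    "HOL-Algebra.Sym_Groups"
    "HOL-Algebra.Generated_Groups"
    "HOL-Computational_Algebra.Polynomial"
begin

section \<open>Left modules over a ring that need not be commutative\<close>

text \<open>The locale \<open>module\<close> of HOL-Algebra requires a commutative ring, so the axioms are repeated
  here over an arbitrary ring. The record type \<open>module\<close> and the locale \<open>submodule\<close> are reused.
  The fields \<open>mult\<close> and \<open>one\<close>, which the record type inherits from rings, have no meaning for a
  module.\<close>

locale left_module = R?: ring R + M?: abelian_group M
  for R :: "('a, 'r) ring_scheme" (structure) and M :: "('a, 'b, 'm) module_scheme" (structure) +
  assumes smult_closed: "\<lbrakk>a \<in> carrier R; x \<in> carrier M\<rbrakk> \<Longrightarrow> a \<odot>\<^bsub>M\<^esub> x \<in> carrier M"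
    and smult_l_distr: "\<lbrakk>a \<in> carrier R; b \<in> carrier R; x \<in> carrier M\<rbrakk> \<Longrightarrow>
      (a \<oplus>\<^bsub>R\<^esub> b) \<odot>\<^bsub>M\<^esub> x = a \<odot>\<^bsub>M\<^esub> x \<oplus>\<^bsub>M\<^esub> b \<odot>\<^bsub>M\<^esub> x"
    and smult_r_distr: "\<lbrakk>a \<in> carrier R; x \<in> carrier M; y \<in> carrier M\<rbrakk> \<Longrightarrow>
      a \<odot>\<^bsub>M\<^esub> (x \<oplus>\<^bsub>M\<^esub> y) = a \<odot>\<^bsub>M\<^esub> x \<oplus>\<^bsub>M\<^esub> a \<odot>\<^bsub>M\<^esub> y"
    and smult_assoc: "\<lbrakk>a \<in> carrier R; b \<in> carrier R; x \<in> carrier M\<rbrakk> \<Longrightarrow>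
      (a \<otimes>\<^bsub>R\<^esub> b) \<odot>\<^bsub>M\<^esub> x = a \<odot>\<^bsub>M\<^esub> (b \<odot>\<^bsub>M\<^esub> x)"
    and smult_one: "x \<in> carrier M \<Longrightarrow> \<one>\<^bsub>R\<^esub> \<odot>\<^bsub>M\<^esub> x = x"

definition lmod_hom ::
  "('a, 'r) ring_scheme \<Rightarrow> ('a, 'b, 'm) module_scheme \<Rightarrow> ('a, 'c, 'n) module_scheme \<Rightarrow> ('b \<Rightarrow> 'c) set"
  where "lmod_hom R M N = {f \<in> hom (add_monoid M) (add_monoid N).
    \<forall>a\<in>carrier R. \<forall>x\<in>carrier M. f (a \<odot>\<^bsub>M\<^esub> x) = a \<odot>\<^bsub>N\<^esub> f x}"

definition lmod_iso ::
  "('a, 'r) ring_scheme \<Rightarrow> ('a, 'b, 'm) module_scheme \<Rightarrow> ('a, 'c, 'n) module_scheme \<Rightarrow> bool"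
  where "lmod_iso R M N \<longleftrightarrow> (\<exists>f\<in>lmod_hom R M N. bij_betw f (carrier M) (carrier N))"

definition fin_gen :: "('a, 'r) ring_scheme \<Rightarrow> ('a, 'b, 'm) module_scheme \<Rightarrow> bool"
  where "fin_gen R M \<longleftrightarrow> (\<exists>X. finite X \<and> X \<subseteq> carrier M \<and>
    (\<forall>N. submodule N R M \<and> X \<subseteq> N \<longrightarrow> N = carrier M))"

definition quot_lmod :: "('a, 'b, 'm) module_scheme \<Rightarrow> 'b set \<Rightarrow> ('a, 'b set) module"
  where "quot_lmod M N = \<lparr>carrier = a_rcosets\<^bsub>M\<^esub> N, monoid.mult = undefined, one = undefined,
    zero = N, add = set_add M, module.smult = (\<lambda>a X. \<Union>x\<in>X. N +>\<^bsub>M\<^esub> (a \<odot>\<^bsub>M\<^esub> x))\<rparr>"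

definition dsum ::
  "('a, 'b, 'm) module_scheme \<Rightarrow> ('a, 'c, 'n) module_scheme \<Rightarrow> ('a, 'b \<times> 'c) module"
  where "dsum M N = \<lparr>carrier = carrier M \<times> carrier N, monoid.mult = undefined, one = undefined,
    zero = (\<zero>\<^bsub>M\<^esub>, \<zero>\<^bsub>N\<^esub>),
    add = (\<lambda>x y. (fst x \<oplus>\<^bsub>M\<^esub> fst y, snd x \<oplus>\<^bsub>N\<^esub> snd y)),
    module.smult = (\<lambda>a x. (a \<odot>\<^bsub>M\<^esub> fst x, a \<odot>\<^bsub>N\<^esub> snd x))\<rparr>"

definition regular_lmod :: "('a, 'r) ring_scheme \<Rightarrow> ('a, 'a) module"
  where "regular_lmod R = \<lparr>carrier = carrier R, monoid.mult = undefined, one = undefined,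
    zero = \<zero>\<^bsub>R\<^esub>, add = add R, module.smult = monoid.mult R\<rparr>"

definition free_lmod :: "('a, 'r) ring_scheme \<Rightarrow> nat \<Rightarrow> ('a, nat \<Rightarrow> 'a) module"
  where "free_lmod R n = \<lparr>carrier = {..<n} \<rightarrow>\<^sub>E carrier R, monoid.mult = undefined, one = undefined,
    zero = (\<lambda>i\<in>{..<n}. \<zero>\<^bsub>R\<^esub>),
    add = (\<lambda>x y. \<lambda>i\<in>{..<n}. x i \<oplus>\<^bsub>R\<^esub> y i),
    module.smult = (\<lambda>a x. \<lambda>i\<in>{..<n}. a \<otimes>\<^bsub>R\<^esub> x i)\<rparr>"

definition internal_dsum ::
  "('a, 'r) ring_scheme \<Rightarrow> ('a, 'b, 'm) module_scheme \<Rightarrow> 'b set \<Rightarrow> 'b set \<Rightarrow> bool"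
  where "internal_dsum R M U W \<longleftrightarrow> submodule U R M \<and> submodule W R M \<and>
    U \<inter> W = {\<zero>\<^bsub>M\<^esub>} \<and> U <+>\<^bsub>M\<^esub> W = carrier M"

definition indecomposable_lmod :: "('a, 'r) ring_scheme \<Rightarrow> ('a, 'b, 'm) module_scheme \<Rightarrow> bool"
  where "indecomposable_lmod R M \<longleftrightarrow> carrier M \<noteq> {\<zero>\<^bsub>M\<^esub>} \<and>
    (\<forall>U W. internal_dsum R M U W \<longrightarrow> U = {\<zero>\<^bsub>M\<^esub>} \<or> W = {\<zero>\<^bsub>M\<^esub>})"

text \<open>Direct summands of free modules. Only finite rank occurs, as the notion is used for
  finitely generated modules.\<close>

definition projective_lmod :: "('a, 'r) ring_scheme \<Rightarrow> ('a, 'b, 'm) module_scheme \<Rightarrow> bool"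
  where "projective_lmod R P \<longleftrightarrow> (\<exists>n U W. internal_dsum R (free_lmod R n) U W \<and>
    lmod_iso R P ((free_lmod R n)\<lparr>carrier := U\<rparr>))"

definition proj_indecomposable :: "('a, 'r) ring_scheme \<Rightarrow> ('a, 'b, 'm) module_scheme \<Rightarrow> bool"
  where "proj_indecomposable R P \<longleftrightarrow> left_module R P \<and> fin_gen R P \<and>
    projective_lmod R P \<and> indecomposable_lmod R P"

definition essential_epi ::
  "('a, 'r) ring_scheme \<Rightarrow> ('a, 'b, 'm) module_scheme \<Rightarrow> ('a, 'c, 'n) module_scheme \<Rightarrow> ('b \<Rightarrow> 'c) \<Rightarrow> bool"
  where "essential_epi R M N f \<longleftrightarrow> f \<in> lmod_hom R M N \<and> f ` carrier M = carrier N \<and>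
    (\<forall>U. submodule U R M \<and> f ` U = carrier N \<longrightarrow> U = carrier M)"

definition projective_cover ::
  "('a, 'r) ring_scheme \<Rightarrow> ('a, 'b, 'm) module_scheme \<Rightarrow> ('a, 'c, 'n) module_scheme \<Rightarrow> bool"
  where "projective_cover R P M \<longleftrightarrow> left_module R M \<and> left_module R P \<and> fin_gen R P \<and>
    projective_lmod R P \<and> (\<exists>f. essential_epi R P M f)"

definition maximal_submodule ::
  "('a, 'r) ring_scheme \<Rightarrow> ('a, 'b, 'm) module_scheme \<Rightarrow> 'b set \<Rightarrow> bool"
  where "maximal_submodule R M N \<longleftrightarrow> submodule N R M \<and> N \<noteq> carrier M \<and>
    (\<forall>L. submodule L R M \<and> N \<subseteq> L \<longrightarrow> L = N \<or> L = carrier M)"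

definition rad :: "('a, 'r) ring_scheme \<Rightarrow> ('a, 'b, 'm) module_scheme \<Rightarrow> 'b set"
  where "rad R M = carrier M \<inter> \<Inter>{N. maximal_submodule R M N}"

primrec rad_pow :: "('a, 'r) ring_scheme \<Rightarrow> ('a, 'b, 'm) module_scheme \<Rightarrow> nat \<Rightarrow> 'b set"
  where
    "rad_pow R M 0 = carrier M"
  | "rad_pow R M (Suc n) = rad R (M\<lparr>carrier := rad_pow R M n\<rparr>)"

text \<open>Layers are counted from \<open>n = 1\<close>.\<close>

definition radical_layer ::
  "('a, 'r) ring_scheme \<Rightarrow> ('a, 'b, 'm) module_scheme \<Rightarrow> nat \<Rightarrow> ('a, 'b set) module"
  where "radical_layer R M n =
    quot_lmod (M\<lparr>carrier := rad_pow R M (n - 1)\<rparr>) (rad_pow R M n)"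

text \<open>That the list of layers ends after the third one is expressed by \<open>rad\<^sup>3 M = 0\<close>.\<close>

definition has_radical_layers ::
  "('a, 'r) ring_scheme \<Rightarrow> ('a, 'b, 'm) module_scheme \<Rightarrow> ('a, 'c, 'n) module_scheme \<Rightarrow>
   ('a, 'd, 'o) module_scheme \<Rightarrow> ('a, 'e, 'p) module_scheme \<Rightarrow> bool"
  where "has_radical_layers R M L1 L2 L3 \<longleftrightarrow>
    lmod_iso R (radical_layer R M 1) L1 \<and>
    lmod_iso R (radical_layer R M 2) L2 \<and>
    lmod_iso R (radical_layer R M 3) L3 \<and>
    rad_pow R M 3 = {\<zero>\<^bsub>M\<^esub>}"


section \<open>The group algebra of a finite group\<close>

text \<open>Elements are the functions from the group to the field, extended by \<open>0\<close> outside the carrier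
  of the group; a function \<open>f\<close> stands for the sum of all \<open>f g \<cdot> g\<close>. For infinite groups finite
  support would have to be demanded.\<close>

definition group_algebra :: "('g, 'x) monoid_scheme \<Rightarrow> ('g \<Rightarrow> 'k::field) ring"
  where "group_algebra G = \<lparr>carrier = {f. \<forall>g. g \<notin> carrier G \<longrightarrow> f g = 0},
    monoid.mult = (\<lambda>f h g. if g \<in> carrier G then \<Sum>x\<in>carrier G. f x * h (inv\<^bsub>G\<^esub> x \<otimes>\<^bsub>G\<^esub> g) else 0),
    one = (\<lambda>g. if g = \<one>\<^bsub>G\<^esub> then 1 else 0),
    zero = (\<lambda>g. 0),
    add = (\<lambda>f h g. f g + h g)\<rparr>"

definition group_elem :: "'g \<Rightarrow> 'g \<Rightarrow> 'k::field"
  where "group_elem g = (\<lambda>x. if x = g then 1 else 0)"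

text \<open>The field \<open>k\<close> with \<open>g\<close> acting as multiplication by \<open>\<chi> g\<close>, extended linearly. This is a
  module if \<open>\<chi>\<close> is multiplicative on \<open>G\<close>.\<close>

definition one_dim_lmod ::
  "('g, 'x) monoid_scheme \<Rightarrow> ('g \<Rightarrow> 'k::field) \<Rightarrow> ('g \<Rightarrow> 'k, 'k) module"
  where "one_dim_lmod G \<chi> = \<lparr>carrier = UNIV, monoid.mult = undefined, one = undefined,
    zero = 0, add = (+), module.smult = (\<lambda>a x. (\<Sum>g\<in>carrier G. a g * \<chi> g) * x)\<rparr>"


section \<open>The group \<open>A\<^sub>4\<close> and its simple modules\<close>

abbreviation A4 :: "(nat \<Rightarrow> nat) monoid"
  where "A4 \<equiv> alt_group 4"

abbreviation kA4 :: "((nat \<Rightarrow> nat) \<Rightarrow> 'k::field) ring"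
  where "kA4 \<equiv> group_algebra A4"

definition V4 :: "(nat \<Rightarrow> nat) set"
  where "V4 = generate A4 {transpose 1 2 \<circ> transpose 3 4, transpose 1 3 \<circ> transpose 2 4}"

definition c123 :: "nat \<Rightarrow> nat"
  where "c123 = cycle_of_list [1, 2, 3]"

text \<open>\<open>A\<^sub>4\<close> is the disjoint union of the cosets of \<open>V\<^sub>4\<close> by the powers \<open>0, 1, 2\<close> of \<open>(1,2,3)\<close>;
  the following exponent identifies the coset of \<open>g\<close>.\<close>

definition V4_exponent :: "(nat \<Rightarrow> nat) \<Rightarrow> nat"
  where "V4_exponent g = (THE j. j < 3 \<and> (\<exists>v\<in>V4. g = (c123 ^^ j) \<circ> v))"

definition T :: "'k::field \<Rightarrow> nat \<Rightarrow> ((nat \<Rightarrow> nat) \<Rightarrow> 'k, 'k) module"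
  where "T \<omega> i = one_dim_lmod A4 (\<lambda>g. (\<omega> ^ (i - 1)) ^ V4_exponent g)"

lemma V4_mem_A4:
  "transpose 1 2 \<circ> transpose 3 4 \<in> carrier A4"
  "transpose 1 3 \<circ> transpose 2 4 \<in> carrier A4"
  "transpose 1 4 \<circ> transpose 2 3 \<in> carrier A4"
  by (auto simp: alt_group_carrier evenperm_comp permutation_swap_id evenperm_swap
      intro!: permutes_compose permutes_swap_id)

lemma c123_mem_A4: "c123 \<in> carrier A4"
  by (auto simp: c123_def alt_group_carrier evenperm_comp permutation_swap_id evenperm_swap
      intro!: permutes_compose permutes_swap_id)

lemma V4_eq:
  "V4 = {id, transpose 1 2 \<circ> transpose 3 4, transpose 1 3 \<circ> transpose 2 4,
         transpose 1 4 \<circ> transpose 2 3}" (is "_ = ?V")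
proof
  interpret A: group A4 by (rule alt_group_is_group)
  have V: "?V \<subseteq> carrier A4"
    using V4_mem_A4 A.one_closed by (simp add: alt_group_one)
  define a b d :: "nat \<Rightarrow> nat" where
    "a = transpose 1 2 \<circ> transpose 3 4" and
    "b = transpose 1 3 \<circ> transpose 2 4" and
    "d = transpose 1 4 \<circ> transpose 2 3"
  have V_abd: "?V = {id, a, b, d}"
    by (simp only: a_def b_def d_def)
  have tab: "a \<circ> a = id" "a \<circ> b = d" "a \<circ> d = b" "b \<circ> a = d" "b \<circ> b = id" "b \<circ> d = a"
    "d \<circ> a = b" "d \<circ> b = a" "d \<circ> d = id"
    by (rule ext, simp add: a_def b_def d_def transpose_def)+
  have mult: "x \<circ> y \<in> ?V" if "x \<in> ?V" "y \<in> ?V" for x y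
    using that unfolding V_abd by (auto simp only: tab id_comp comp_id insert_iff)
  have invol: "x \<circ> x = id" if "x \<in> ?V" for x
    using that unfolding V_abd by (auto simp only: tab id_comp)
  have "subgroup ?V A4"
  proof (rule A.subgroupI)
    show "inv\<^bsub>A4\<^esub> x \<in> ?V" if "x \<in> ?V" for x
    proof -
      have "inv\<^bsub>A4\<^esub> x = x"
        using that V invol[OF that]
        by (intro A.inv_equality) (auto simp only: alt_group_mult alt_group_one)
      then show ?thesis using that by simp
    qed
  qed (use V mult in \<open>auto simp only: alt_group_mult\<close>)
  then show "V4 \<subseteq> ?V"
    unfolding V4_def by (rule A.generate_subgroup_incl[rotated]) auto
  have "(transpose 1 2 \<circ> transpose 3 4) \<otimes>\<^bsub>A4\<^esub> (transpose 1 3 \<circ> transpose 2 4) \<in> V4"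
    unfolding V4_def by (intro generate.eng generate.incl) auto
  moreover have "(transpose 1 2 \<circ> transpose 3 4) \<otimes>\<^bsub>A4\<^esub> (transpose 1 3 \<circ> transpose 2 4)
      = transpose 1 4 \<circ> transpose 2 (3::nat)"
    using tab(2) by (simp only: alt_group_mult a_def b_def d_def)
  moreover have "id \<in> V4"
    using generate.one[of A4] by (simp add: V4_def alt_group_one)
  ultimately show "?V \<subseteq> V4"
    by (auto simp: V4_def intro: generate.incl)
qed

lemma V4_exponent_eq:
  assumes "j < 3" "v \<in> V4"
  shows "V4_exponent ((c123 ^^ j) \<circ> v) = j"
  unfolding V4_exponent_def
proof (rule the_equality)
  have c: "c123 1 = 2" "c123 2 = 3" "c123 3 = 1" "c123 4 = 4"
    by (simp_all add: c123_def transpose_def)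
  have "i = j" if "i < 3" "w \<in> V4" and eq: "(c123 ^^ j) \<circ> v = (c123 ^^ i) \<circ> w" for i w
  proof -
    have "(c123 ^^ j) (v n) = (c123 ^^ i) (w n)" for n
      using eq by (metis comp_apply)
    from this[of 1] this[of 2] this[of 3] this[of 4] show ?thesis
      using assms that(1,2) c unfolding V4_eq
      by (auto simp: transpose_def numeral_3_eq_3 less_Suc_eq)
  qed
  then show "i = j" if "i < 3 \<and> (\<exists>w\<in>V4. (c123 ^^ j) \<circ> v = (c123 ^^ i) \<circ> w)" for i
    using that by blast
qed (use assms in blast)

lemma T_V4:
  assumes "v \<in> V4"
  shows "group_elem v \<odot>\<^bsub>T \<omega> i\<^esub> x = x"
proof -
  have "v \<in> carrier A4"
    using assms V4_mem_A4 monoid.one_closed[OF group.is_monoid[OF alt_group_is_group[of 4]]]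
    unfolding V4_eq by (auto simp only: alt_group_one)
  moreover have "finite (carrier A4)"
    by (rule finite_subset[of _ "{p. p permutes {1..4}}"])
       (auto simp: alt_group_carrier finite_permutations)
  moreover have "V4_exponent v = 0"
    using V4_exponent_eq[of 0 v] assms by simp
  ultimately show ?thesis
    by (simp add: T_def one_dim_lmod_def group_elem_def if_distrib[of "\<lambda>y. y * _"] cong: if_cong)
qed

lemma T_c123: "group_elem c123 \<odot>\<^bsub>T \<omega> i\<^esub> x = \<omega> ^ (i - 1) * x"
proof -
  have "finite (carrier A4)"
    by (rule finite_subset[of _ "{p. p permutes {1..4}}"])
       (auto simp: alt_group_carrier finite_permutations)
  moreover have "V4_exponent c123 = 1"
    using V4_exponent_eq[of 1 id] by (simp add: V4_eq)
  ultimately show ?thesis using c123_mem_A4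
    by (simp add: T_def one_dim_lmod_def group_elem_def if_distrib[of "\<lambda>y. y * _"] cong: if_cong)
qed

end

theory Submission
  imports Defs "HOL-Library.Function_Algebras"
begin

text \<open>
  Let \<open>c = (1,2,3)\<close>. The group algebra of \<open>V\<^sub>4\<close> in characteristic 2 is the truncated polynomial ring
  \<open>k[p, q]/(p\<^sup>2, q\<^sup>2)\<close>, and since \<open>k\<close> contains a primitive cube root of unity, \<open>p\<close> and \<open>q\<close> can be
  chosen as eigenvectors of the conjugation by \<open>c\<close>: \<open>c p = \<omega> p c\<close> and \<open>c q = \<omega>\<^sup>2 q c\<close>. The three
  idempotents \<open>e \<zeta>\<close> of \<open>k\<langle>c\<rangle>\<close>, one for each cube root of unity \<open>\<zeta>\<close>, are orthogonal with sum 1, so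
  \<open>kA\<^sub>4\<close> is the direct sum of the left ideals \<open>E \<zeta> = kA\<^sub>4 e \<zeta>\<close>. Such an ideal has the basis
  \<open>e \<zeta>\<close>, \<open>p e \<zeta>\<close>, \<open>q e \<zeta>\<close>, \<open>p q e \<zeta>\<close>, on which \<open>c\<close> has the eigenvalues \<open>\<zeta>\<close>, \<open>\<omega> \<zeta>\<close>,
  \<open>\<omega>\<^sup>2 \<zeta>\<close>, \<open>\<zeta>\<close>, while \<open>p\<close> and \<open>q\<close> move down the diamond. Hence an element with nonzero first
  coordinate generates \<open>E \<zeta>\<close> (\<open>submodule_E_full\<close>), every nonzero submodule contains \<open>p q e \<zeta>\<close>
  (\<open>submodule_E_socle\<close>), and the radical layers can be read off (\<open>radical_layers\<close>).

  Writing \<open>S \<zeta>\<close> for the one-dimensional module on which \<open>c\<close> acts as \<open>\<zeta>\<close>, the module \<open>E \<zeta>\<close> is a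
  projective cover of \<open>S \<zeta>\<close>. It remains to see that there are no other projective covers and no other
  projective indecomposable modules. Both follow from one fact (\<open>projective_onto_E\<close>): every nonzero
  projective module \<open>P\<close> maps onto some \<open>E \<zeta>\<close>. To see it, write a free module as \<open>F = U \<oplus> W\<close> with
  \<open>U \<cong> P\<close>. If \<open>p q\<close> killed \<open>U\<close>, then \<open>p q F \<subseteq> W\<close>; but a nonzero element of \<open>U\<close> has a nonzero
  multiple that is killed by \<open>p\<close> and \<open>q\<close>, and such elements lie in \<open>p q F\<close>, hence in \<open>W\<close>, which is absurd. So
  \<open>p q u \<noteq> 0\<close> for some \<open>u \<in> U\<close>, some coordinate of \<open>u\<close> is then nonzero in some \<open>S \<zeta>\<close>, and that
  coordinate followed by right multiplication with \<open>e \<zeta>\<close> maps \<open>U\<close> onto \<open>E \<zeta>\<close>.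

  A surjection of \<open>P\<close> onto \<open>E \<zeta>\<close> splits, so an indecomposable \<open>P\<close> is isomorphic to \<open>E \<zeta>\<close>. If
  \<open>P\<close> is a projective cover of \<open>S \<zeta>\<close>, there is moreover a map from \<open>E \<zeta>\<close> onto \<open>P\<close>; the composite
  from \<open>E \<zeta>\<close> onto some \<open>E \<xi>\<close> does not kill the socle of \<open>E \<zeta>\<close>, so \<open>E \<zeta> \<cong> P\<close>.
\<close>

section \<open>Homomorphisms and submodules of left modules\<close>

context left_module
begin

lemma smult_zero_left [simp]:
  assumes "x \<in> carrier M" shows "\<zero>\<^bsub>R\<^esub> \<odot>\<^bsub>M\<^esub> x = \<zero>\<^bsub>M\<^esub>"
proof -
  have "\<zero>\<^bsub>R\<^esub> \<odot>\<^bsub>M\<^esub> x \<oplus>\<^bsub>M\<^esub> \<zero>\<^bsub>R\<^esub> \<odot>\<^bsub>M\<^esub> x = \<zero>\<^bsub>R\<^esub> \<odot>\<^bsub>M\<^esub> x"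
    using smult_l_distr[of "\<zero>\<^bsub>R\<^esub>" "\<zero>\<^bsub>R\<^esub>" x] assms by simp
  then show ?thesis
    using smult_closed[of "\<zero>\<^bsub>R\<^esub>" x] assms by (metis M.add.l_cancel_one' R.zero_closed)
qed

lemma smult_zero_right [simp]:
  assumes "a \<in> carrier R" shows "a \<odot>\<^bsub>M\<^esub> \<zero>\<^bsub>M\<^esub> = \<zero>\<^bsub>M\<^esub>"
proof -
  have "a \<odot>\<^bsub>M\<^esub> \<zero>\<^bsub>M\<^esub> \<oplus>\<^bsub>M\<^esub> a \<odot>\<^bsub>M\<^esub> \<zero>\<^bsub>M\<^esub> = a \<odot>\<^bsub>M\<^esub> \<zero>\<^bsub>M\<^esub>"
    using smult_r_distr[of a "\<zero>\<^bsub>M\<^esub>" "\<zero>\<^bsub>M\<^esub>"] assms by simp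
  then show ?thesis
    using smult_closed[of a "\<zero>\<^bsub>M\<^esub>"] assms by (metis M.add.l_cancel_one' M.zero_closed)
qed

lemma minus_eq_smult:
  assumes "x \<in> carrier M" shows "\<ominus>\<^bsub>M\<^esub> x = (\<ominus>\<^bsub>R\<^esub> \<one>\<^bsub>R\<^esub>) \<odot>\<^bsub>M\<^esub> x"
proof (rule M.minus_equality)
  show "(\<ominus>\<^bsub>R\<^esub> \<one>\<^bsub>R\<^esub>) \<odot>\<^bsub>M\<^esub> x \<oplus>\<^bsub>M\<^esub> x = \<zero>\<^bsub>M\<^esub>"
    using smult_l_distr[of "\<ominus>\<^bsub>R\<^esub> \<one>\<^bsub>R\<^esub>" "\<one>\<^bsub>R\<^esub>" x] assms by (simp add: smult_one R.l_neg)
qed (use assms smult_closed in auto)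

text \<open>Additive inverses come for free: \<open>\<ominus> x\<close> is the multiple of \<open>x\<close> by \<open>\<ominus> \<one>\<close>.\<close>

lemma submodule_iff:
  "submodule U R M \<longleftrightarrow> U \<subseteq> carrier M \<and> \<zero>\<^bsub>M\<^esub> \<in> U \<and> (\<forall>x\<in>U. \<forall>y\<in>U. x \<oplus>\<^bsub>M\<^esub> y \<in> U) \<and>
    (\<forall>a\<in>carrier R. \<forall>x\<in>U. a \<odot>\<^bsub>M\<^esub> x \<in> U)" (is "_ \<longleftrightarrow> ?r")
proof
  assume "submodule U R M"
  then interpret submodule U R M .
  show ?r using subset one_closed m_closed smult_closed by auto
next
  assume r: ?r
  show "submodule U R M"
  proof (intro submodule.intro subgroup.intro submodule_axioms.intro)
    show "inv\<^bsub>add_monoid M\<^esub> x \<in> U" if "x \<in> U" for x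
      using minus_eq_smult[of x] r that R.add.inv_closed[OF R.one_closed]
      unfolding a_inv_def by fastforce
  qed (use r in auto)
qed

lemma submoduleD:
  assumes "submodule U R M"
  shows "U \<subseteq> carrier M" "\<zero>\<^bsub>M\<^esub> \<in> U" "\<And>x y. x \<in> U \<Longrightarrow> y \<in> U \<Longrightarrow> x \<oplus>\<^bsub>M\<^esub> y \<in> U"
    "\<And>a x. a \<in> carrier R \<Longrightarrow> x \<in> U \<Longrightarrow> a \<odot>\<^bsub>M\<^esub> x \<in> U" "\<And>x. x \<in> U \<Longrightarrow> \<ominus>\<^bsub>M\<^esub> x \<in> U"
  using assms minus_eq_smult R.add.inv_closed[OF R.one_closed] unfolding submodule_iff
  by (auto simp: subset_iff)

lemma submodule_carrier: "submodule (carrier M) R M"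
  by (simp add: submodule_iff smult_closed)

lemma submodule_left_module:
  assumes "submodule U R M" shows "left_module R (M\<lparr>carrier := U\<rparr>)"
proof -
  note U = submoduleD[OF assms]
  have "abelian_group (M\<lparr>carrier := U\<rparr>)"
  proof (rule abelian_groupI)
    show "\<exists>y\<in>carrier (M\<lparr>carrier := U\<rparr>). y \<oplus>\<^bsub>M\<lparr>carrier := U\<rparr>\<^esub> x = \<zero>\<^bsub>M\<lparr>carrier := U\<rparr>\<^esub>"
      if "x \<in> carrier (M\<lparr>carrier := U\<rparr>)" for x
      using that U(1,5) M.l_neg by auto
  qed (use U in \<open>auto simp: subset_iff intro: M.a_assoc M.a_comm\<close>)
  then show ?thesis
    using U smult_l_distr smult_r_distr smult_assoc smult_one
    by (intro left_module.intro left_module_axioms.intro R.ring_axioms) (auto simp: subset_iff)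
qed

lemma submodule_restrict_iff:
  assumes "submodule U R M"
  shows "submodule V R (M\<lparr>carrier := U\<rparr>) \<longleftrightarrow> submodule V R M \<and> V \<subseteq> U"
proof -
  interpret U: left_module R "M\<lparr>carrier := U\<rparr>" by (rule submodule_left_module[OF assms])
  show ?thesis using submoduleD(1)[OF assms] unfolding U.submodule_iff submodule_iff by auto
qed

end

lemma lmod_homD:
  assumes "f \<in> lmod_hom R M N"
  shows "\<And>x. x \<in> carrier M \<Longrightarrow> f x \<in> carrier N"
    and "\<And>x y. x \<in> carrier M \<Longrightarrow> y \<in> carrier M \<Longrightarrow> f (x \<oplus>\<^bsub>M\<^esub> y) = f x \<oplus>\<^bsub>N\<^esub> f y"
    and "\<And>a x. a \<in> carrier R \<Longrightarrow> x \<in> carrier M \<Longrightarrow> f (a \<odot>\<^bsub>M\<^esub> x) = a \<odot>\<^bsub>N\<^esub> f x"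
  using assms by (auto simp: lmod_hom_def hom_def)

lemma lmod_homI:
  assumes "\<And>x. x \<in> carrier M \<Longrightarrow> f x \<in> carrier N"
    and "\<And>x y. x \<in> carrier M \<Longrightarrow> y \<in> carrier M \<Longrightarrow> f (x \<oplus>\<^bsub>M\<^esub> y) = f x \<oplus>\<^bsub>N\<^esub> f y"
    and "\<And>a x. a \<in> carrier R \<Longrightarrow> x \<in> carrier M \<Longrightarrow> f (a \<odot>\<^bsub>M\<^esub> x) = a \<odot>\<^bsub>N\<^esub> f x"
  shows "f \<in> lmod_hom R M N"
  using assms by (auto simp: lmod_hom_def hom_def)

lemma lmod_hom_zero:
  assumes "left_module R M" "left_module R N" "f \<in> lmod_hom R M N"
  shows "f \<zero>\<^bsub>M\<^esub> = \<zero>\<^bsub>N\<^esub>"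
proof -
  interpret M: left_module R M by fact
  interpret N: left_module R N by fact
  have "f (\<zero>\<^bsub>R\<^esub> \<odot>\<^bsub>M\<^esub> \<zero>\<^bsub>M\<^esub>) = \<zero>\<^bsub>R\<^esub> \<odot>\<^bsub>N\<^esub> f \<zero>\<^bsub>M\<^esub>"
    using lmod_homD(3)[OF assms(3)] by blast
  then show ?thesis using lmod_homD(1)[OF assms(3)] by simp
qed

lemma lmod_hom_comp:
  assumes "f \<in> lmod_hom R M N" "g \<in> lmod_hom R N L"
  shows "(\<lambda>x. g (f x)) \<in> lmod_hom R M L"
  using lmod_homD[OF assms(1)] lmod_homD[OF assms(2)] by (intro lmod_homI) auto

lemma lmod_hom_restrict:
  assumes "f \<in> lmod_hom R M N" "U \<subseteq> carrier M" "f ` U \<subseteq> V"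
  shows "f \<in> lmod_hom R (M\<lparr>carrier := U\<rparr>) (N\<lparr>carrier := V\<rparr>)"
  using lmod_homD[OF assms(1)] assms(2,3) by (intro lmod_homI) (auto simp: subset_iff)

lemma lmod_hom_image_submodule:
  assumes M: "left_module R M" and N: "left_module R N" and f: "f \<in> lmod_hom R M N"
    and U: "submodule U R M"
  shows "submodule (f ` U) R N"
proof -
  interpret M: left_module R M by fact
  interpret N: left_module R N by fact
  note U = M.submoduleD[OF U] and f' = lmod_homD[OF f]
  have "f x \<oplus>\<^bsub>N\<^esub> f y \<in> f ` U" if "x \<in> U" "y \<in> U" for x y
    using that f'(2)[of x y] U by (metis subset_iff image_eqI)
  moreover have "a \<odot>\<^bsub>N\<^esub> f x \<in> f ` U" if "a \<in> carrier R" "x \<in> U" for a x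
    using that f'(3)[of a x] U by (metis subset_iff image_eqI)
  ultimately show ?thesis
    using U(1) f'(1) imageI[OF U(2), of f] lmod_hom_zero[OF M N f] unfolding N.submodule_iff
    by auto
qed

lemma lmod_hom_kernel_submodule:
  assumes M: "left_module R M" and N: "left_module R N" and f: "f \<in> lmod_hom R M N"
  shows "submodule {x \<in> carrier M. f x = \<zero>\<^bsub>N\<^esub>} R M"
proof -
  interpret M: left_module R M by fact
  interpret N: left_module R N by fact
  show ?thesis
    using lmod_homD[OF f] lmod_hom_zero[OF M N f] unfolding M.submodule_iff
    by (auto simp: M.smult_closed)
qed

lemma lmod_hom_minus:
  assumes M: "left_module R M" and N: "left_module R N" and f: "f \<in> lmod_hom R M N"
    and x: "x \<in> carrier M"
  shows "f (\<ominus>\<^bsub>M\<^esub> x) = \<ominus>\<^bsub>N\<^esub> f x"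
proof -
  interpret M: left_module R M by fact
  interpret N: left_module R N by fact
  show ?thesis
    using lmod_homD[OF f] x by (simp add: M.minus_eq_smult N.minus_eq_smult)
qed

lemma lmod_hom_inj_on:
  assumes M: "left_module R M" and N: "left_module R N" and f: "f \<in> lmod_hom R M N"
    and ker: "\<And>x. x \<in> carrier M \<Longrightarrow> f x = \<zero>\<^bsub>N\<^esub> \<Longrightarrow> x = \<zero>\<^bsub>M\<^esub>"
  shows "inj_on f (carrier M)"
proof (rule inj_onI)
  interpret M: left_module R M by fact
  interpret N: left_module R N by fact
  fix x y assume xy: "x \<in> carrier M" "y \<in> carrier M" "f x = f y"
  then have "f (x \<ominus>\<^bsub>M\<^esub> y) = \<zero>\<^bsub>N\<^esub>"
    using lmod_homD[OF f] lmod_hom_minus[OF M N f] by (simp add: a_minus_def N.M.r_neg)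
  then have "x \<ominus>\<^bsub>M\<^esub> y = \<zero>\<^bsub>M\<^esub>" using ker[of "x \<ominus>\<^bsub>M\<^esub> y"] xy by simp
  moreover have "x = (x \<ominus>\<^bsub>M\<^esub> y) \<oplus>\<^bsub>M\<^esub> y"
    using xy by (simp add: a_minus_def M.M.a_assoc M.M.l_neg)
  ultimately show "x = y" using xy by simp
qed

lemma lmod_iso_sym:
  assumes M: "left_module R M" and N: "left_module R N" and "lmod_iso R M N"
  obtains f g where "f \<in> lmod_hom R M N" "g \<in> lmod_hom R N M"
    "\<And>x. x \<in> carrier M \<Longrightarrow> g (f x) = x" "\<And>y. y \<in> carrier N \<Longrightarrow> f (g y) = y"
proof -
  interpret M: left_module R M by fact
  interpret N: left_module R N by fact
  obtain f where f: "f \<in> lmod_hom R M N" "bij_betw f (carrier M) (carrier N)"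
    using assms(3) unfolding lmod_iso_def by blast
  define g where "g = inv_into (carrier M) f"
  have g: "g y \<in> carrier M" "f (g y) = y" if "y \<in> carrier N" for y
    using f(2) that by (auto simp: g_def bij_betw_def inv_into_into f_inv_into_f)
  have gf: "g (f x) = x" if "x \<in> carrier M" for x
    using f(2) that by (auto simp: g_def bij_betw_def)
  note fD = lmod_homD[OF f(1)]
  have "g \<in> lmod_hom R N M"
  proof (rule lmod_homI)
    show "g (x \<oplus>\<^bsub>N\<^esub> y) = g x \<oplus>\<^bsub>M\<^esub> g y" if "x \<in> carrier N" "y \<in> carrier N" for x y
      using fD(2)[of "g x" "g y"] g that gf[of "g x \<oplus>\<^bsub>M\<^esub> g y"] by simp
    show "g (a \<odot>\<^bsub>N\<^esub> x) = a \<odot>\<^bsub>M\<^esub> g x" if "a \<in> carrier R" "x \<in> carrier N" for a x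
      using fD(3)[of a "g x"] g that gf[of "a \<odot>\<^bsub>M\<^esub> g x"] M.smult_closed by simp
  qed (use g in auto)
  then show thesis using that f(1) gf g(2) by blast
qed

lemma lmod_isoI:
  assumes "f \<in> lmod_hom R M N" "g \<in> lmod_hom R N M"
    and "\<And>x. x \<in> carrier M \<Longrightarrow> g (f x) = x" "\<And>y. y \<in> carrier N \<Longrightarrow> f (g y) = y"
  shows "lmod_iso R M N"
  unfolding lmod_iso_def
  using assms(1) bij_betw_byWitness[of "carrier M" g f "carrier N"] assms(3,4)
    lmod_homD(1)[OF assms(1)] lmod_homD(1)[OF assms(2)] by blast

lemma lmod_iso_commute:
  assumes "left_module R M" "left_module R N" "lmod_iso R M N"
  shows "lmod_iso R N M"
  using lmod_iso_sym[OF assms] lmod_isoI by metis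

lemma lmod_iso_trans:
  assumes "lmod_iso R M N" "lmod_iso R N L"
  shows "lmod_iso R M L"
proof -
  obtain f where f: "f \<in> lmod_hom R M N" "bij_betw f (carrier M) (carrier N)"
    using assms(1) unfolding lmod_iso_def by blast
  obtain g where g: "g \<in> lmod_hom R N L" "bij_betw g (carrier N) (carrier L)"
    using assms(2) unfolding lmod_iso_def by blast
  show ?thesis
    unfolding lmod_iso_def
    using lmod_hom_comp[OF f(1) g(1)] bij_betw_trans[OF f(2) g(2)] by (auto simp: comp_def)
qed

text \<open>First isomorphism theorem. A coset \<open>K +> x\<close> is the fibre of \<open>f\<close> over \<open>f x\<close>.\<close>

lemma quot_lmod_iso:
  assumes M: "left_module R M" and N: "left_module R N" and f: "f \<in> lmod_hom R M N"
    and surj: "f ` carrier M = carrier N"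
    and K: "K = {x \<in> carrier M. f x = \<zero>\<^bsub>N\<^esub>}"
  shows "lmod_iso R (quot_lmod M K) N"
proof -
  interpret M: left_module R M by fact
  interpret N: left_module R N by fact
  note fD = lmod_homD[OF f]
  have coset: "K +>\<^bsub>M\<^esub> x = {y \<in> carrier M. f y = f x}" if x: "x \<in> carrier M" for x
  proof -
    have "y \<in> K +>\<^bsub>M\<^esub> x" if y: "y \<in> carrier M" "f y = f x" for y
    proof -
      have "y = (y \<ominus>\<^bsub>M\<^esub> x) \<oplus>\<^bsub>M\<^esub> x" using x y(1) by (simp add: a_minus_def M.M.a_assoc M.M.l_neg)
      moreover have "y \<ominus>\<^bsub>M\<^esub> x \<in> K"
        using x y fD lmod_hom_minus[OF M N f] by (simp add: K a_minus_def N.M.r_neg)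
      ultimately show ?thesis unfolding a_r_coset_def' by blast
    qed
    then show ?thesis using x fD by (auto simp: a_r_coset_def' K)
  qed
  have cos: "\<exists>x\<in>carrier M. X = {y \<in> carrier M. f y = f x}" if "X \<in> carrier (quot_lmod M K)" for X
    using that coset by (auto simp: quot_lmod_def A_RCOSETS_def')
  define h where "h = (\<lambda>X. f (SOME x. x \<in> X))"
  have h: "h {y \<in> carrier M. f y = f x} = f x" if "x \<in> carrier M" for x
    using someI[of "\<lambda>y. y \<in> {y \<in> carrier M. f y = f x}" x] that by (auto simp: h_def)
  have add: "{y \<in> carrier M. f y = f x} <+>\<^bsub>M\<^esub> {y \<in> carrier M. f y = f z}
      = {y \<in> carrier M. f y = f (x \<oplus>\<^bsub>M\<^esub> z)}" if xz: "x \<in> carrier M" "z \<in> carrier M" for x z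
  proof -
    have "\<exists>u v. u \<in> carrier M \<and> f u = f x \<and> v \<in> carrier M \<and> f v = f z \<and> y = u \<oplus>\<^bsub>M\<^esub> v"
      if y: "y \<in> carrier M" "f y = f x \<oplus>\<^bsub>N\<^esub> f z" for y
    proof (intro exI conjI)
      show "y = (y \<ominus>\<^bsub>M\<^esub> z) \<oplus>\<^bsub>M\<^esub> z" "y \<ominus>\<^bsub>M\<^esub> z \<in> carrier M" "f (y \<ominus>\<^bsub>M\<^esub> z) = f x"
        using y xz fD lmod_hom_minus[OF M N f]
        by (simp_all add: a_minus_def M.M.a_assoc M.M.l_neg N.M.a_assoc N.M.r_neg)
    qed (use xz in auto)
    then show ?thesis using xz fD(2) by (force simp: set_add_def')
  qed
  have smult: "(\<Union>x\<in>{y \<in> carrier M. f y = f z}. K +>\<^bsub>M\<^esub> (a \<odot>\<^bsub>M\<^esub> x)) = {y \<in> carrier M. f y = f (a \<odot>\<^bsub>M\<^esub> z)}"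
    if "a \<in> carrier R" "z \<in> carrier M" for a z
    using that fD(3) by (auto simp: coset M.smult_closed)
  have h_closed: "h X \<in> carrier N" if "X \<in> carrier (quot_lmod M K)" for X
    using cos[OF that] h fD(1) by auto
  have "h \<in> lmod_hom R (quot_lmod M K) N"
  proof (rule lmod_homI)
    show "h (X \<oplus>\<^bsub>quot_lmod M K\<^esub> Y) = h X \<oplus>\<^bsub>N\<^esub> h Y"
      if XY: "X \<in> carrier (quot_lmod M K)" "Y \<in> carrier (quot_lmod M K)" for X Y
    proof -
      obtain x y where "x \<in> carrier M" "y \<in> carrier M" "X = {z \<in> carrier M. f z = f x}"
        "Y = {z \<in> carrier M. f z = f y}" using cos[OF XY(1)] cos[OF XY(2)] by blast
      then show ?thesis using add[of x y] h[of x] h[of y] h[of "x \<oplus>\<^bsub>M\<^esub> y"] fD(2)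
        by (simp add: quot_lmod_def)
    qed
    show "h (a \<odot>\<^bsub>quot_lmod M K\<^esub> X) = a \<odot>\<^bsub>N\<^esub> h X"
      if aX: "a \<in> carrier R" "X \<in> carrier (quot_lmod M K)" for a X
    proof -
      obtain x where "x \<in> carrier M" "X = {z \<in> carrier M. f z = f x}" using cos[OF aX(2)] by blast
      then show ?thesis
        using smult[of a x] aX(1) h[of x] h[of "a \<odot>\<^bsub>M\<^esub> x"] fD(3) M.smult_closed
        by (simp add: quot_lmod_def)
    qed
  qed (rule h_closed)
  moreover have "inj_on h (carrier (quot_lmod M K))"
  proof (rule inj_onI)
    fix X Y assume XY: "X \<in> carrier (quot_lmod M K)" "Y \<in> carrier (quot_lmod M K)" "h X = h Y"
    obtain x y where "x \<in> carrier M" "y \<in> carrier M" "X = {z \<in> carrier M. f z = f x}"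
      "Y = {z \<in> carrier M. f z = f y}" using cos[OF XY(1)] cos[OF XY(2)] by blast
    then show "X = Y" using XY(3) h[of x] h[of y] by simp
  qed
  moreover have "h ` carrier (quot_lmod M K) = carrier N"
  proof
    show "carrier N \<subseteq> h ` carrier (quot_lmod M K)"
    proof
      fix n assume "n \<in> carrier N"
      then obtain x where x: "x \<in> carrier M" "n = f x" using surj by auto
      then have "K +>\<^bsub>M\<^esub> x \<in> carrier (quot_lmod M K)" "h (K +>\<^bsub>M\<^esub> x) = n"
        using h[of x] coset[of x] by (auto simp: quot_lmod_def A_RCOSETS_def')
      then show "n \<in> h ` carrier (quot_lmod M K)" by blast
    qed
  qed (use h_closed in blast)
  ultimately show ?thesis unfolding lmod_iso_def bij_betw_def by blast
qed

text \<open>Indecomposability only speaks of submodules, which an isomorphism carries over.\<close>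

lemma indecomposable_transport:
  assumes M: "left_module R M" and N: "left_module R N" and iso: "lmod_iso R M N"
    and ind: "indecomposable_lmod R M"
  shows "indecomposable_lmod R N"
proof -
  interpret M: left_module R M by fact
  interpret N: left_module R N by fact
  obtain f g where f: "f \<in> lmod_hom R M N" and g: "g \<in> lmod_hom R N M"
    and gf: "\<And>x. x \<in> carrier M \<Longrightarrow> g (f x) = x" and fg: "\<And>y. y \<in> carrier N \<Longrightarrow> f (g y) = y"
    using lmod_iso_sym[OF M N iso] by blast
  have f0: "f \<zero>\<^bsub>M\<^esub> = \<zero>\<^bsub>N\<^esub>" and g0: "g \<zero>\<^bsub>N\<^esub> = \<zero>\<^bsub>M\<^esub>"
    using lmod_hom_zero M N f g by blast+
  have zero: "V = {\<zero>\<^bsub>N\<^esub>}" if "g ` V = {\<zero>\<^bsub>M\<^esub>}" "submodule V R N" for V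
  proof -
    have "y = \<zero>\<^bsub>N\<^esub>" if "y \<in> V" for y
      using \<open>g ` V = {\<zero>\<^bsub>M\<^esub>}\<close> that fg[of y] f0 N.submoduleD(1)[OF \<open>submodule V R N\<close>]
      by (metis imageI singletonD subsetD)
    then show ?thesis using N.submoduleD(2)[OF that(2)] by blast
  qed
  show ?thesis unfolding indecomposable_lmod_def
  proof (intro conjI allI impI)
    show "carrier N \<noteq> {\<zero>\<^bsub>N\<^esub>}"
    proof
      assume N0: "carrier N = {\<zero>\<^bsub>N\<^esub>}"
      have "x = \<zero>\<^bsub>M\<^esub>" if "x \<in> carrier M" for x
        using lmod_homD(1)[OF f that] N0 gf[OF that] g0 by auto
      then show False using ind M.M.zero_closed unfolding indecomposable_lmod_def by blast
    qed
    fix U W assume "internal_dsum R N U W"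
    then have U: "submodule U R N" and W: "submodule W R N" and int: "U \<inter> W = {\<zero>\<^bsub>N\<^esub>}"
      and sum: "U <+>\<^bsub>N\<^esub> W = carrier N" by (auto simp: internal_dsum_def)
    note UD = N.submoduleD[OF U] and WD = N.submoduleD[OF W]
    have gU: "submodule (g ` U) R M" and gW: "submodule (g ` W) R M"
      using lmod_hom_image_submodule[OF N M g] U W by blast+
    have "g ` U \<inter> g ` W \<subseteq> {\<zero>\<^bsub>M\<^esub>}"
    proof
      fix x assume "x \<in> g ` U \<inter> g ` W"
      then obtain u w where uw: "u \<in> U" "w \<in> W" "x = g u" "x = g w" by blast
      then have "u = w" using fg UD(1) WD(1) by (metis subsetD)
      then have "u = \<zero>\<^bsub>N\<^esub>" using uw(1,2) int by blast
      then show "x \<in> {\<zero>\<^bsub>M\<^esub>}" using uw(3) g0 by simp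
    qed
    moreover have "g ` U <+>\<^bsub>M\<^esub> g ` W = carrier M"
    proof
      show "g ` U <+>\<^bsub>M\<^esub> g ` W \<subseteq> carrier M"
        using M.submoduleD(1)[OF gU] M.submoduleD(1)[OF gW] M.M.a_closed unfolding set_add_def' by blast
      show "carrier M \<subseteq> g ` U <+>\<^bsub>M\<^esub> g ` W"
      proof
        fix x assume x: "x \<in> carrier M"
        have "f x \<in> U <+>\<^bsub>N\<^esub> W" using lmod_homD(1)[OF f x] sum by simp
        then obtain u w where uw: "u \<in> U" "w \<in> W" "f x = u \<oplus>\<^bsub>N\<^esub> w" unfolding set_add_def' by blast
        then have "x = g u \<oplus>\<^bsub>M\<^esub> g w"
          using gf[OF x] lmod_homD(2)[OF g, of u w] UD(1) WD(1) by (metis subsetD)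
        then show "x \<in> g ` U <+>\<^bsub>M\<^esub> g ` W" using uw unfolding set_add_def' by blast
      qed
    qed
    ultimately have "internal_dsum R M (g ` U) (g ` W)"
      using gU gW M.submoduleD(2)[OF gU] M.submoduleD(2)[OF gW] unfolding internal_dsum_def by blast
    then have "g ` U = {\<zero>\<^bsub>M\<^esub>} \<or> g ` W = {\<zero>\<^bsub>M\<^esub>}" using ind unfolding indecomposable_lmod_def by blast
    then show "U = {\<zero>\<^bsub>N\<^esub>} \<or> W = {\<zero>\<^bsub>N\<^esub>}" using zero U W by blast
  qed
qed

section \<open>Radicals under isomorphisms\<close>

lemma maximal_submodule_image:
  assumes M: "left_module R M" and N: "left_module R N"
    and f: "f \<in> lmod_hom R M N" and g: "g \<in> lmod_hom R N M"
    and gf: "\<And>x. x \<in> carrier M \<Longrightarrow> g (f x) = x" and fg: "\<And>y. y \<in> carrier N \<Longrightarrow> f (g y) = y"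
    and max: "maximal_submodule R M U"
  shows "maximal_submodule R N (f ` U)"
proof -
  interpret M: left_module R M by fact
  interpret N: left_module R N by fact
  have U: "submodule U R M" "U \<noteq> carrier M" using max by (auto simp: maximal_submodule_def)
  have gf': "g ` f ` V = V" if "V \<subseteq> carrier M" for V
    using that gf by (force simp: image_image)
  have fg': "f ` g ` V = V" if "V \<subseteq> carrier N" for V
    using that fg by (force simp: image_image)
  have carr: "f ` carrier M = carrier N" "g ` carrier N = carrier M"
  proof -
    have "y \<in> f ` carrier M" if "y \<in> carrier N" for y
      using fg[OF that] lmod_homD(1)[OF g that] by (metis image_eqI)
    then show "f ` carrier M = carrier N" using lmod_homD(1)[OF f] by blast
    have "x \<in> g ` carrier N" if "x \<in> carrier M" for x
      using gf[OF that] lmod_homD(1)[OF f that] by (metis image_eqI)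
    then show "g ` carrier N = carrier M" using lmod_homD(1)[OF g] by blast
  qed
  show ?thesis unfolding maximal_submodule_def
  proof (intro conjI allI impI)
    show "submodule (f ` U) R N" by (rule lmod_hom_image_submodule[OF M N f U(1)])
    show "f ` U \<noteq> carrier N"
      using U gf'[of U] M.submoduleD(1)[OF U(1)] carr by metis
    fix L assume L: "submodule L R N \<and> f ` U \<subseteq> L"
    then have "submodule (g ` L) R M" "U \<subseteq> g ` L"
      using lmod_hom_image_submodule[OF N M g] gf'[of U] M.submoduleD(1)[OF U(1)] by blast+
    then have "g ` L = U \<or> g ` L = carrier M" using max by (auto simp: maximal_submodule_def)
    then show "L = f ` U \<or> L = carrier N"
      using fg'[of L] N.submoduleD(1)[of L] L carr by metis
  qed
qed

lemma rad_image:
  assumes M: "left_module R M" and N: "left_module R N"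
    and f: "f \<in> lmod_hom R M N" and g: "g \<in> lmod_hom R N M"
    and gf: "\<And>x. x \<in> carrier M \<Longrightarrow> g (f x) = x" and fg: "\<And>y. y \<in> carrier N \<Longrightarrow> f (g y) = y"
  shows "rad R N = f ` rad R M"
proof -
  have sub: "f ` rad R M \<subseteq> rad R N"
    if M: "left_module R M" and N: "left_module R N"
    and f: "f \<in> lmod_hom R M N" and g: "g \<in> lmod_hom R N M"
    and gf: "\<And>x. x \<in> carrier M \<Longrightarrow> g (f x) = x" and fg: "\<And>y. y \<in> carrier N \<Longrightarrow> f (g y) = y"
    for M :: "('a, 'x, 'y) module_scheme" and N :: "('a, 'z, 'w) module_scheme" and f g
  proof
    interpret M: left_module R M by fact
    interpret N: left_module R N by fact
    fix y assume "y \<in> f ` rad R M"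
    then obtain x where x: "x \<in> carrier M" "\<And>U. maximal_submodule R M U \<Longrightarrow> x \<in> U" "y = f x"
      by (auto simp: rad_def)
    have "f x \<in> V" if V: "maximal_submodule R N V" for V
    proof -
      have "x \<in> g ` V" using x(2) maximal_submodule_image[OF N M g f fg gf V] by blast
      moreover have "V \<subseteq> carrier N" using V N.submoduleD(1) by (auto simp: maximal_submodule_def)
      ultimately show ?thesis using fg by auto
    qed
    then show "y \<in> rad R N" using x lmod_homD(1)[OF f] by (auto simp: rad_def)
  qed
  have "rad R N \<subseteq> carrier N" by (auto simp: rad_def)
  then have "(\<lambda>y. f (g y)) ` rad R N = (\<lambda>y. y) ` rad R N"
    using fg by (intro image_cong) auto
  then have "f ` g ` rad R N = rad R N" by (simp add: image_image)
  then show ?thesis using sub[OF M N f g gf fg] sub[OF N M g f fg gf] by blast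
qed

lemma (in left_module) submodule_rad: "submodule (rad R M) R M"
  unfolding submodule_iff
  using submoduleD smult_closed by (auto simp: rad_def maximal_submodule_def)

lemma (in left_module) submodule_rad_pow: "submodule (rad_pow R M n) R M"
proof (induction n)
  case (Suc n)
  then show ?case
    using left_module.submodule_rad[OF submodule_left_module[OF Suc]]
    by (simp add: submodule_restrict_iff)
qed (simp add: submodule_carrier)

lemma rad_pow_image:
  assumes M: "left_module R M" and N: "left_module R N"
    and f: "f \<in> lmod_hom R M N" and g: "g \<in> lmod_hom R N M"
    and gf: "\<And>x. x \<in> carrier M \<Longrightarrow> g (f x) = x" and fg: "\<And>y. y \<in> carrier N \<Longrightarrow> f (g y) = y"
  shows "rad_pow R N n = f ` rad_pow R M n"
proof (induction n)
  case 0
  show ?case using lmod_homD(1)[OF f] lmod_homD(1)[OF g] fg by force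
next
  case (Suc n)
  interpret M: left_module R M by fact
  interpret N: left_module R N by fact
  note sM = M.submodule_rad_pow[of n] and sN = N.submodule_rad_pow[of n]
  have sub: "rad_pow R M n \<subseteq> carrier M" "rad_pow R N n \<subseteq> carrier N"
    using M.submoduleD(1)[OF sM] N.submoduleD(1)[OF sN] .
  have "g ` rad_pow R N n \<subseteq> rad_pow R M n" using Suc gf sub by auto
  moreover have "f ` rad_pow R M n \<subseteq> rad_pow R N n" using Suc by simp
  ultimately have "rad R (N\<lparr>carrier := rad_pow R N n\<rparr>) = f ` rad R (M\<lparr>carrier := rad_pow R M n\<rparr>)"
    using gf fg sub
    by (intro rad_image[OF M.submodule_left_module[OF sM] N.submodule_left_module[OF sN]
        lmod_hom_restrict[OF f sub(1)] lmod_hom_restrict[OF g sub(2)]]) auto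
  then show ?case by simp
qed

lemma radical_layer_iso:
  assumes M: "left_module R M" and L: "left_module R L"
    and f: "f \<in> lmod_hom R (M\<lparr>carrier := rad_pow R M n\<rparr>) L"
    and surj: "f ` rad_pow R M n = carrier L"
    and ker: "rad_pow R M (Suc n) = {x \<in> rad_pow R M n. f x = \<zero>\<^bsub>L\<^esub>}"
  shows "lmod_iso R (radical_layer R M (Suc n)) L"
proof -
  interpret M: left_module R M by fact
  show ?thesis
    using quot_lmod_iso[OF M.submodule_left_module[OF M.submodule_rad_pow] L f] surj ker
    by (simp add: radical_layer_def)
qed

text \<open>The layers of an isomorphic copy \<open>N\<close> are described by homomorphisms given on \<open>M\<close>; the
  radicals are thus computed only in the concrete modules \<open>E \<zeta>\<close>.\<close>

lemma radical_layer_iso_transport: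
  assumes M: "left_module R M" and N: "left_module R N" and iso: "lmod_iso R M N"
    and L: "left_module R L"
    and f: "f \<in> lmod_hom R (M\<lparr>carrier := rad_pow R M n\<rparr>) L"
    and surj: "f ` rad_pow R M n = carrier L"
    and ker: "rad_pow R M (Suc n) = {x \<in> rad_pow R M n. f x = \<zero>\<^bsub>L\<^esub>}"
  shows "lmod_iso R (radical_layer R N (Suc n)) L"
proof -
  interpret M: left_module R M by fact
  interpret N: left_module R N by fact
  obtain i j where i: "i \<in> lmod_hom R M N" "j \<in> lmod_hom R N M"
    "\<And>x. x \<in> carrier M \<Longrightarrow> j (i x) = x" "\<And>y. y \<in> carrier N \<Longrightarrow> i (j y) = y"
    using lmod_iso_sym[OF M N iso] by blast
  have eq: "rad_pow R N n = i ` rad_pow R M n" for n by (rule rad_pow_image[OF M N i])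
  have sub: "rad_pow R M n \<subseteq> carrier M" "rad_pow R N n \<subseteq> carrier N"
    using M.submoduleD(1)[OF M.submodule_rad_pow] N.submoduleD(1)[OF N.submodule_rad_pow] .
  have j: "j ` rad_pow R N n = rad_pow R M n"
    using i(3) sub(1) unfolding eq by (force simp: image_image)
  show ?thesis
  proof (rule radical_layer_iso[OF N L])
    show "(\<lambda>x. f (j x)) \<in> lmod_hom R (N\<lparr>carrier := rad_pow R N n\<rparr>) L"
      by (rule lmod_hom_comp[OF lmod_hom_restrict[OF i(2) sub(2)] f]) (simp add: j)
    show "(\<lambda>x. f (j x)) ` rad_pow R N n = carrier L"
      using j surj by (metis image_image)
    show "rad_pow R N (Suc n) = {x \<in> rad_pow R N n. f (j x) = \<zero>\<^bsub>L\<^esub>}"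
      unfolding eq ker using i(3) sub(1) by auto
  qed
qed

section \<open>The group algebra of a finite group\<close>

definition scale :: "'k::field \<Rightarrow> ('g \<Rightarrow> 'k) \<Rightarrow> 'g \<Rightarrow> 'k"
  where "scale r f = (\<lambda>x. r * f x)"

lemma scale_apply: "scale r f x = r * f x"
  by (simp add: scale_def)

lemma scale_simps:
  "scale r (f + h) = scale r f + scale r h" "scale (r + s) f = scale r f + scale s f"
  "scale r (scale s f) = scale (r * s) f" "scale 1 f = f" "scale 0 f = 0" "scale r 0 = 0"
  by (auto simp: scale_def fun_eq_iff algebra_simps)

lemma group_algebra_simps:
  "f \<in> carrier (group_algebra G) \<longleftrightarrow> (\<forall>g. g \<notin> carrier G \<longrightarrow> f g = 0)"
  "f \<oplus>\<^bsub>group_algebra G\<^esub> h = f + h"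
  "\<zero>\<^bsub>group_algebra G\<^esub> = 0"
  "\<one>\<^bsub>group_algebra G\<^esub> = group_elem \<one>\<^bsub>G\<^esub>"
  by (auto simp: group_algebra_def group_elem_def fun_eq_iff)

lemma group_algebra_mult:
  "(f \<otimes>\<^bsub>group_algebra G\<^esub> h) g =
    (if g \<in> carrier G then \<Sum>x\<in>carrier G. f x * h (inv\<^bsub>G\<^esub> x \<otimes>\<^bsub>G\<^esub> g) else 0)"
  by (simp add: group_algebra_def)

text \<open>The identities for convolution are stated on all functions, not only on those supported in the
  group, so that products can be expanded by rewriting alone.\<close>


lemma conv_simps:
  "(f + f') \<otimes>\<^bsub>group_algebra G\<^esub> h = f \<otimes>\<^bsub>group_algebra G\<^esub> h + f' \<otimes>\<^bsub>group_algebra G\<^esub> h"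
  "h \<otimes>\<^bsub>group_algebra G\<^esub> (f + f') = h \<otimes>\<^bsub>group_algebra G\<^esub> f + h \<otimes>\<^bsub>group_algebra G\<^esub> f'"
  "scale r f \<otimes>\<^bsub>group_algebra G\<^esub> h = scale r (f \<otimes>\<^bsub>group_algebra G\<^esub> h)"
  "f \<otimes>\<^bsub>group_algebra G\<^esub> scale r h = scale r (f \<otimes>\<^bsub>group_algebra G\<^esub> h)"
  "0 \<otimes>\<^bsub>group_algebra G\<^esub> h = 0" "h \<otimes>\<^bsub>group_algebra G\<^esub> 0 = 0"
  by (auto simp: scale_def fun_eq_iff group_algebra_mult algebra_simps sum.distrib sum_distrib_left
      intro!: sum.cong)

lemma group_algebra_closed:
  "f \<in> carrier (group_algebra G) \<Longrightarrow> h \<in> carrier (group_algebra G) \<Longrightarrow> f + h \<in> carrier (group_algebra G)"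
  "f \<in> carrier (group_algebra G) \<Longrightarrow> scale r f \<in> carrier (group_algebra G)"
  "0 \<in> carrier (group_algebra G)"
  "f \<otimes>\<^bsub>group_algebra G\<^esub> h \<in> carrier (group_algebra G)"
  "g \<in> carrier G \<Longrightarrow> group_elem g \<in> carrier (group_algebra G)"
  by (auto simp: scale_def group_algebra_simps group_algebra_mult group_elem_def)

locale finite_group = group +
  assumes finite_carrier: "finite (carrier G)"
begin

lemma conv_assoc:
  "f \<otimes>\<^bsub>group_algebra G\<^esub> h \<otimes>\<^bsub>group_algebra G\<^esub> k = f \<otimes>\<^bsub>group_algebra G\<^esub> (h \<otimes>\<^bsub>group_algebra G\<^esub> k)"
proof (rule ext)
  fix g
  show "(f \<otimes>\<^bsub>group_algebra G\<^esub> h \<otimes>\<^bsub>group_algebra G\<^esub> k) g =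
    (f \<otimes>\<^bsub>group_algebra G\<^esub> (h \<otimes>\<^bsub>group_algebra G\<^esub> k)) g"
  proof (cases "g \<in> carrier G")
    case g: True
    have inv_cancel: "y \<otimes> (inv y \<otimes> x) = x" "inv y \<otimes> (y \<otimes> x) = x"
      if "y \<in> carrier G" "x \<in> carrier G" for x y
      using that by (simp_all add: m_assoc[symmetric])
    have "(f \<otimes>\<^bsub>group_algebra G\<^esub> h \<otimes>\<^bsub>group_algebra G\<^esub> k) g
      = (\<Sum>x\<in>carrier G. \<Sum>y\<in>carrier G. f y * h (inv y \<otimes> x) * k (inv x \<otimes> g))"
      using g by (simp add: group_algebra_mult sum_distrib_right)
    also have "\<dots> = (\<Sum>y\<in>carrier G. \<Sum>x\<in>carrier G. f y * h (inv y \<otimes> x) * k (inv x \<otimes> g))"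
      by (rule sum.swap)
    also have "\<dots> = (\<Sum>y\<in>carrier G. \<Sum>z\<in>carrier G. f y * (h z * k (inv z \<otimes> (inv y \<otimes> g))))"
    proof (rule sum.cong[OF refl])
      fix y assume y: "y \<in> carrier G"
      show "(\<Sum>x\<in>carrier G. f y * h (inv y \<otimes> x) * k (inv x \<otimes> g))
        = (\<Sum>z\<in>carrier G. f y * (h z * k (inv z \<otimes> (inv y \<otimes> g))))"
        by (rule sum.reindex_bij_witness[of _ "\<lambda>z. y \<otimes> z" "\<lambda>x. inv y \<otimes> x"])
          (use y g in \<open>simp_all add: inv_cancel inv_mult_group m_assoc mult.assoc\<close>)
    qed
    also have "\<dots> = (f \<otimes>\<^bsub>group_algebra G\<^esub> (h \<otimes>\<^bsub>group_algebra G\<^esub> k)) g"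
      using g by (simp add: group_algebra_mult sum_distrib_left)
    finally show ?thesis .
  qed (simp add: group_algebra_mult)
qed

lemma group_elem_conv:
  assumes "x \<in> carrier G"
  shows "(group_elem x \<otimes>\<^bsub>group_algebra G\<^esub> f) g = (if g \<in> carrier G then f (inv x \<otimes> g) else 0)"
proof -
  have "(\<Sum>y\<in>carrier G. group_elem x y * f (inv y \<otimes> g)) = (\<Sum>y\<in>carrier G. if y = x then f (inv x \<otimes> g) else 0)"
    by (rule sum.cong) (auto simp: group_elem_def)
  then show ?thesis using finite_carrier assms by (simp add: group_algebra_mult)
qed

lemma group_elem_mult:
  assumes "x \<in> carrier G" "y \<in> carrier G"
  shows "group_elem x \<otimes>\<^bsub>group_algebra G\<^esub> group_elem y = group_elem (x \<otimes> y)"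
proof (rule ext)
  fix g
  have "inv x \<otimes> g = y \<longleftrightarrow> g = x \<otimes> y" if "g \<in> carrier G"
    using assms that inv_solve_left[of y x g] by metis
  then show "(group_elem x \<otimes>\<^bsub>group_algebra G\<^esub> group_elem y) g = group_elem (x \<otimes> y) g"
    unfolding group_elem_conv[OF assms(1)] using m_closed[OF assms] by (simp add: group_elem_def) blast
qed

lemma conv_one_left:
  assumes "f \<in> carrier (group_algebra G)" shows "group_elem \<one> \<otimes>\<^bsub>group_algebra G\<^esub> f = f"
  using assms by (auto simp: fun_eq_iff group_elem_conv group_algebra_simps)

lemma group_algebra_expand:
  assumes "f \<in> carrier (group_algebra G)"
  shows "f = (\<Sum>g\<in>carrier G. scale (f g) (group_elem g))"
proof (rule ext)
  fix x
  have "(\<Sum>g\<in>S. scale (f g) (group_elem g)) x = (if x \<in> S then f x else 0)" if "finite S" for S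
    using that by induction (auto simp: group_elem_def scale_def)
  then show "f x = (\<Sum>g\<in>carrier G. scale (f g) (group_elem g)) x"
    using assms finite_carrier by (auto simp: group_algebra_simps)
qed

lemma group_algebra_induct [consumes 1, case_names add scale elem]:
  assumes f: "f \<in> carrier (group_algebra G)"
    and add: "\<And>f h. f \<in> carrier (group_algebra G) \<Longrightarrow> h \<in> carrier (group_algebra G) \<Longrightarrow> P f \<Longrightarrow> P h \<Longrightarrow> P (f + h)"
    and scale: "\<And>r f. f \<in> carrier (group_algebra G) \<Longrightarrow> P f \<Longrightarrow> P (scale r f)"
    and elem: "\<And>g. g \<in> carrier G \<Longrightarrow> P (group_elem g)"
  shows "P f"
proof -
  have zero: "P 0" using scale[of "group_elem \<one>" 0] elem[of \<one>] by (simp add: scale_simps group_algebra_closed)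
  have "(\<Sum>g\<in>S. scale (f g) (group_elem g)) \<in> carrier (group_algebra G) \<and>
      P (\<Sum>g\<in>S. scale (f g) (group_elem g))" if "finite S" "S \<subseteq> carrier G" for S
    using that
  proof induction
    case (insert x S)
    define t where "t = scale (f x) (group_elem x)"
    define u where "u = (\<Sum>g\<in>S. scale (f g) (group_elem g))"
    have x: "x \<in> carrier G" using insert.prems by blast
    have "t \<in> carrier (group_algebra G)" "P t"
      unfolding t_def
      by (rule group_algebra_closed(2)[OF group_algebra_closed(5)[OF x]],
          rule scale[OF group_algebra_closed(5)[OF x] elem[OF x]])
    moreover have "u \<in> carrier (group_algebra G)" "P u"
      using insert unfolding u_def by blast+
    ultimately have "t + u \<in> carrier (group_algebra G) \<and> P (t + u)"
      using add group_algebra_closed(1) by blast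
    then show ?case by (simp only: sum.insert[OF insert.hyps(1,2)] t_def u_def)
  qed (simp_all add: zero group_algebra_closed)
  then have "P (\<Sum>g\<in>carrier G. scale (f g) (group_elem g))" using finite_carrier by blast
  then show ?thesis by (subst group_algebra_expand[OF f])
qed

lemma conv_one_right:
  assumes "f \<in> carrier (group_algebra G)" shows "f \<otimes>\<^bsub>group_algebra G\<^esub> group_elem \<one> = f"
  using assms by (induction rule: group_algebra_induct) (simp_all add: conv_simps group_elem_mult del: plus_fun_apply)

lemma ring_group_algebra: "ring (group_algebra G :: (_ \<Rightarrow> 'k::field) ring)"
proof (rule ringI)
  show "abelian_group (group_algebra G :: (_ \<Rightarrow> 'k::field) ring)"
  proof (rule abelian_groupI)
    fix x :: "'a \<Rightarrow> 'k" assume "x \<in> carrier (group_algebra G)"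
    then show "\<exists>y\<in>carrier (group_algebra G). y \<oplus>\<^bsub>group_algebra G\<^esub> x = \<zero>\<^bsub>group_algebra G\<^esub>"
      by (intro bexI[of _ "- x"]) (auto simp: group_algebra_simps)
  qed (auto simp: group_algebra_simps algebra_simps)
  show "monoid (group_algebra G :: (_ \<Rightarrow> 'k::field) ring)"
    by (rule monoidI)
      (auto simp: group_algebra_simps(4) group_algebra_closed conv_assoc conv_one_left conv_one_right)
qed (simp_all add: group_algebra_simps conv_simps)

end

section \<open>Regular modules, free modules and direct sums\<close>

lemma regular_lmod_simps [simp]:
  "carrier (regular_lmod R) = carrier R" "\<zero>\<^bsub>regular_lmod R\<^esub> = \<zero>\<^bsub>R\<^esub>"
  "add (regular_lmod R) = add R" "module.smult (regular_lmod R) = monoid.mult R"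
  by (simp_all add: regular_lmod_def)

lemma left_module_regular:
  assumes "ring R" shows "left_module R (regular_lmod R)"
proof -
  interpret R: ring R by fact
  have "abelian_group (regular_lmod R)"
  proof (rule abelian_groupI)
    fix x assume x: "x \<in> carrier (regular_lmod R)"
    show "\<exists>y\<in>carrier (regular_lmod R). y \<oplus>\<^bsub>regular_lmod R\<^esub> x = \<zero>\<^bsub>regular_lmod R\<^esub>"
      by (intro bexI[of _ "\<ominus>\<^bsub>R\<^esub> x"]) (use x R.l_neg in simp_all)
  qed (auto simp: R.a_ac)
  then show ?thesis
    by (intro left_module.intro left_module_axioms.intro assms)
      (auto simp: R.l_distr R.r_distr R.m_assoc)
qed

lemma free_lmod_simps:
  "x \<in> carrier (free_lmod R n) \<longleftrightarrow> (\<forall>i<n. x i \<in> carrier R) \<and> (\<forall>i\<ge>n. x i = undefined)"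
  "\<zero>\<^bsub>free_lmod R n\<^esub> = (\<lambda>i. if i < n then \<zero>\<^bsub>R\<^esub> else undefined)"
  "x \<oplus>\<^bsub>free_lmod R n\<^esub> y = (\<lambda>i. if i < n then x i \<oplus>\<^bsub>R\<^esub> y i else undefined)"
  "a \<odot>\<^bsub>free_lmod R n\<^esub> x = (\<lambda>i. if i < n then a \<otimes>\<^bsub>R\<^esub> x i else undefined)"
  by (auto simp: free_lmod_def PiE_iff extensional_def restrict_def)

lemma left_module_free:
  assumes "ring R" shows "left_module R (free_lmod R n)"
proof -
  interpret R: ring R by fact
  have "abelian_group (free_lmod R n)"
  proof (rule abelian_groupI)
    fix x assume x: "x \<in> carrier (free_lmod R n)"
    then show "\<exists>y\<in>carrier (free_lmod R n). y \<oplus>\<^bsub>free_lmod R n\<^esub> x = \<zero>\<^bsub>free_lmod R n\<^esub>"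
      by (intro bexI[of _ "\<lambda>i. if i < n then \<ominus>\<^bsub>R\<^esub> x i else undefined"])
        (simp_all add: free_lmod_simps R.l_neg fun_eq_iff)
  qed (simp_all add: free_lmod_simps R.a_ac fun_eq_iff)
  then show ?thesis
    by (intro left_module.intro left_module_axioms.intro assms)
      (simp_all add: free_lmod_simps R.l_distr R.r_distr R.m_assoc fun_eq_iff)
qed

lemma left_module_dsum:
  assumes "left_module R M" "left_module R N" shows "left_module R (dsum M N)"
proof -
  interpret M: left_module R M by fact
  interpret N: left_module R N by fact
  have "abelian_group (dsum M N)"
  proof (rule abelian_groupI)
    fix x assume "x \<in> carrier (dsum M N)"
    then show "\<exists>y\<in>carrier (dsum M N). y \<oplus>\<^bsub>dsum M N\<^esub> x = \<zero>\<^bsub>dsum M N\<^esub>"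
      by (intro bexI[of _ "(\<ominus>\<^bsub>M\<^esub> fst x, \<ominus>\<^bsub>N\<^esub> snd x)"])
        (auto simp: dsum_def M.M.l_neg N.M.l_neg)
  qed (auto simp: dsum_def M.M.a_ac N.M.a_ac)
  then show ?thesis
    by (intro left_module.intro left_module_axioms.intro M.R.ring_axioms)
      (auto simp: dsum_def M.smult_closed N.smult_closed M.smult_l_distr N.smult_l_distr
        M.smult_r_distr N.smult_r_distr M.smult_assoc N.smult_assoc M.smult_one N.smult_one)
qed

section \<open>The group \<open>A\<^sub>4\<close>\<close>

definition va :: "nat \<Rightarrow> nat" where "va = transpose 1 2 \<circ> transpose 3 4"
definition vb :: "nat \<Rightarrow> nat" where "vb = transpose 1 3 \<circ> transpose 2 4"
definition vd :: "nat \<Rightarrow> nat" where "vd = transpose 1 4 \<circ> transpose 2 3"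

lemma V4_names: "V4 = {id, va, vb, vd}"
  by (simp only: V4_eq va_def vb_def vd_def)

interpretation A4: finite_group A4
proof (intro finite_group.intro finite_group_axioms.intro alt_group_is_group)
  show "finite (carrier A4)"
    by (rule finite_subset[of _ "{p. p permutes {1..4}}"])
       (auto simp: alt_group_carrier finite_permutations)
qed

lemma A4_mem: "id \<in> carrier A4" "va \<in> carrier A4" "vb \<in> carrier A4" "vd \<in> carrier A4"
  "c123 \<in> carrier A4" "x \<in> carrier A4 \<Longrightarrow> y \<in> carrier A4 \<Longrightarrow> x \<circ> y \<in> carrier A4"
  using V4_mem_A4 c123_mem_A4 A4.one_closed A4.m_closed[of x y]
  by (simp_all only: va_def vb_def vd_def alt_group_one alt_group_mult)

lemma A4_apply:
  "c123 1 = 2" "c123 2 = 3" "c123 3 = 1" "c123 4 = 4"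
  "va 1 = 2" "va 2 = 1" "va 3 = 4" "va 4 = 3"
  "vb 1 = 3" "vb 2 = 4" "vb 3 = 1" "vb 4 = 2"
  "vd 1 = 4" "vd 2 = 3" "vd 3 = 2" "vd 4 = 1"
  by (simp_all add: c123_def va_def vb_def vd_def transpose_def)

lemma A4_eqI:
  assumes "f \<in> carrier A4" "g \<in> carrier A4" "f 1 = g 1" "f 2 = g 2" "f 3 = g 3" "f 4 = g 4"
  shows "f = g"
proof (rule ext)
  fix n :: nat
  have "n \<in> {1..4} \<Longrightarrow> n = 1 \<or> n = 2 \<or> n = 3 \<or> n = 4" by auto
  then show "f n = g n"
    using assms by (cases "n \<in> {1..4}") (auto simp: alt_group_carrier permutes_not_in)
qed

lemma V4_table: "va \<circ> va = id" "vb \<circ> vb = id" "vd \<circ> vd = id" "va \<circ> vb = vd" "vb \<circ> va = vd"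
  "va \<circ> vd = vb" "vd \<circ> va = vb" "vb \<circ> vd = va" "vd \<circ> vb = va"
  by (rule A4_eqI; (intro A4_mem)?; simp only: comp_apply id_apply A4_apply)+

lemma c123_conj: "c123 \<circ> va = vd \<circ> c123" "c123 \<circ> vb = va \<circ> c123" "c123 \<circ> vd = vb \<circ> c123"
  "c123 \<circ> (c123 \<circ> c123) = id"
  by (rule A4_eqI; (intro A4_mem)?; simp only: comp_apply id_apply A4_apply)+

lemma c123_power_mem: "(c123 ^^ j) \<in> carrier A4"
  by (induction j) (simp_all only: funpow.simps A4_mem)

text \<open>The twelve products on the right are distinct by uniqueness of the exponent.\<close>

lemma A4_eq: "carrier A4 = (\<lambda>(j, v). (c123 ^^ j) \<circ> v) ` ({..<3} \<times> V4)"
proof -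
  let ?f = "\<lambda>(j, v). (c123 ^^ j) \<circ> v"
  have "V4 \<subseteq> carrier A4" using A4_mem by (auto simp: V4_names)
  then have sub: "?f ` ({..<3} \<times> V4) \<subseteq> carrier A4" using c123_power_mem by (auto intro: A4_mem(6))
  have "inj_on ?f ({..<3} \<times> V4)"
  proof (rule inj_onI, clarify)
    fix i v j w assume ij: "i < (3::nat)" "j < (3::nat)" "v \<in> V4" "w \<in> V4"
      and eq: "(c123 ^^ i) \<circ> v = (c123 ^^ j) \<circ> w"
    then have "i = j" using V4_exponent_eq by metis
    moreover have "inj (c123 ^^ j)"
      using c123_power_mem[of j] by (auto simp: alt_group_carrier permutes_inj)
    ultimately show "i = j \<and> v = w" using eq by (auto simp: fun_eq_iff inj_def)
  qed
  then have "card (?f ` ({..<3} \<times> V4)) = 3 * card V4" by (simp add: card_image card_cartesian_product)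
  moreover have "card V4 = 4"
  proof -
    have "id \<noteq> va" "id \<noteq> vb" "id \<noteq> vd" "va \<noteq> vb" "va \<noteq> vd" "vb \<noteq> vd"
      by - (rule notI, drule fun_cong[of _ _ 1], (simp only: A4_apply id_apply; simp))+
    then show ?thesis by (simp add: V4_names)
  qed
  moreover have "card (carrier A4) = 12"
    using alt_group_card_carrier[of 4] by (simp add: fact_numeral)
  ultimately show ?thesis
    using card_subset_eq[OF A4.finite_carrier sub] by simp
qed

lemma A4_cases:
  assumes "g \<in> carrier A4"
  obtains j v where "j < 3" "v \<in> V4" "g = (c123 ^^ j) \<circ> v" "V4_exponent g = j"
  using assms V4_exponent_eq unfolding A4_eq by auto

section \<open>Generators and relations of \<open>kA\<^sub>4\<close> in characteristic 2\<close>

abbreviation conv :: "((nat \<Rightarrow> nat) \<Rightarrow> 'k::field) \<Rightarrow> ((nat \<Rightarrow> nat) \<Rightarrow> 'k) \<Rightarrow> (nat \<Rightarrow> nat) \<Rightarrow> 'k"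
    (infixl "\<star>" 70)
  where "x \<star> y \<equiv> x \<otimes>\<^bsub>kA4\<^esub> y"

lemmas kA4_closed = group_algebra_closed[where G = A4]

lemma ge_mult: "x \<in> carrier A4 \<Longrightarrow> y \<in> carrier A4 \<Longrightarrow> group_elem x \<star> group_elem y = group_elem (x \<circ> y)"
  using A4.group_elem_mult[of x y] unfolding alt_group_mult .

lemma ge_id: "f \<in> carrier kA4 \<Longrightarrow> group_elem id \<star> f = f" "f \<in> carrier kA4 \<Longrightarrow> f \<star> group_elem id = f"
  using A4.conv_one_left A4.conv_one_right by (simp_all only: alt_group_one)

locale kA4_char2 =
  fixes \<omega> :: "'k::field"
  assumes two: "(1::'k) + 1 = 0" and omega: "\<omega>\<^sup>2 + \<omega> + 1 = 0"
begin

abbreviation ge :: "(nat \<Rightarrow> nat) \<Rightarrow> (nat \<Rightarrow> nat) \<Rightarrow> 'k" where "ge \<equiv> group_elem"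

text \<open>The eigenvectors of the conjugation by \<open>c123\<close> on the span of the involutions \<open>va\<close>, \<open>vb\<close>, \<open>vd\<close>,
  which it permutes cyclically; the eigenvalues are \<open>\<omega>\<close> and \<open>\<omega>\<^sup>2\<close>. The third eigenvector is
  recovered as \<open>p \<star> q\<close> up to the identity element.\<close>

definition "p = ge va + scale \<omega> (ge vb) + scale (\<omega>\<^sup>2) (ge vd)"
definition "q = ge va + scale (\<omega>\<^sup>2) (ge vb) + scale \<omega> (ge vd)"

text \<open>The idempotent of the cyclic group generated by \<open>c123\<close> on which \<open>c123\<close> acts as \<open>\<zeta>\<close>. The usual
  factor \<open>1/3\<close> is 1 in characteristic 2, and \<open>\<zeta>\<^sup>2 = 1/\<zeta>\<close>.\<close>

definition "e \<zeta> = ge id + scale (\<zeta>\<^sup>2) (ge c123) + scale \<zeta> (ge (c123 \<circ> c123))"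

text \<open>The set of cube roots of unity.\<close>

definition "Z = {1, \<omega>, \<omega>\<^sup>2}"

lemma char2: "x + x = (0::'k)" "x + (x + y) = (y::'k)" "(numeral (Num.Bit0 n) :: 'k) = 0"
  "(numeral (Num.Bit1 n) :: 'k) = 1"
proof -
  show xx: "x + x = (0::'k)" for x using two distrib_left[of x 1 1] by simp
  show "x + (x + y) = (y::'k)" by (simp add: xx add.assoc[symmetric])
  show "(numeral (Num.Bit0 n) :: 'k) = 0" "(numeral (Num.Bit1 n) :: 'k) = 1"
    by (simp_all only: numeral.simps xx add_0)
qed

text \<open>Together with \<open>char2\<close>, rewriting \<open>\<omega>\<^sup>2\<close> to \<open>\<omega> + 1\<close> decides the identities between polynomial
  expressions in \<open>\<omega>\<close> below.\<close>

lemma omega_sq: "\<omega> * \<omega> = \<omega> + 1" "\<omega> * (\<omega> * x) = \<omega> * x + x"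
proof -
  have "\<omega> * \<omega> + (\<omega> + 1) + (\<omega> + 1) = 0 + (\<omega> + 1)" using omega by (simp add: power2_eq_square add.assoc)
  then show 1: "\<omega> * \<omega> = \<omega> + 1" by (simp only: add.assoc char2 add_0 add_0_right)
  show "\<omega> * (\<omega> * x) = \<omega> * x + x" by (simp add: 1 mult.assoc[symmetric] distrib_right)
qed

lemmas omega_simps = power2_eq_square algebra_simps omega_sq char2

lemma omega3: "\<omega> ^ 3 = 1" by (simp add: power3_eq_cube omega_simps)

lemma omega_powers: "\<omega> * \<omega> = \<omega>\<^sup>2" "\<omega> * \<omega>\<^sup>2 = 1" "\<omega>\<^sup>2 * \<omega> = 1" "\<omega>\<^sup>2 * \<omega>\<^sup>2 = \<omega>" "(\<omega>\<^sup>2)\<^sup>2 = \<omega>" "(\<omega>\<^sup>2) ^ 3 = 1" "\<omega> ^ 4 = \<omega>"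
proof -
  show 1: "\<omega> * \<omega> = \<omega>\<^sup>2" "\<omega> * \<omega>\<^sup>2 = 1" "\<omega>\<^sup>2 * \<omega> = 1"
    using omega3 by (simp_all add: power2_eq_square power3_eq_cube mult.assoc)
  then show "\<omega>\<^sup>2 * \<omega>\<^sup>2 = \<omega>" "(\<omega>\<^sup>2)\<^sup>2 = \<omega>"
    by (metis mult.assoc mult_1_right power2_eq_square)+
  then show "\<omega> ^ 4 = \<omega>" by (simp add: power4_eq_xxxx power2_eq_square mult.assoc)
  show "(\<omega>\<^sup>2) ^ 3 = 1" using 1 \<open>\<omega>\<^sup>2 * \<omega>\<^sup>2 = \<omega>\<close> by (simp add: power3_eq_cube)
qed

lemma omega_distinct: "\<omega> \<noteq> 1" "\<omega>\<^sup>2 \<noteq> 1" "\<omega>\<^sup>2 \<noteq> \<omega>" "\<omega> \<noteq> 0"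
proof -
  show 1: "\<omega> \<noteq> 1" using omega two by (metis add.right_neutral one_power2 zero_neq_one add.commute)
  show 0: "\<omega> \<noteq> 0" using omega by auto
  show "\<omega>\<^sup>2 \<noteq> \<omega>" using 0 1 by (simp add: power2_eq_square)
  show "\<omega>\<^sup>2 \<noteq> 1" using 0 by (simp add: power2_eq_square omega_sq)
qed

lemma Z_closed: "\<zeta> \<in> Z \<Longrightarrow> \<omega> * \<zeta> \<in> Z" "\<zeta> \<in> Z \<Longrightarrow> \<omega>\<^sup>2 * \<zeta> \<in> Z"
  and Z_cube: "\<zeta> \<in> Z \<Longrightarrow> \<zeta> ^ 3 = 1"
proof -
  show "\<zeta> \<in> Z \<Longrightarrow> \<omega> * \<zeta> \<in> Z" "\<zeta> \<in> Z \<Longrightarrow> \<omega>\<^sup>2 * \<zeta> \<in> Z" "\<zeta> \<in> Z \<Longrightarrow> \<zeta> ^ 3 = 1"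
    using omega3 omega_powers unfolding Z_def by (metis insertE insertI1 insertI2 mult_1_right power_one singletonD)+
qed

lemma sum_roots_zero:
  assumes "\<zeta> \<in> Z" "\<xi> \<in> Z" "\<zeta> \<noteq> \<xi>" shows "1 + \<zeta>\<^sup>2 * \<xi> + \<zeta> * \<xi>\<^sup>2 = 0"
proof -
  have "1 + \<omega> + \<omega>\<^sup>2 = 0" "1 + \<omega>\<^sup>2 + \<omega> = 0" using omega by (simp_all add: ac_simps)
  then show ?thesis
    using assms unfolding Z_def
    by (elim insertE) (simp_all add: omega_powers del: power2_eq_iff)
qed

lemma pq_closed: "p \<in> carrier kA4" "q \<in> carrier kA4" "e \<zeta> \<in> carrier kA4"
  unfolding p_def q_def e_def by (intro kA4_closed A4_mem)+

lemmas ge_table = ge_mult A4_mem V4_table c123_conj comp_id id_comp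

lemma p_sq: "p \<star> p = 0"
proof (rule ext)
  fix x show "(p \<star> p) x = 0 x"
    unfolding p_def
    apply (simp only: conv_simps scale_simps ge_table)
    apply (simp only: plus_fun_apply scale_apply zero_fun_apply)
    by (simp add: omega_simps)
qed

lemma q_sq: "q \<star> q = 0"
proof (rule ext)
  fix x show "(q \<star> q) x = 0 x"
    unfolding q_def
    apply (simp only: conv_simps scale_simps ge_table)
    apply (simp only: plus_fun_apply scale_apply zero_fun_apply)
    by (simp add: omega_simps)
qed

lemma p_q: "p \<star> q = ge id + ge va + ge vb + ge vd"
proof (rule ext)
  fix x show "(p \<star> q) x = (ge id + ge va + ge vb + ge vd) x"
    unfolding p_def q_def
    apply (simp only: conv_simps scale_simps ge_table)
    apply (simp only: plus_fun_apply scale_apply zero_fun_apply)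
    by (simp add: omega_simps)
qed

lemma q_p: "q \<star> p = p \<star> q"
proof (rule ext)
  fix x show "(q \<star> p) x = (p \<star> q) x"
    unfolding p_def q_def
    apply (simp only: conv_simps scale_simps ge_table)
    apply (simp only: plus_fun_apply scale_apply zero_fun_apply)
    by (simp add: omega_simps)
qed

text \<open>So \<open>p\<close>, \<open>q\<close> and \<open>c123\<close> generate the algebra.\<close>

lemma va_expand: "ge va = ge id + p + q + p \<star> q"
proof (rule ext)
  fix x show "ge va x = (ge id + p + q + p \<star> q) x"
    unfolding p_q unfolding p_def q_def
    apply (simp only: plus_fun_apply scale_apply zero_fun_apply)
    by (simp add: omega_simps)
qed

lemma c_p: "ge c123 \<star> p = scale \<omega> (p \<star> ge c123)"
proof (rule ext)
  fix x show "(ge c123 \<star> p) x = scale \<omega> (p \<star> ge c123) x"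
    unfolding p_def
    apply (simp only: conv_simps scale_simps ge_table)
    apply (simp only: plus_fun_apply scale_apply zero_fun_apply)
    by (simp add: omega_simps)
qed

lemma c_q: "ge c123 \<star> q = scale (\<omega>\<^sup>2) (q \<star> ge c123)"
proof (rule ext)
  fix x show "(ge c123 \<star> q) x = scale (\<omega>\<^sup>2) (q \<star> ge c123) x"
    unfolding q_def
    apply (simp only: conv_simps scale_simps ge_table)
    apply (simp only: plus_fun_apply scale_apply zero_fun_apply)
    by (simp add: omega_simps)
qed

lemma c_e: assumes "\<zeta> \<in> Z" shows "ge c123 \<star> e \<zeta> = scale \<zeta> (e \<zeta>)"
proof (rule ext)
  fix x show "(ge c123 \<star> e \<zeta>) x = scale \<zeta> (e \<zeta>) x"
    unfolding e_def
    apply (simp only: conv_simps scale_simps ge_table)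
    apply (simp only: plus_fun_apply scale_apply zero_fun_apply)
    using Z_cube[OF assms] by (simp add: power2_eq_square power3_eq_cube algebra_simps)
qed

lemma c_square: "ge (c123 \<circ> c123) = ge c123 \<star> ge c123"
  by (simp only: ge_table)

lemma e_sum: "e 1 + e \<omega> + e (\<omega>\<^sup>2) = ge id"
proof (rule ext)
  fix x show "(e 1 + e \<omega> + e (\<omega>\<^sup>2)) x = ge id x"
    unfolding e_def
    apply (simp only: plus_fun_apply scale_apply zero_fun_apply)
    by (simp add: omega_simps)
qed

lemma e_e:
  assumes "\<zeta> \<in> Z" "\<xi> \<in> Z"
  shows "e \<zeta> \<star> e \<xi> = (if \<zeta> = \<xi> then e \<zeta> else 0)"
proof -
  have eq: "e \<zeta> \<star> e \<xi> = scale (1 + \<zeta>\<^sup>2 * \<xi> + \<zeta> * \<xi>\<^sup>2) (e \<xi>)"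
    by (simp only: e_def[of \<zeta>] conv_simps ge_id[OF pq_closed(3)] c_square A4.conv_assoc c_e[OF assms(2)] scale_simps
      power2_eq_square mult.assoc)
  have one: "1 + \<zeta>\<^sup>2 * \<xi> + \<zeta> * \<xi>\<^sup>2 = 1" if "\<zeta> = \<xi>"
    using Z_cube[OF assms(2)] that by (simp add: power2_eq_square power3_eq_cube algebra_simps char2)
  show ?thesis
  proof (cases "\<zeta> = \<xi>")
    case True
    have "e \<zeta> \<star> e \<xi> = e \<xi>" by (simp only: eq one[OF True] scale_simps(4))
    then show ?thesis using True by simp
  next
    case False
    have "e \<zeta> \<star> e \<xi> = 0" by (simp only: eq sum_roots_zero[OF assms False] scale_simps(5))
    then show ?thesis using False by simp
  qed
qed

text \<open>Left multiplication by \<open>p\<close> therefore shifts the eigenvalue of \<open>c123\<close> by the factor \<open>\<omega>\<close>, and that by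
  \<open>q\<close> shifts it by \<open>\<omega>\<^sup>2\<close>. This is where the middle layers get their composition factors.\<close>

lemma p_e: assumes "\<zeta> \<in> Z" shows "e (\<omega> * \<zeta>) \<star> p = p \<star> e \<zeta>"
proof -
  have "ge c123 \<star> (ge c123 \<star> p) = scale (\<omega>\<^sup>2) (p \<star> (ge c123 \<star> ge c123))"
    by (simp only: c_p A4.conv_assoc[symmetric] conv_simps scale_simps power2_eq_square)
  then have "e (\<omega> * \<zeta>) \<star> p = p + scale ((\<omega> * \<zeta>)\<^sup>2 * \<omega>) (p \<star> ge c123)
      + scale (\<omega> * \<zeta> * \<omega>\<^sup>2) (p \<star> (ge c123 \<star> ge c123))"
    by (simp only: e_def conv_simps ge_id pq_closed c_square A4.conv_assoc c_p scale_simps)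
  moreover have "(\<omega> * \<zeta>)\<^sup>2 * \<omega> = (\<omega>\<^sup>2 * \<omega>) * \<zeta>\<^sup>2" "\<omega> * \<zeta> * \<omega>\<^sup>2 = (\<omega> * \<omega>\<^sup>2) * \<zeta>"
    by (simp_all only: power_mult_distrib ac_simps)
  ultimately show ?thesis
    by (simp only: e_def conv_simps ge_id pq_closed c_square omega_powers mult_1)
qed

lemma q_e: assumes "\<zeta> \<in> Z" shows "e (\<omega>\<^sup>2 * \<zeta>) \<star> q = q \<star> e \<zeta>"
proof -
  have "ge c123 \<star> (ge c123 \<star> q) = scale (\<omega> ^ 4) (q \<star> (ge c123 \<star> ge c123))"
    by (simp only: c_q A4.conv_assoc[symmetric] conv_simps scale_simps power2_eq_square power4_eq_xxxx mult.assoc)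
  then have "e (\<omega>\<^sup>2 * \<zeta>) \<star> q = q + scale ((\<omega>\<^sup>2 * \<zeta>)\<^sup>2 * \<omega>\<^sup>2) (q \<star> ge c123)
      + scale (\<omega>\<^sup>2 * \<zeta> * \<omega> ^ 4) (q \<star> (ge c123 \<star> ge c123))"
    by (simp only: e_def conv_simps ge_id pq_closed c_square A4.conv_assoc c_q scale_simps)
  moreover have "(\<omega>\<^sup>2 * \<zeta>)\<^sup>2 * \<omega>\<^sup>2 = ((\<omega>\<^sup>2)\<^sup>2 * \<omega>\<^sup>2) * \<zeta>\<^sup>2" "\<omega>\<^sup>2 * \<zeta> * \<omega> ^ 4 = (\<omega>\<^sup>2 * \<omega> ^ 4) * \<zeta>"
    by (simp_all only: power_mult_distrib ac_simps)
  ultimately show ?thesis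
    by (simp only: e_def conv_simps ge_id pq_closed c_square omega_powers mult_1)
qed

section \<open>Bases of the left ideals \<open>kA\<^sub>4 e \<zeta>\<close>\<close>

definition comb :: "'k \<Rightarrow> 'k \<Rightarrow> 'k \<Rightarrow> 'k \<Rightarrow> 'k \<Rightarrow> (nat \<Rightarrow> nat) \<Rightarrow> 'k"
  where "comb \<zeta> \<alpha> \<beta> \<gamma> \<delta> = scale \<alpha> (e \<zeta>) + scale \<beta> (p \<star> e \<zeta>) + scale \<gamma> (q \<star> e \<zeta>) + scale \<delta> (p \<star> (q \<star> e \<zeta>))"

lemma comb_closed: "comb \<zeta> \<alpha> \<beta> \<gamma> \<delta> \<in> carrier kA4"
  unfolding comb_def by (intro kA4_closed pq_closed)

lemma comb_add: "comb \<zeta> \<alpha> \<beta> \<gamma> \<delta> + comb \<zeta> \<alpha>' \<beta>' \<gamma>' \<delta>' = comb \<zeta> (\<alpha> + \<alpha>') (\<beta> + \<beta>') (\<gamma> + \<gamma>') (\<delta> + \<delta>')"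
  unfolding comb_def by (simp only: scale_simps ac_simps)

lemma comb_scale: "scale r (comb \<zeta> \<alpha> \<beta> \<gamma> \<delta>) = comb \<zeta> (r * \<alpha>) (r * \<beta>) (r * \<gamma>) (r * \<delta>)"
  unfolding comb_def by (simp only: scale_simps)

lemma comb_zero: "comb \<zeta> 0 0 0 0 = 0"
  unfolding comb_def by (simp only: scale_simps add_0)

lemma e_comb: "e \<zeta> = comb \<zeta> 1 0 0 0" and pe_comb: "p \<star> e \<zeta> = comb \<zeta> 0 1 0 0"
  and qe_comb: "q \<star> e \<zeta> = comb \<zeta> 0 0 1 0" and pqe_comb: "p \<star> (q \<star> e \<zeta>) = comb \<zeta> 0 0 0 1"
  unfolding comb_def by (simp_all only: scale_simps add_0 add_0_right)

lemma word_simps: "p \<star> (p \<star> x) = 0" "q \<star> (q \<star> x) = 0" "q \<star> (p \<star> x) = p \<star> (q \<star> x)"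
  by (simp_all only: A4.conv_assoc[symmetric] p_sq q_sq q_p conv_simps)

lemma p_comb: "p \<star> comb \<zeta> \<alpha> \<beta> \<gamma> \<delta> = comb \<zeta> 0 \<alpha> 0 \<gamma>"
  unfolding comb_def by (simp only: conv_simps word_simps scale_simps add_0 add_0_right)

lemma q_comb: "q \<star> comb \<zeta> \<alpha> \<beta> \<gamma> \<delta> = comb \<zeta> 0 0 \<alpha> \<beta>"
  unfolding comb_def by (simp only: conv_simps word_simps scale_simps add_0 add_0_right)

lemma pq_comb: "(p \<star> q) \<star> comb \<zeta> \<alpha> \<beta> \<gamma> \<delta> = comb \<zeta> 0 0 0 \<alpha>"
  by (simp only: A4.conv_assoc p_comb q_comb)

lemma c_comb:
  assumes "\<zeta> \<in> Z"
  shows "ge c123 \<star> comb \<zeta> \<alpha> \<beta> \<gamma> \<delta> = comb \<zeta> (\<zeta> * \<alpha>) (\<omega> * \<zeta> * \<beta>) (\<omega>\<^sup>2 * \<zeta> * \<gamma>) (\<zeta> * \<delta>)"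
proof -
  have p: "ge c123 \<star> (p \<star> x) = scale \<omega> (p \<star> (ge c123 \<star> x))" for x
    by (simp only: A4.conv_assoc[symmetric] c_p conv_simps)
  have q: "ge c123 \<star> (q \<star> x) = scale (\<omega>\<^sup>2) (q \<star> (ge c123 \<star> x))" for x
    by (simp only: A4.conv_assoc[symmetric] c_q conv_simps)
  have "\<delta> * (\<omega> * (\<omega>\<^sup>2 * \<zeta>)) = \<zeta> * \<delta>"
    using omega_powers(2) by (metis mult.assoc mult.commute mult_1)
  then show ?thesis
    unfolding comb_def by (simp only: conv_simps p q c_e[OF assms] scale_simps) (simp only: ac_simps)
qed

lemma va_comb: "ge va \<star> comb \<zeta> \<alpha> \<beta> \<gamma> \<delta> = comb \<zeta> \<alpha> (\<beta> + \<alpha>) (\<gamma> + \<alpha>) (\<delta> + \<gamma> + \<beta> + \<alpha>)"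
  by (simp only: va_expand conv_simps ge_id comb_closed pq_comb p_comb q_comb comb_add add_0_right)

text \<open>The span of the four basis vectors is a left ideal: it is stable under \<open>va\<close> and \<open>c123\<close>, and these
  generate the group, as \<open>vb\<close> and \<open>vd\<close> are conjugates of \<open>va\<close>.\<close>

lemma conv_comb:
  assumes "\<zeta> \<in> Z" "x \<in> carrier kA4"
  shows "\<exists>\<alpha>' \<beta>' \<gamma>' \<delta>'. x \<star> comb \<zeta> \<alpha> \<beta> \<gamma> \<delta> = comb \<zeta> \<alpha>' \<beta>' \<gamma>' \<delta>'"
proof -
  define S where "S = {f. \<exists>\<alpha> \<beta> \<gamma> \<delta>. f = comb \<zeta> \<alpha> \<beta> \<gamma> \<delta>}"
  have closed: "f + h \<in> S" "scale r f \<in> S" if "f \<in> S" "h \<in> S" for f h r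
    using that comb_add comb_scale unfolding S_def mem_Collect_eq by metis+
  have c: "ge c123 \<star> f \<in> S" and a: "ge va \<star> f \<in> S" if "f \<in> S" for f
    using that c_comb[OF assms(1)] va_comb unfolding S_def mem_Collect_eq by metis+
  have S_kA4: "f \<in> carrier kA4" if "f \<in> S" for f using that comb_closed by (auto simp: S_def)
  have ctable: "c123 \<circ> (va \<circ> (c123 \<circ> c123)) = vd" "c123 \<circ> (c123 \<circ> (va \<circ> c123)) = vb"
    by (simp_all only: o_assoc c123_conj) (simp_all only: comp_assoc c123_conj comp_id)
  have d: "ge vd \<star> f \<in> S" "ge vb \<star> f \<in> S" if "f \<in> S" for f
  proof -
    have "ge vd \<star> f = ge c123 \<star> (ge va \<star> (ge c123 \<star> (ge c123 \<star> f)))"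
      by (simp only: A4.conv_assoc[symmetric] ge_mult A4_mem comp_assoc ctable)
    moreover have "ge vb \<star> f = ge c123 \<star> (ge c123 \<star> (ge va \<star> (ge c123 \<star> f)))"
      by (simp only: A4.conv_assoc[symmetric] ge_mult A4_mem comp_assoc ctable)
    ultimately show "ge vd \<star> f \<in> S" "ge vb \<star> f \<in> S" using a c that by auto
  qed
  have cpow: "ge (c123 ^^ j) \<star> f \<in> S" if "f \<in> S" for f j
  proof (induction j)
    case 0
    show ?case using ge_id(1)[OF S_kA4[OF that]] that by (simp only: funpow.simps)
  next
    case (Suc j)
    have "ge (c123 ^^ Suc j) \<star> f = ge c123 \<star> (ge (c123 ^^ j) \<star> f)"
      by (simp only: funpow.simps A4.conv_assoc[symmetric] ge_mult A4_mem c123_power_mem)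
    then show ?case using c[OF Suc] by (simp only:)
  qed
  have "x \<star> f \<in> S" if "f \<in> S" for f
    using assms(2)
  proof (induction x rule: A4.group_algebra_induct)
    case (elem g)
    then obtain j v where g: "v \<in> V4" "g = (c123 ^^ j) \<circ> v" using A4_cases by metis
    then have v: "v \<in> carrier A4" by (auto simp only: V4_names A4_mem insert_iff empty_iff)
    have "ge v \<star> f \<in> S"
      using g(1) d[OF that] a[OF that] ge_id(1)[OF S_kA4[OF that]] that unfolding V4_names by auto
    then have "ge (c123 ^^ j) \<star> (ge v \<star> f) \<in> S" by (rule cpow)
    then show ?case by (simp only: g(2) A4.conv_assoc[symmetric] ge_mult c123_power_mem v)
  qed (simp_all only: conv_simps closed[OF _ that] closed)
  then show ?thesis unfolding S_def by blast
qed

text \<open>Since \<open>p \<star> q\<close> is the sum of \<open>V\<^sub>4\<close>, only the product of the two identity elements contributes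
  to the coefficient at the identity.\<close>

lemma pqe_id: "(p \<star> (q \<star> e \<zeta>)) id = 1"
proof -
    have neq: "v \<circ> c123 \<noteq> id" "v \<circ> (c123 \<circ> c123) \<noteq> id" if "v \<in> {va, vb, vd}" for v
    proof -
      have "(v \<circ> c123) 4 \<noteq> id 4" "(v \<circ> (c123 \<circ> c123)) 4 \<noteq> id 4"
        using that by (auto simp only: comp_apply id_apply A4_apply insert_iff empty_iff)
      then show "v \<circ> c123 \<noteq> id" "v \<circ> (c123 \<circ> c123) \<noteq> id" by metis+
    qed
    have neqv: "va \<noteq> id" "vb \<noteq> id" "vd \<noteq> id" "c123 \<noteq> id" "c123 \<circ> c123 \<noteq> id"
      by - (rule notI, drule fun_cong[of _ _ 1], (simp only: A4_apply id_apply comp_apply; simp))+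
    show ?thesis
      unfolding A4.conv_assoc[symmetric] p_q e_def
      apply (simp only: conv_simps ge_table)
      apply (simp only: plus_fun_apply scale_apply group_elem_def)
      using neqv neq[of va] neq[of vb] neq[of vd] by (simp add: eq_commute[of id])
qed

lemma pqe_nonzero: "p \<star> (q \<star> e \<zeta>) \<noteq> 0"
  using pqe_id[of \<zeta>] by auto

text \<open>The four vectors are linearly independent: multiplying a relation by \<open>p \<star> q\<close>, \<open>p\<close> and \<open>q\<close> moves
  one coefficient after the other to the socle.\<close>

lemma comb_eq_zero: "comb \<zeta> \<alpha> \<beta> \<gamma> \<delta> = 0 \<longleftrightarrow> \<alpha> = 0 \<and> \<beta> = 0 \<and> \<gamma> = 0 \<and> \<delta> = 0"
proof
  assume 0: "comb \<zeta> \<alpha> \<beta> \<gamma> \<delta> = 0"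
  have socle: "r = 0" if "comb \<zeta> 0 0 0 r = 0" for r
  proof (rule ccontr)
    assume "r \<noteq> 0"
    then have "comb \<zeta> 0 0 0 1 = scale (1 / r) (comb \<zeta> 0 0 0 r)" by (simp only: comb_scale) simp
    then show False using that pqe_nonzero[of \<zeta>] by (simp add: pqe_comb scale_simps)
  qed
  have "comb \<zeta> 0 0 0 \<alpha> = 0" "comb \<zeta> 0 \<alpha> 0 \<gamma> = 0" "comb \<zeta> 0 0 \<alpha> \<beta> = 0"
    using 0 pq_comb[of \<zeta> \<alpha> \<beta> \<gamma> \<delta>] p_comb[of \<zeta> \<alpha> \<beta> \<gamma> \<delta>] q_comb[of \<zeta> \<alpha> \<beta> \<gamma> \<delta>]
    by (simp_all only: conv_simps)
  then have "\<alpha> = 0" "\<beta> = 0" "\<gamma> = 0" using socle by metis+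
  then show "\<alpha> = 0 \<and> \<beta> = 0 \<and> \<gamma> = 0 \<and> \<delta> = 0" using 0 socle by metis
qed (simp add: comb_zero)

lemma comb_inject: "comb \<zeta> \<alpha> \<beta> \<gamma> \<delta> = comb \<zeta> \<alpha>' \<beta>' \<gamma>' \<delta>' \<longleftrightarrow> \<alpha> = \<alpha>' \<and> \<beta> = \<beta>' \<and> \<gamma> = \<gamma>' \<and> \<delta> = \<delta>'"
proof -
  have "comb \<zeta> \<alpha> \<beta> \<gamma> \<delta> = comb \<zeta> (\<alpha> - \<alpha>') (\<beta> - \<beta>') (\<gamma> - \<gamma>') (\<delta> - \<delta>') + comb \<zeta> \<alpha>' \<beta>' \<gamma>' \<delta>'"
    by (simp only: comb_add) simp
  then show ?thesis using comb_eq_zero[of \<zeta> "\<alpha> - \<alpha>'" "\<beta> - \<beta>'" "\<gamma> - \<gamma>'" "\<delta> - \<delta>'"]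
    by (metis add_0 add_right_cancel right_minus_eq)
qed

text \<open>The character by which the algebra acts on the top and on the socle of the left ideal of \<open>e \<zeta>\<close>. Its
  multiplicativity will be read off from the action on the socle (\<open>conv_pqe\<close>).\<close>

definition chi :: "'k \<Rightarrow> ((nat \<Rightarrow> nat) \<Rightarrow> 'k) \<Rightarrow> 'k"
  where "chi \<zeta> x = (\<Sum>g\<in>carrier A4. x g * \<zeta> ^ V4_exponent g)"

lemma chi_add: "chi \<zeta> (x + y) = chi \<zeta> x + chi \<zeta> y"
  by (simp add: chi_def distrib_right sum.distrib)

lemma chi_scale: "chi \<zeta> (scale r x) = r * chi \<zeta> x"
  by (simp add: chi_def scale_apply sum_distrib_left mult.assoc)

lemma chi_elem: "g \<in> carrier A4 \<Longrightarrow> chi \<zeta> (ge g) = \<zeta> ^ V4_exponent g"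
  using A4.finite_carrier
  by (simp add: chi_def group_elem_def if_distrib[of "\<lambda>y. y * _"] cong: if_cong)

lemma conv_pqe:
  assumes "\<zeta> \<in> Z" "x \<in> carrier kA4"
  shows "x \<star> comb \<zeta> 0 0 0 \<delta> = comb \<zeta> 0 0 0 (chi \<zeta> x * \<delta>)"
  using assms(2)
proof (induction x rule: A4.group_algebra_induct)
  case (elem g)
  obtain j v where g: "v \<in> V4" "g = (c123 ^^ j) \<circ> v" "V4_exponent g = j"
    using elem by (metis A4_cases)
  have v: "v \<in> carrier A4" using g(1) by (auto simp only: V4_names A4_mem insert_iff empty_iff)
  have cpow: "ge (c123 ^^ j) \<star> comb \<zeta> 0 0 0 \<delta> = comb \<zeta> 0 0 0 (\<zeta> ^ j * \<delta>)" for j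
  proof (induction j)
    case 0
    then show ?case by (simp only: funpow.simps ge_id comb_closed power_0 mult_1)
  next
    case (Suc j)
    have "ge (c123 ^^ Suc j) \<star> comb \<zeta> 0 0 0 \<delta> = ge c123 \<star> (ge (c123 ^^ j) \<star> comb \<zeta> 0 0 0 \<delta>)"
      by (simp only: funpow.simps A4.conv_assoc[symmetric] ge_mult A4_mem c123_power_mem)
    then show ?case by (simp only: Suc c_comb[OF assms(1)]) (simp add: mult.assoc)
  qed
  have "ge v \<star> (p \<star> q) = p \<star> q"
    using g(1) unfolding V4_names p_q
    by (elim insertE emptyE; simp only: conv_simps ge_table) (simp_all only: ac_simps)
  then have "ge v \<star> comb \<zeta> 0 0 0 \<delta> = comb \<zeta> 0 0 0 \<delta>"
    using pq_comb[of \<zeta> \<delta> 0 0 0] A4.conv_assoc[of "ge v" "p \<star> q" "comb \<zeta> \<delta> 0 0 0"] by simp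
  moreover have "ge g = ge (c123 ^^ j) \<star> ge v" by (simp only: g(2) ge_mult c123_power_mem v)
  moreover have "chi \<zeta> (ge g) = \<zeta> ^ j" using chi_elem[OF elem] g(3) by simp
  ultimately show ?case by (simp only: A4.conv_assoc cpow)
qed (simp_all only: conv_simps chi_add chi_scale comb_add comb_scale distrib_right add_0 mult_zero_right mult.assoc)

lemma chi_eqI:
  assumes "\<zeta> \<in> Z" "x \<in> carrier kA4" "x \<star> comb \<zeta> 0 0 0 1 = comb \<zeta> 0 0 0 r"
  shows "chi \<zeta> x = r"
  using conv_pqe[OF assms(1,2), of 1] assms(3) by (simp add: comb_inject)

lemma chi_mult:
  assumes "\<zeta> \<in> Z" "x \<in> carrier kA4" "y \<in> carrier kA4"
  shows "chi \<zeta> (x \<star> y) = chi \<zeta> x * chi \<zeta> y"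
  by (rule chi_eqI[OF assms(1) kA4_closed(4)]) (simp add: A4.conv_assoc conv_pqe assms)

lemma chi_one: "\<zeta> \<in> Z \<Longrightarrow> chi \<zeta> (ge id) = 1"
  by (rule chi_eqI) (simp_all only: kA4_closed A4_mem ge_id comb_closed)

lemma comb_e: "\<zeta> \<in> Z \<Longrightarrow> \<xi> \<in> Z \<Longrightarrow> comb \<zeta> \<alpha> \<beta> \<gamma> \<delta> \<star> e \<xi> = (if \<zeta> = \<xi> then comb \<zeta> \<alpha> \<beta> \<gamma> \<delta> else 0)"
  unfolding comb_def
  by (cases "\<zeta> = \<xi>") (simp_all only: conv_simps A4.conv_assoc e_e scale_simps if_True if_False add_0 simp_thms)

lemma comb_p: "\<zeta> \<in> Z \<Longrightarrow> comb (\<omega> * \<zeta>) \<alpha> \<beta> \<gamma> \<delta> \<star> p = comb \<zeta> 0 \<alpha> 0 \<gamma>"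
  unfolding comb_def
  by (simp only: conv_simps A4.conv_assoc p_e word_simps scale_simps add_0 add_0_right)

lemma comb_q: "\<zeta> \<in> Z \<Longrightarrow> comb (\<omega>\<^sup>2 * \<zeta>) \<alpha> \<beta> \<gamma> \<delta> \<star> q = comb \<zeta> 0 0 \<alpha> \<beta>"
  unfolding comb_def
  by (simp only: conv_simps A4.conv_assoc q_e word_simps scale_simps add_0 add_0_right)

lemma chi_pq: "\<zeta> \<in> Z \<Longrightarrow> chi \<zeta> p = 0" "\<zeta> \<in> Z \<Longrightarrow> chi \<zeta> q = 0"
  by (rule chi_eqI; simp only: pq_closed p_comb q_comb)+

lemma chi_e: "\<zeta> \<in> Z \<Longrightarrow> \<xi> \<in> Z \<Longrightarrow> chi \<zeta> (e \<xi>) = (if \<zeta> = \<xi> then 1 else 0)"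
proof (rule chi_eqI)
  assume Z: "\<zeta> \<in> Z" "\<xi> \<in> Z"
  have p: "e (\<omega> * \<zeta>) \<star> (p \<star> x) = p \<star> (e \<zeta> \<star> x)" if "\<zeta> \<in> Z" for x \<zeta>
    by (simp only: A4.conv_assoc[symmetric] p_e[OF that])
  have q: "e (\<omega>\<^sup>2 * \<zeta>) \<star> (q \<star> x) = q \<star> (e \<zeta> \<star> x)" if "\<zeta> \<in> Z" for x \<zeta>
    by (simp only: A4.conv_assoc[symmetric] q_e[OF that])
  have "e (\<omega> * (\<omega>\<^sup>2 * \<xi>)) \<star> (p \<star> (q \<star> e \<zeta>)) = p \<star> (q \<star> (e \<xi> \<star> e \<zeta>))"
    by (simp only: p[OF Z_closed(2)[OF Z(2)]] q[OF Z(2)])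
  moreover have "\<omega> * (\<omega>\<^sup>2 * \<xi>) = \<xi>" by (simp only: mult.assoc[symmetric] omega_powers mult_1)
  ultimately show "e \<xi> \<star> comb \<zeta> 0 0 0 1 = comb \<zeta> 0 0 0 (if \<zeta> = \<xi> then 1 else 0)"
    using Z by (auto simp: pqe_comb[symmetric] e_e comb_zero conv_simps)
qed (simp_all add: pq_closed)

lemma chi_comb:
  assumes "\<zeta> \<in> Z" "\<xi> \<in> Z" shows "chi \<xi> (comb \<zeta> \<alpha> \<beta> \<gamma> \<delta>) = (if \<xi> = \<zeta> then \<alpha> else 0)"
  unfolding comb_def chi_add chi_scale
  using assms by (simp add: chi_mult chi_pq chi_e pq_closed kA4_closed)

lemma conv_e:
  assumes "\<zeta> \<in> Z" "x \<in> carrier kA4"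
  obtains \<beta> \<gamma> \<delta> where "x \<star> e \<zeta> = comb \<zeta> (chi \<zeta> x) \<beta> \<gamma> \<delta>"
proof -
  obtain \<alpha> \<beta> \<gamma> \<delta> where x: "x \<star> e \<zeta> = comb \<zeta> \<alpha> \<beta> \<gamma> \<delta>"
    using conv_comb[OF assms, of 1 0 0 0] by (auto simp: e_comb)
  have "chi \<zeta> (x \<star> e \<zeta>) = chi \<zeta> x" using assms by (simp add: chi_mult chi_e pq_closed)
  then have "\<alpha> = chi \<zeta> x" using x assms by (simp add: chi_comb)
  then show thesis using that x by blast
qed

text \<open>Modulo the socle, \<open>p e \<zeta>\<close> and \<open>q e \<zeta>\<close> are eigenvectors of the whole algebra, because they equal
  \<open>e (\<omega> \<zeta>) p\<close> and \<open>e (\<omega>\<^sup>2 \<zeta>) q\<close>, so that \<open>conv_e\<close> applies at the shifted roots.\<close>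

lemma conv_radical:
  assumes "\<zeta> \<in> Z" "x \<in> carrier kA4"
  obtains \<delta>' where "x \<star> comb \<zeta> 0 \<beta> \<gamma> \<delta> = comb \<zeta> 0 (chi (\<omega> * \<zeta>) x * \<beta>) (chi (\<omega>\<^sup>2 * \<zeta>) x * \<gamma>) \<delta>'"
proof -
  obtain b g d where "x \<star> e (\<omega> * \<zeta>) = comb (\<omega> * \<zeta>) (chi (\<omega> * \<zeta>) x) b g d"
    using conv_e[OF Z_closed(1)[OF assms(1)] assms(2)] .
  then have "x \<star> e (\<omega> * \<zeta>) \<star> p = comb \<zeta> 0 (chi (\<omega> * \<zeta>) x) 0 g"
    by (simp add: comb_p[OF assms(1)])
  then have p: "x \<star> (p \<star> e \<zeta>) = comb \<zeta> 0 (chi (\<omega> * \<zeta>) x) 0 g"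
    by (simp add: A4.conv_assoc p_e[OF assms(1)])
  obtain b' g' d' where "x \<star> e (\<omega>\<^sup>2 * \<zeta>) = comb (\<omega>\<^sup>2 * \<zeta>) (chi (\<omega>\<^sup>2 * \<zeta>) x) b' g' d'"
    using conv_e[OF Z_closed(2)[OF assms(1)] assms(2)] .
  then have "x \<star> e (\<omega>\<^sup>2 * \<zeta>) \<star> q = comb \<zeta> 0 0 (chi (\<omega>\<^sup>2 * \<zeta>) x) b'"
    by (simp add: comb_q[OF assms(1)])
  then have q: "x \<star> (q \<star> e \<zeta>) = comb \<zeta> 0 0 (chi (\<omega>\<^sup>2 * \<zeta>) x) b'"
    by (simp add: A4.conv_assoc q_e[OF assms(1)])
  have "x \<star> comb \<zeta> 0 \<beta> \<gamma> \<delta> = scale \<beta> (x \<star> (p \<star> e \<zeta>)) + scale \<gamma> (x \<star> (q \<star> e \<zeta>)) + scale \<delta> (x \<star> comb \<zeta> 0 0 0 1)"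
    unfolding comb_def by (simp only: conv_simps scale_simps add_0 add_0_right)
  then have "x \<star> comb \<zeta> 0 \<beta> \<gamma> \<delta> = comb \<zeta> 0 (\<beta> * chi (\<omega> * \<zeta>) x) (\<gamma> * chi (\<omega>\<^sup>2 * \<zeta>) x) (\<beta> * g + \<gamma> * b' + \<delta> * chi \<zeta> x)"
    by (simp only: p q conv_pqe[OF assms] comb_scale comb_add) simp
  then show thesis using that by (simp add: mult.commute)
qed

lemma decompose:
  assumes "x \<in> carrier kA4" shows "x \<star> e 1 + x \<star> e \<omega> + x \<star> e (\<omega>\<^sup>2) = x"
  using assms by (simp only: conv_simps[symmetric] e_sum ge_id)

section \<open>The modules \<open>E \<zeta>\<close> and \<open>S \<zeta>\<close>\<close>

abbreviation A :: "((nat \<Rightarrow> nat) \<Rightarrow> 'k) ring" where "A \<equiv> kA4"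

definition E :: "'k \<Rightarrow> ((nat \<Rightarrow> nat) \<Rightarrow> 'k, (nat \<Rightarrow> nat) \<Rightarrow> 'k) module"
  where "E \<zeta> = (regular_lmod kA4)\<lparr>carrier := {f. \<exists>\<alpha> \<beta> \<gamma> \<delta>. f = comb \<zeta> \<alpha> \<beta> \<gamma> \<delta>}\<rparr>"

text \<open>The simple modules \<open>T \<omega> i\<close>, indexed by the eigenvalue of \<open>c123\<close> instead of by \<open>i\<close>.\<close>

definition S :: "'k \<Rightarrow> ((nat \<Rightarrow> nat) \<Rightarrow> 'k, 'k) module"
  where "S \<zeta> = one_dim_lmod A4 (\<lambda>g. \<zeta> ^ V4_exponent g)"

lemma E_simps [simp]:
  "carrier (E \<zeta>) = {f. \<exists>\<alpha> \<beta> \<gamma> \<delta>. f = comb \<zeta> \<alpha> \<beta> \<gamma> \<delta>}" "x \<oplus>\<^bsub>E \<zeta>\<^esub> y = x + y" "\<zero>\<^bsub>E \<zeta>\<^esub> = 0"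
  "a \<odot>\<^bsub>E \<zeta>\<^esub> x = a \<star> x"
  by (simp_all add: E_def group_algebra_simps)

lemma S_simps [simp]:
  "carrier (S \<zeta>) = UNIV" "x \<oplus>\<^bsub>S \<zeta>\<^esub> y = x + y" "\<zero>\<^bsub>S \<zeta>\<^esub> = 0" "a \<odot>\<^bsub>S \<zeta>\<^esub> x = chi \<zeta> a * x"
  by (simp_all add: S_def one_dim_lmod_def chi_def)

lemmas ring_kA4 = A4.ring_group_algebra[where 'k = 'k]

lemma kA4_one: "\<one>\<^bsub>kA4\<^esub> = ge id"
  by (simp only: group_algebra_simps alt_group_one)

lemma left_module_S: assumes "\<zeta> \<in> Z" shows "left_module kA4 (S \<zeta>)"
proof -
  have "abelian_group (S \<zeta>)"
  proof (rule abelian_groupI)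
    fix x show "\<exists>y\<in>carrier (S \<zeta>). y \<oplus>\<^bsub>S \<zeta>\<^esub> x = \<zero>\<^bsub>S \<zeta>\<^esub>"
      by (intro bexI[of _ "- x"]) simp_all
  qed simp_all
  then show ?thesis
    using assms chi_one kA4_one
    by (intro left_module.intro left_module_axioms.intro ring_kA4)
      (simp_all add: group_algebra_simps(2) chi_add chi_mult algebra_simps)
qed

lemma comb_mem_E: "comb \<zeta> \<alpha> \<beta> \<gamma> \<delta> \<in> carrier (E \<zeta>)"
  by auto

lemma E_cases:
  assumes "x \<in> carrier (E \<zeta>)"
  obtains \<alpha> \<beta> \<gamma> \<delta> where "x = comb \<zeta> \<alpha> \<beta> \<gamma> \<delta>"
  using assms by auto

lemma E_kA4: "x \<in> carrier (E \<zeta>) \<Longrightarrow> x \<in> carrier kA4"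
  using comb_closed by auto

lemma submodule_E: assumes "\<zeta> \<in> Z" shows "submodule (carrier (E \<zeta>)) kA4 (regular_lmod kA4)"
proof -
  interpret left_module A "regular_lmod A" by (rule left_module_regular[OF ring_kA4])
  have 0: "0 \<in> carrier (E \<zeta>)" using comb_mem_E[of \<zeta> 0 0 0 0] by (simp only: comb_zero)
  have add: "x + y \<in> carrier (E \<zeta>)" if "x \<in> carrier (E \<zeta>)" "y \<in> carrier (E \<zeta>)" for x y
    using that comb_mem_E comb_add by (metis E_cases)
  have smult: "a \<star> x \<in> carrier (E \<zeta>)" if "a \<in> carrier kA4" "x \<in> carrier (E \<zeta>)" for a x
    using that conv_comb[OF assms] comb_mem_E by (metis E_cases)
  show ?thesis unfolding submodule_iff
    using E_kA4 0 add smult by (auto simp only: regular_lmod_simps group_algebra_simps(2,3))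
qed

lemma left_module_E: assumes "\<zeta> \<in> Z" shows "left_module kA4 (E \<zeta>)"
  using left_module.submodule_left_module[OF left_module_regular[OF ring_kA4] submodule_E[OF assms]]
  by (simp add: E_def)

lemma E_e: assumes "\<zeta> \<in> Z" "x \<in> carrier (E \<zeta>)" shows "x \<star> e \<zeta> = x"
  using assms by (auto simp: comb_e)

lemma E_mult: assumes "\<zeta> \<in> Z" "x \<in> carrier kA4" shows "x \<star> e \<zeta> \<in> carrier (E \<zeta>)"
  using conv_e[OF assms] comb_mem_E by metis

lemma chi_hom: "\<zeta> \<in> Z \<Longrightarrow> chi \<zeta> \<in> lmod_hom kA4 (E \<zeta>) (S \<zeta>)"
  by (rule lmod_homI) (auto simp: chi_add chi_mult comb_closed simp del: plus_fun_apply)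

lemma submodule_E_closed:
  assumes "\<zeta> \<in> Z" "submodule U kA4 (E \<zeta>)" "x \<in> U"
  shows "scale r x \<in> U" "p \<star> x \<in> U" "q \<star> x \<in> U" "x \<in> carrier (E \<zeta>)" "y \<in> U \<Longrightarrow> x + y \<in> U"
proof -
  note U = left_module.submoduleD[OF left_module_E[OF assms(1)] assms(2)]
  show x: "x \<in> carrier (E \<zeta>)" using U(1) assms(3) by blast
  have "scale r (ge id) \<star> x \<in> U" using U(4)[OF kA4_closed(2)[OF kA4_closed(5)] assms(3)] A4_mem by simp
  then show "scale r x \<in> U" by (simp only: conv_simps ge_id[OF E_kA4[OF x]])
  show "p \<star> x \<in> U" "q \<star> x \<in> U" using U(4)[OF _ assms(3)] pq_closed by simp_all
  show "x + y \<in> U" if "y \<in> U" using U(3)[OF assms(3) that] by simp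
qed

text \<open>Locality of \<open>E \<zeta>\<close>: from a vector with nonzero first coordinate, multiplication by \<open>p\<close>, \<open>q\<close> and
  \<open>p q\<close> produces a triangular system of generators.\<close>

lemma submodule_E_full:
  assumes Z: "\<zeta> \<in> Z" and U: "submodule U kA4 (E \<zeta>)" and x: "x \<in> U" "chi \<zeta> x \<noteq> 0"
  shows "U = carrier (E \<zeta>)"
proof
  note cl = submodule_E_closed[OF Z U]
  show "U \<subseteq> carrier (E \<zeta>)" using cl(4) by blast
  obtain \<alpha> \<beta> \<gamma> \<delta> where xc: "x = comb \<zeta> \<alpha> \<beta> \<gamma> \<delta>" using cl(4)[OF x(1)] by (rule E_cases)
  have \<alpha>: "\<alpha> \<noteq> 0" using x(2) chi_comb[OF Z Z] xc by auto
  have "comb \<zeta> 0 \<alpha> 0 \<gamma> \<in> U" "comb \<zeta> 0 0 \<alpha> \<beta> \<in> U"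
    using cl(2)[OF x(1)] cl(3)[OF x(1)] by (simp_all only: xc p_comb q_comb)
  then have pe: "comb \<zeta> 0 \<alpha> 0 \<gamma> \<in> U" and qe: "comb \<zeta> 0 0 \<alpha> \<beta> \<in> U" and pqe: "comb \<zeta> 0 0 0 \<alpha> \<in> U"
    using cl(2)[of "comb \<zeta> 0 0 \<alpha> \<beta>"] by (simp_all only: p_comb)
  show "carrier (E \<zeta>) \<subseteq> U"
  proof
    fix y assume "y \<in> carrier (E \<zeta>)"
    then obtain a b c d where y: "y = comb \<zeta> a b c d" by (rule E_cases)
    \<comment> \<open>back substitution in the triangular system\<close>
    define r where "r = a / \<alpha>"
    define s where "s = (b - r * \<beta>) / \<alpha>"
    define t where "t = (c - r * \<gamma>) / \<alpha>"
    define u where "u = (d - r * \<delta> - s * \<gamma> - t * \<beta>) / \<alpha>"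
    have "scale r x + scale s (comb \<zeta> 0 \<alpha> 0 \<gamma>) + scale t (comb \<zeta> 0 0 \<alpha> \<beta>) + scale u (comb \<zeta> 0 0 0 \<alpha>) = y"
      using \<alpha> by (simp only: xc y comb_scale comb_add comb_inject) (simp add: r_def s_def t_def u_def)
    then show "y \<in> U" using cl(1,5) x(1) pe qe pqe by metis
  qed
qed

lemma submodule_E_socle:
  assumes Z: "\<zeta> \<in> Z" and U: "submodule U kA4 (E \<zeta>)" and ne: "U \<noteq> {0}"
  shows "comb \<zeta> 0 0 0 r \<in> U"
proof -
  note cl = submodule_E_closed[OF Z U]
  have "0 \<in> U" using left_module.submoduleD(2)[OF left_module_E[OF Z] U] by simp
  then obtain x where x: "x \<in> U" "x \<noteq> 0" using ne by blast
  obtain \<alpha> \<beta> \<gamma> \<delta> where xc: "x = comb \<zeta> \<alpha> \<beta> \<gamma> \<delta>" using cl(4)[OF x(1)] by (rule E_cases)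
  have "comb \<zeta> 0 \<alpha> 0 \<gamma> \<in> U" "comb \<zeta> 0 0 \<alpha> \<beta> \<in> U"
    using cl(2)[OF x(1)] cl(3)[OF x(1)] by (simp_all only: xc p_comb q_comb)
  moreover from this have "comb \<zeta> 0 0 0 \<alpha> \<in> U"
    using cl(2)[of "comb \<zeta> 0 0 \<alpha> \<beta>"] by (simp only: p_comb)
  ultimately have "\<exists>t. t \<noteq> 0 \<and> comb \<zeta> 0 0 0 t \<in> U"
    using x xc comb_eq_zero[of \<zeta> \<alpha> \<beta> \<gamma> \<delta>] by metis
  then obtain t where t: "t \<noteq> 0" "comb \<zeta> 0 0 0 t \<in> U" by blast
  have "scale (r / t) (comb \<zeta> 0 0 0 t) = comb \<zeta> 0 0 0 r" using t(1) by (simp only: comb_scale) simp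
  then show ?thesis using cl(1)[OF t(2)] by metis
qed

lemma E_nonzero: "carrier (E \<zeta>) \<noteq> {\<zero>\<^bsub>E \<zeta>\<^esub>}"
  using comb_mem_E[of \<zeta> 1 0 0 0] comb_eq_zero[of \<zeta> 1 0 0 0] by (metis E_simps(3) singletonD zero_neq_one)

text \<open>If \<open>e \<zeta> = u + w\<close>, then \<open>u\<close> or \<open>w\<close> lies outside the kernel of \<open>chi \<zeta>\<close> and generates everything.\<close>

lemma indecomposable_E: assumes Z: "\<zeta> \<in> Z" shows "indecomposable_lmod kA4 (E \<zeta>)"
  unfolding indecomposable_lmod_def
proof (intro conjI allI impI E_nonzero)
  fix U W assume UW: "internal_dsum kA4 (E \<zeta>) U W"
  then have sub: "submodule U kA4 (E \<zeta>)" "submodule W kA4 (E \<zeta>)" and int: "U \<inter> W = {\<zero>\<^bsub>E \<zeta>\<^esub>}"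
    and sum: "U <+>\<^bsub>E \<zeta>\<^esub> W = carrier (E \<zeta>)" by (auto simp only: internal_dsum_def)
  have "e \<zeta> \<in> carrier (E \<zeta>)" using comb_mem_E e_comb by metis
  then obtain u w where uw: "u \<in> U" "w \<in> W" "e \<zeta> = u + w"
    unfolding sum[symmetric] set_add_def' by auto
  then have "chi \<zeta> u + chi \<zeta> w = 1" using chi_add chi_e[OF Z Z] by metis
  then have "chi \<zeta> u \<noteq> 0 \<or> chi \<zeta> w \<noteq> 0" by auto
  then have "U = carrier (E \<zeta>) \<or> W = carrier (E \<zeta>)" using submodule_E_full[OF Z] sub uw by blast
  moreover have "U \<subseteq> carrier (E \<zeta>)" "W \<subseteq> carrier (E \<zeta>)"
    using left_module.submoduleD(1)[OF left_module_E[OF Z]] sub by blast+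
  ultimately show "U = {\<zero>\<^bsub>E \<zeta>\<^esub>} \<or> W = {\<zero>\<^bsub>E \<zeta>\<^esub>}" using int by blast
qed

lemma fin_gen_E: assumes Z: "\<zeta> \<in> Z" shows "fin_gen kA4 (E \<zeta>)"
  unfolding fin_gen_def
proof (intro exI[of _ "{e \<zeta>}"] conjI allI impI)
  show "{e \<zeta>} \<subseteq> carrier (E \<zeta>)" using comb_mem_E e_comb by (metis empty_subsetI insert_subset)
  fix N assume "submodule N kA4 (E \<zeta>) \<and> {e \<zeta>} \<subseteq> N"
  then show "N = carrier (E \<zeta>)" using submodule_E_full[OF Z, of N "e \<zeta>"] chi_e[OF Z Z] by simp
qed simp

text \<open>\<open>E \<zeta>\<close> is complemented in the free module of rank 1 by the annihilator of \<open>e \<zeta>\<close>.\<close>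

lemma projective_E: assumes Z: "\<zeta> \<in> Z" shows "projective_lmod kA4 (E \<zeta>)"
proof -
  let ?F = "free_lmod A 1"
  interpret F: left_module kA4 ?F by (rule left_module_free[OF ring_kA4])
  define i where "i = (\<lambda>(x :: (nat \<Rightarrow> nat) \<Rightarrow> 'k) (j::nat). if j < 1 then x else undefined)"
  define U where "U = {x \<in> carrier ?F. x 0 \<star> e \<zeta> = x 0}"
  define W where "W = {x \<in> carrier ?F. x 0 \<star> e \<zeta> = 0}"
  have U: "submodule U kA4 ?F" and W: "submodule W kA4 ?F"
    unfolding F.submodule_iff U_def W_def
    by (auto simp: free_lmod_simps group_algebra_simps(2,3) conv_simps A4.conv_assoc kA4_closed simp del: plus_fun_apply)
  have "U \<inter> W = {\<zero>\<^bsub>?F\<^esub>}"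
    by (auto simp: U_def W_def free_lmod_simps group_algebra_simps(3) fun_eq_iff conv_simps kA4_closed)
  moreover have "x \<in> U <+>\<^bsub>?F\<^esub> W" if x: "x \<in> carrier ?F" for x
  proof -
    have x0: "x 0 \<in> carrier kA4" using x by (simp add: free_lmod_simps)
    have "scale (- 1) (x 0) + x 0 = 0" by (auto simp: scale_apply)
    then have "x = i (x 0 \<star> e \<zeta>) \<oplus>\<^bsub>?F\<^esub> i (x 0 + scale (- 1) (x 0 \<star> e \<zeta>))"
      using x by (auto simp: free_lmod_simps i_def fun_eq_iff group_algebra_simps(2) scale_apply)
    moreover have "i (x 0 \<star> e \<zeta>) \<in> U"
      by (auto simp: U_def i_def free_lmod_simps kA4_closed A4.conv_assoc e_e[OF Z Z])
    moreover have "x 0 \<star> e \<zeta> + scale (- 1) (x 0 \<star> e \<zeta>) = 0" by (auto simp: scale_apply)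
    then have "i (x 0 + scale (- 1) (x 0 \<star> e \<zeta>)) \<in> W"
      using x0 by (simp add: W_def i_def free_lmod_simps kA4_closed conv_simps A4.conv_assoc e_e[OF Z Z] del: plus_fun_apply)
    ultimately show ?thesis unfolding set_add_def' by blast
  qed
  then have "U <+>\<^bsub>?F\<^esub> W = carrier ?F"
    using F.submoduleD(1)[OF U] F.submoduleD(1)[OF W] F.M.a_closed unfolding set_add_def' by blast
  ultimately have dsum: "internal_dsum kA4 ?F U W" using U W by (simp add: internal_dsum_def)
  have "lmod_iso kA4 (E \<zeta>) (?F\<lparr>carrier := U\<rparr>)"
  proof (rule lmod_isoI)
    show "i \<in> lmod_hom kA4 (E \<zeta>) (?F\<lparr>carrier := U\<rparr>)"
      using E_e[OF Z] E_kA4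
      by (intro lmod_homI) (simp_all add: U_def i_def free_lmod_simps group_algebra_simps(2) fun_eq_iff del: E_simps(1))
    show "(\<lambda>x. x 0) \<in> lmod_hom kA4 (?F\<lparr>carrier := U\<rparr>) (E \<zeta>)"
      using E_mult[OF Z]
      by (intro lmod_homI) (simp_all add: U_def free_lmod_simps group_algebra_simps(2) del: E_simps(1), metis)
    show "i (y 0) = y" if "y \<in> carrier (?F\<lparr>carrier := U\<rparr>)" for y
      using that by (auto simp: i_def U_def free_lmod_simps)
  qed (simp add: i_def)
  then show ?thesis using dsum unfolding projective_lmod_def by blast
qed

lemma essential_chi: assumes Z: "\<zeta> \<in> Z" shows "essential_epi kA4 (E \<zeta>) (S \<zeta>) (chi \<zeta>)"
proof -
  have "chi \<zeta> ` carrier (E \<zeta>) = carrier (S \<zeta>)"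
  proof -
    have "r \<in> chi \<zeta> ` carrier (E \<zeta>)" for r
      using chi_comb[OF Z Z, of r 0 0 0] comb_mem_E[of \<zeta> r 0 0 0] by (metis image_eqI)
    then show ?thesis by auto
  qed
  moreover have "U = carrier (E \<zeta>)" if "submodule U kA4 (E \<zeta>)" "chi \<zeta> ` U = carrier (S \<zeta>)" for U
  proof -
    have "1 \<in> chi \<zeta> ` U" using that(2) by simp
    then obtain u where "u \<in> U" "chi \<zeta> u = 1" by auto
    then show ?thesis using submodule_E_full[OF Z that(1), of u] by simp
  qed
  ultimately show ?thesis
    using chi_hom[OF Z] unfolding essential_epi_def by blast
qed

lemma projective_cover_E: "\<zeta> \<in> Z \<Longrightarrow> projective_cover kA4 (E \<zeta>) (S \<zeta>)"
  unfolding projective_cover_def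
  using left_module_E left_module_S fin_gen_E projective_E essential_chi by blast

section \<open>Projective modules map onto some \<open>E \<zeta>\<close>\<close>

text \<open>In each \<open>E \<zeta>\<close> the common kernel of \<open>p\<close> and \<open>q\<close> is the last coordinate line, which is the image
  of \<open>p q\<close>.\<close>

lemma annihilated_in_socle:
  assumes x: "x \<in> carrier A" "p \<star> x = 0" "q \<star> x = 0"
  obtains y where "y \<in> carrier A" "x = (p \<star> q) \<star> y"
proof -
  have "\<exists>y. y \<in> carrier A \<and> x \<star> e \<zeta> = (p \<star> q) \<star> y" if Z: "\<zeta> \<in> Z" for \<zeta>
  proof -
    obtain \<alpha> \<beta> \<gamma> \<delta> where xe: "x \<star> e \<zeta> = comb \<zeta> \<alpha> \<beta> \<gamma> \<delta>"
      using E_mult[OF Z x(1)] by (rule E_cases)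
    have "comb \<zeta> 0 \<alpha> 0 \<gamma> = 0" "comb \<zeta> 0 0 \<alpha> \<beta> = 0"
      using p_comb[of \<zeta> \<alpha> \<beta> \<gamma> \<delta>] q_comb[of \<zeta> \<alpha> \<beta> \<gamma> \<delta>] x(2,3)
      by (simp_all only: xe[symmetric] A4.conv_assoc[symmetric] conv_simps)
    then have "x \<star> e \<zeta> = (p \<star> q) \<star> comb \<zeta> \<delta> 0 0 0"
      by (simp add: xe comb_eq_zero pq_comb)
    then show ?thesis using comb_closed by blast
  qed
  then obtain y where y: "\<And>\<zeta>. \<zeta> \<in> Z \<Longrightarrow> y \<zeta> \<in> carrier A \<and> x \<star> e \<zeta> = (p \<star> q) \<star> y \<zeta>"
    by metis
  have "x = (p \<star> q) \<star> (y 1 + y \<omega> + y (\<omega>\<^sup>2))"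
    using decompose[OF x(1)] y by (simp add: conv_simps Z_def)
  then show thesis using that[of "y 1 + y \<omega> + y (\<omega>\<^sup>2)"] y by (simp add: kA4_closed Z_def del: plus_fun_apply)
qed

lemma chi_nonzero:
  assumes x: "x \<in> carrier A" "(p \<star> q) \<star> x \<noteq> 0"
  obtains \<zeta> where "\<zeta> \<in> Z" "chi \<zeta> x \<noteq> 0"
proof -
  have e: "(p \<star> q) \<star> x \<star> e \<zeta> = comb \<zeta> 0 0 0 (chi \<zeta> x)" if "\<zeta> \<in> Z" for \<zeta>
    using conv_e[OF that x(1)] pq_comb A4.conv_assoc by metis
  have "(p \<star> q) \<star> x = 0" if "\<forall>\<zeta>\<in>Z. chi \<zeta> x = 0"
    using that e decompose[OF kA4_closed(4), of "p \<star> q" x] by (simp add: Z_def comb_zero)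
  then show thesis using x(2) that by blast
qed

text \<open>As \<open>p\<close> and \<open>q\<close> commute and have square 0, multiplying a nonzero vector by \<open>p\<close> and \<open>q\<close> as long as
  it stays nonzero leads to a vector that both kill.\<close>

lemma free_submodule_socle:
  assumes U: "submodule U A (free_lmod A n)" and ne: "U \<noteq> {\<zero>\<^bsub>free_lmod A n\<^esub>}"
  obtains y where "y \<in> carrier (free_lmod A n)" "(p \<star> q) \<odot>\<^bsub>free_lmod A n\<^esub> y \<in> U"
    "(p \<star> q) \<odot>\<^bsub>free_lmod A n\<^esub> y \<noteq> \<zero>\<^bsub>free_lmod A n\<^esub>"
proof -
  let ?F = "free_lmod A n"
  interpret F: left_module A ?F by (rule left_module_free[OF ring_kA4])
  note UD = F.submoduleD[OF U]
  obtain x where x: "x \<in> U" "x \<noteq> \<zero>\<^bsub>?F\<^esub>" using UD(2) ne by blast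
  have assoc: "(a \<star> b) \<odot>\<^bsub>?F\<^esub> z = a \<odot>\<^bsub>?F\<^esub> (b \<odot>\<^bsub>?F\<^esub> z)" if "a \<in> carrier A" "b \<in> carrier A" "z \<in> U" for a b z
    using F.smult_assoc that UD(1) by blast
  have zero: "0 \<odot>\<^bsub>?F\<^esub> z = \<zero>\<^bsub>?F\<^esub>" if "z \<in> U" for z
    using F.smult_zero_left[of z] that UD(1) by (auto simp only: group_algebra_simps(3))
  have step: "\<exists>z. z \<in> U \<and> z \<noteq> \<zero>\<^bsub>?F\<^esub> \<and> p \<odot>\<^bsub>?F\<^esub> z = \<zero>\<^bsub>?F\<^esub>"
  proof (cases "p \<odot>\<^bsub>?F\<^esub> x = \<zero>\<^bsub>?F\<^esub>")
    case False
    have "p \<odot>\<^bsub>?F\<^esub> (p \<odot>\<^bsub>?F\<^esub> x) = \<zero>\<^bsub>?F\<^esub>"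
      using assoc[OF pq_closed(1) pq_closed(1) x(1)] zero[OF x(1)] by (simp only: p_sq)
    then show ?thesis using False UD(4)[OF pq_closed(1) x(1)] by blast
  qed (use x in blast)
  then obtain z where z: "z \<in> U" "z \<noteq> \<zero>\<^bsub>?F\<^esub>" "p \<odot>\<^bsub>?F\<^esub> z = \<zero>\<^bsub>?F\<^esub>" by blast
  have "\<exists>w. w \<in> U \<and> w \<noteq> \<zero>\<^bsub>?F\<^esub> \<and> p \<odot>\<^bsub>?F\<^esub> w = \<zero>\<^bsub>?F\<^esub> \<and> q \<odot>\<^bsub>?F\<^esub> w = \<zero>\<^bsub>?F\<^esub>"
  proof (cases "q \<odot>\<^bsub>?F\<^esub> z = \<zero>\<^bsub>?F\<^esub>")
    case False
    have "q \<odot>\<^bsub>?F\<^esub> (q \<odot>\<^bsub>?F\<^esub> z) = \<zero>\<^bsub>?F\<^esub>"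
      using assoc[OF pq_closed(2) pq_closed(2) z(1)] zero[OF z(1)] by (simp only: q_sq)
    moreover have "p \<odot>\<^bsub>?F\<^esub> (q \<odot>\<^bsub>?F\<^esub> z) = q \<odot>\<^bsub>?F\<^esub> (p \<odot>\<^bsub>?F\<^esub> z)"
      using assoc[OF pq_closed(1) pq_closed(2) z(1)] assoc[OF pq_closed(2) pq_closed(1) z(1)]
      by (simp only: q_p)
    ultimately show ?thesis
      using False UD(4)[OF pq_closed(2) z(1)] z(3) F.smult_zero_right[OF pq_closed(2)] by metis
  qed (use z in blast)
  then obtain w where w: "w \<in> U" "w \<noteq> \<zero>\<^bsub>?F\<^esub>" "p \<odot>\<^bsub>?F\<^esub> w = \<zero>\<^bsub>?F\<^esub>" "q \<odot>\<^bsub>?F\<^esub> w = \<zero>\<^bsub>?F\<^esub>" by blast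
  have wF: "w \<in> carrier ?F" using w(1) UD(1) by blast
  have "\<exists>y. y \<in> carrier A \<and> w i = (p \<star> q) \<star> y" if i: "i < n" for i
  proof -
    have "w i \<in> carrier A" using wF i by (simp add: free_lmod_simps)
    moreover have "p \<star> w i = 0" "q \<star> w i = 0"
      using fun_cong[OF w(3), of i] fun_cong[OF w(4), of i] i
      by (simp_all only: free_lmod_simps group_algebra_simps(3) if_True)
    ultimately show ?thesis using annihilated_in_socle by metis
  qed
  then obtain y where y: "\<And>i. i < n \<Longrightarrow> y i \<in> carrier A \<and> w i = (p \<star> q) \<star> y i" by metis
  define y' where "y' = (\<lambda>i. if i < n then y i else undefined)"
  have "y' \<in> carrier ?F" using y by (simp add: free_lmod_simps y'_def)
  moreover have "w = (p \<star> q) \<odot>\<^bsub>?F\<^esub> y'"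
    using y wF by (auto simp: free_lmod_simps y'_def)
  ultimately show thesis using that w by metis
qed

lemma hom_coordinate:
  assumes Z: "\<zeta> \<in> Z" and i: "i < n"
  shows "(\<lambda>x. x i \<star> e \<zeta>) \<in> lmod_hom A (free_lmod A n) (E \<zeta>)"
  using i E_mult[OF Z]
  by (intro lmod_homI)
    (simp_all add: free_lmod_simps group_algebra_simps(2) conv_simps A4.conv_assoc del: E_simps(1) plus_fun_apply)

text \<open>The key fact. If \<open>p q\<close> killed the summand \<open>U\<close>, every \<open>p q y\<close> would lie in the complement \<open>W\<close>,
  contradicting \<open>free_submodule_socle\<close>.\<close>

lemma projective_onto_E:
  assumes P: "left_module A P" and proj: "projective_lmod A P" and ne: "carrier P \<noteq> {\<zero>\<^bsub>P\<^esub>}"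
  obtains \<zeta> g where "\<zeta> \<in> Z" "g \<in> lmod_hom A P (E \<zeta>)" "g ` carrier P = carrier (E \<zeta>)"
proof -
  obtain n U W where UW: "internal_dsum A (free_lmod A n) U W"
    and iso: "lmod_iso A P ((free_lmod A n)\<lparr>carrier := U\<rparr>)"
    using proj unfolding projective_lmod_def by blast
  let ?F = "free_lmod A n"
  interpret F: left_module A ?F by (rule left_module_free[OF ring_kA4])
  have U: "submodule U A ?F" and W: "submodule W A ?F" and int: "U \<inter> W = {\<zero>\<^bsub>?F\<^esub>}"
    and sum: "U <+>\<^bsub>?F\<^esub> W = carrier ?F" using UW by (auto simp only: internal_dsum_def)
  note UD = F.submoduleD[OF U] and WD = F.submoduleD[OF W]
  obtain f where f: "f \<in> lmod_hom A P (?F\<lparr>carrier := U\<rparr>)" "bij_betw f (carrier P) U"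
    using iso unfolding lmod_iso_def by auto
  have "f \<zero>\<^bsub>P\<^esub> = \<zero>\<^bsub>?F\<^esub>"
    using lmod_hom_zero[OF P F.submodule_left_module[OF U] f(1)] by simp
  then have U0: "U \<noteq> {\<zero>\<^bsub>?F\<^esub>}"
  proof -
    interpret P: left_module A P by (rule P)
    obtain m where m: "m \<in> carrier P" "m \<noteq> \<zero>\<^bsub>P\<^esub>" using ne P.zero_closed by blast
    then have "f m \<noteq> f \<zero>\<^bsub>P\<^esub>" "f m \<in> U"
      using f(2) P.M.zero_closed by (auto simp: bij_betw_def inj_on_def)
    then show ?thesis using \<open>f \<zero>\<^bsub>P\<^esub> = \<zero>\<^bsub>?F\<^esub>\<close> by auto
  qed
  have N: "p \<star> q \<in> carrier A" by (rule kA4_closed)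
  have "\<exists>u\<in>U. (p \<star> q) \<odot>\<^bsub>?F\<^esub> u \<noteq> \<zero>\<^bsub>?F\<^esub>"
  proof (rule ccontr)
    assume kill: "\<not> ?thesis"
    obtain y where y: "y \<in> carrier ?F" "(p \<star> q) \<odot>\<^bsub>?F\<^esub> y \<in> U" "(p \<star> q) \<odot>\<^bsub>?F\<^esub> y \<noteq> \<zero>\<^bsub>?F\<^esub>"
      using free_submodule_socle[OF U U0] .
    obtain u w where uw: "u \<in> U" "w \<in> W" "y = u \<oplus>\<^bsub>?F\<^esub> w"
      using y(1) unfolding sum[symmetric] set_add_def' by blast
    have w: "w \<in> carrier ?F" "u \<in> carrier ?F" using uw UD(1) WD(1) by blast+
    have "(p \<star> q) \<odot>\<^bsub>?F\<^esub> y = (p \<star> q) \<odot>\<^bsub>?F\<^esub> u \<oplus>\<^bsub>?F\<^esub> (p \<star> q) \<odot>\<^bsub>?F\<^esub> w"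
      using F.smult_r_distr[OF N w(2,1)] uw(3) by simp
    also have "\<dots> = (p \<star> q) \<odot>\<^bsub>?F\<^esub> w"
      using kill uw(1) F.smult_closed[OF N w(1)] by (metis F.M.l_zero)
    finally have "(p \<star> q) \<odot>\<^bsub>?F\<^esub> y \<in> W" using WD(4)[OF N uw(2)] by metis
    then show False using y(2,3) int by blast
  qed
  then obtain u where u: "u \<in> U" "(p \<star> q) \<odot>\<^bsub>?F\<^esub> u \<noteq> \<zero>\<^bsub>?F\<^esub>" by blast
  then have "\<exists>i<n. (p \<star> q) \<star> u i \<noteq> 0"
    by (auto simp: free_lmod_simps group_algebra_simps(3) fun_eq_iff[where f = "\<lambda>i::nat. if _ i then _ i else _"])
  then obtain i where i: "i < n" "(p \<star> q) \<star> u i \<noteq> 0" by blast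
  have "u i \<in> carrier A" using u(1) UD(1) i(1) by (auto simp: free_lmod_simps)
  then obtain \<zeta> where Z: "\<zeta> \<in> Z" "chi \<zeta> (u i) \<noteq> 0" using chi_nonzero[OF _ i(2)] by metis
  define g where "g = (\<lambda>m. f m i \<star> e \<zeta>)"
  have "f \<in> lmod_hom A P ?F"
    using lmod_homD[OF f(1)] UD(1) by (intro lmod_homI) auto
  then have g: "g \<in> lmod_hom A P (E \<zeta>)"
    unfolding g_def by (rule lmod_hom_comp) (rule hom_coordinate[OF Z(1) i(1)])
  obtain m where m: "m \<in> carrier P" "f m = u" using f(2) u(1) by (auto simp: bij_betw_def)
  have "chi \<zeta> (g m) = chi \<zeta> (u i)"
    using Z \<open>u i \<in> carrier A\<close> by (simp add: g_def m(2) chi_mult pq_closed chi_e)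
  then have "g ` carrier P = carrier (E \<zeta>)"
    using submodule_E_full[OF Z(1) lmod_hom_image_submodule[OF P left_module_E[OF Z(1)] g
          left_module.submodule_carrier[OF P]], of "g m"] m(1) Z(2) by auto
  then show thesis using that Z(1) g by blast
qed

section \<open>Classification of projective covers and projective indecomposables\<close>

lemma hom_from_E:
  assumes Z: "\<zeta> \<in> Z" and M: "left_module A M" and m: "m \<in> carrier M"
  shows "(\<lambda>x. x \<odot>\<^bsub>M\<^esub> m) \<in> lmod_hom A (E \<zeta>) M"
proof -
  interpret M: left_module A M by fact
  show ?thesis
  proof (rule lmod_homI)
    fix x y assume "x \<in> carrier (E \<zeta>)" "y \<in> carrier (E \<zeta>)"
    then show "(x \<oplus>\<^bsub>E \<zeta>\<^esub> y) \<odot>\<^bsub>M\<^esub> m = x \<odot>\<^bsub>M\<^esub> m \<oplus>\<^bsub>M\<^esub> y \<odot>\<^bsub>M\<^esub> m"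
      using M.smult_l_distr[of x y m] m E_kA4 by (simp add: group_algebra_simps(2) del: E_simps(1))
  next
    fix a x assume "a \<in> carrier A" "x \<in> carrier (E \<zeta>)"
    then show "(a \<odot>\<^bsub>E \<zeta>\<^esub> x) \<odot>\<^bsub>M\<^esub> m = a \<odot>\<^bsub>M\<^esub> (x \<odot>\<^bsub>M\<^esub> m)"
      using M.smult_assoc[of a x m] m E_kA4 by (simp del: E_simps(1))
  qed (use M.smult_closed m E_kA4 in blast)
qed

text \<open>With \<open>g m = e \<zeta>\<close>, the map \<open>x \<mapsto> x m\<close> splits the surjection \<open>g\<close> of \<open>projective_onto_E\<close>.\<close>

lemma proj_indecomposable_iso_E:
  assumes "proj_indecomposable A P"
  obtains \<zeta> where "\<zeta> \<in> Z" "lmod_iso A P (E \<zeta>)"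
proof -
  have P: "left_module A P" and proj: "projective_lmod A P" and ind: "indecomposable_lmod A P"
    using assms by (auto simp: proj_indecomposable_def)
  interpret P: left_module A P by (rule P)
  obtain \<zeta> g where Z: "\<zeta> \<in> Z" and g: "g \<in> lmod_hom A P (E \<zeta>)" "g ` carrier P = carrier (E \<zeta>)"
    using projective_onto_E[OF P proj] ind unfolding indecomposable_lmod_def by blast
  interpret E: left_module A "E \<zeta>" by (rule left_module_E[OF Z])
  have eE: "e \<zeta> \<in> carrier (E \<zeta>)" using comb_mem_E e_comb by metis
  then obtain m where m: "m \<in> carrier P" "g m = e \<zeta>" using g(2) by (metis imageE)
  define s where "s = (\<lambda>x. x \<odot>\<^bsub>P\<^esub> m)"
  have s: "s \<in> lmod_hom A (E \<zeta>) P" unfolding s_def by (rule hom_from_E[OF Z P m(1)])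
  have gs: "g (s x) = x" if "x \<in> carrier (E \<zeta>)" for x
    using lmod_homD(3)[OF g(1) E_kA4[OF that] m(1)] E_e[OF Z that] m(2) by (simp add: s_def)
  define K where "K = {y \<in> carrier P. g y = \<zero>\<^bsub>E \<zeta>\<^esub>}"
  have K: "submodule K A P" unfolding K_def by (rule lmod_hom_kernel_submodule[OF P E.left_module_axioms g(1)])
  have I: "submodule (s ` carrier (E \<zeta>)) A P"
    by (rule lmod_hom_image_submodule[OF E.left_module_axioms P s E.submodule_carrier])
  have s0: "s \<zero>\<^bsub>E \<zeta>\<^esub> = \<zero>\<^bsub>P\<^esub>" by (rule lmod_hom_zero[OF E.left_module_axioms P s])
  have "K \<inter> s ` carrier (E \<zeta>) = {\<zero>\<^bsub>P\<^esub>}"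
  proof
    show "K \<inter> s ` carrier (E \<zeta>) \<subseteq> {\<zero>\<^bsub>P\<^esub>}"
    proof
      fix y assume "y \<in> K \<inter> s ` carrier (E \<zeta>)"
      then obtain x where x: "x \<in> carrier (E \<zeta>)" "y = s x" "g y = \<zero>\<^bsub>E \<zeta>\<^esub>" unfolding K_def by blast
      then show "y \<in> {\<zero>\<^bsub>P\<^esub>}" using gs[OF x(1)] s0 by simp
    qed
    show "{\<zero>\<^bsub>P\<^esub>} \<subseteq> K \<inter> s ` carrier (E \<zeta>)"
      using P.submoduleD(2)[OF K] P.submoduleD(2)[OF I] by blast
  qed
  moreover have "K <+>\<^bsub>P\<^esub> s ` carrier (E \<zeta>) = carrier P"
  proof
    show "K <+>\<^bsub>P\<^esub> s ` carrier (E \<zeta>) \<subseteq> carrier P"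
      using P.submoduleD(1)[OF K] P.submoduleD(1)[OF I] P.M.a_closed unfolding set_add_def' by blast
    show "carrier P \<subseteq> K <+>\<^bsub>P\<^esub> s ` carrier (E \<zeta>)"
    proof
      fix y assume y: "y \<in> carrier P"
      have gy: "g y \<in> carrier (E \<zeta>)" by (rule lmod_homD(1)[OF g(1) y])
      have sg: "s (g y) \<in> carrier P" by (rule lmod_homD(1)[OF s gy])
      have "g (y \<ominus>\<^bsub>P\<^esub> s (g y)) = g y \<ominus>\<^bsub>E \<zeta>\<^esub> g (s (g y))"
        unfolding a_minus_def
        using lmod_homD(2)[OF g(1) y P.M.a_inv_closed[OF sg]] lmod_hom_minus[OF P E.left_module_axioms g(1) sg]
        by simp
      then have "g (y \<ominus>\<^bsub>P\<^esub> s (g y)) = \<zero>\<^bsub>E \<zeta>\<^esub>" using gs[OF gy] E.M.r_neg[OF gy] by (simp only: a_minus_def)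
      then have "y \<ominus>\<^bsub>P\<^esub> s (g y) \<in> K" using y sg by (simp add: K_def)
      moreover have "y = (y \<ominus>\<^bsub>P\<^esub> s (g y)) \<oplus>\<^bsub>P\<^esub> s (g y)"
        using y sg by (simp add: a_minus_def P.M.a_assoc P.M.l_neg)
      ultimately show "y \<in> K <+>\<^bsub>P\<^esub> s ` carrier (E \<zeta>)" using gy unfolding set_add_def' by blast
    qed
  qed
  ultimately have "internal_dsum A P K (s ` carrier (E \<zeta>))" using K I by (simp only: internal_dsum_def)
  then have "K = {\<zero>\<^bsub>P\<^esub>} \<or> s ` carrier (E \<zeta>) = {\<zero>\<^bsub>P\<^esub>}" using ind unfolding indecomposable_lmod_def by blast
  moreover have "s ` carrier (E \<zeta>) \<noteq> {\<zero>\<^bsub>P\<^esub>}"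
  proof
    assume "s ` carrier (E \<zeta>) = {\<zero>\<^bsub>P\<^esub>}"
    then have "s (e \<zeta>) = s \<zero>\<^bsub>E \<zeta>\<^esub>" using imageI[OF eE, of s] s0 by (metis singletonD)
    then have "e \<zeta> = \<zero>\<^bsub>E \<zeta>\<^esub>" using gs[OF eE] gs[OF E.M.zero_closed] by simp
    then show False using comb_eq_zero[of \<zeta> 1 0 0 0] by (simp add: e_comb)
  qed
  ultimately have "K = {\<zero>\<^bsub>P\<^esub>}" by blast
  then have "inj_on g (carrier P)"
    by (intro lmod_hom_inj_on[OF P E.left_module_axioms g(1)]) (auto simp: K_def)
  then have "lmod_iso A P (E \<zeta>)" using g unfolding lmod_iso_def bij_betw_def by blast
  then show thesis using that Z by blast
qed

text \<open>Such a homomorphism is right multiplication by \<open>y = h (e \<zeta>)\<close>. Surjectivity forces \<open>y\<close> to be a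
  generator, and \<open>e \<zeta> y = y\<close> is possible for a generator of \<open>E \<xi>\<close> only if \<open>\<zeta> = \<xi>\<close>.\<close>

lemma hom_E_onto_E:
  assumes Z: "\<zeta> \<in> Z" "\<xi> \<in> Z" and h: "h \<in> lmod_hom A (E \<zeta>) (E \<xi>)" "h ` carrier (E \<zeta>) = carrier (E \<xi>)"
  shows "\<zeta> = \<xi>" and "h (comb \<zeta> 0 0 0 1) \<noteq> 0"
proof -
  have eE: "e \<zeta> \<in> carrier (E \<zeta>)" "e \<xi> \<in> carrier (E \<xi>)" using comb_mem_E e_comb by metis+
  define y where "y = h (e \<zeta>)"
  have y: "y \<in> carrier (E \<xi>)" unfolding y_def by (rule lmod_homD(1)[OF h(1) eE(1)])
  have hx: "h x = x \<star> y" if "x \<in> carrier (E \<zeta>)" for x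
    using lmod_homD(3)[OF h(1) E_kA4[OF that] eE(1)] E_e[OF Z(1) that] unfolding y_def E_simps by metis
  have "e \<xi> \<in> h ` carrier (E \<zeta>)" unfolding h(2) by (rule eE(2))
  then obtain x where x: "x \<in> carrier (E \<zeta>)" "e \<xi> = h x" by (rule imageE)
  then have x2: "x \<star> y = e \<xi>" using hx[OF x(1)] by simp
  have "chi \<xi> x * chi \<xi> y = 1"
    using x2 chi_mult[OF Z(2) E_kA4[OF x(1)] E_kA4[OF y]] chi_e[OF Z(2) Z(2)] by simp
  then have chi: "chi \<xi> y \<noteq> 0" by auto
  have ey: "e \<zeta> \<star> y = y" using hx[OF eE(1)] by (simp add: y_def)
  then have "chi \<xi> (e \<zeta>) * chi \<xi> y = chi \<xi> y" using chi_mult[OF Z(2) pq_closed(3) E_kA4[OF y]] by metis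
  then show eq: "\<zeta> = \<xi>" using chi chi_e[OF Z(2) Z(1)] by (auto split: if_splits)
  obtain \<alpha> \<beta> \<gamma> \<delta> where yc: "y = comb \<xi> \<alpha> \<beta> \<gamma> \<delta>" using y by (rule E_cases)
  have "h (comb \<zeta> 0 0 0 1) = (p \<star> q) \<star> (e \<zeta> \<star> y)"
    unfolding hx[OF comb_mem_E] by (simp only: pqe_comb[symmetric] A4.conv_assoc)
  then have "h (comb \<zeta> 0 0 0 1) = comb \<xi> 0 0 0 \<alpha>" by (simp only: ey) (simp only: yc pq_comb)
  moreover have "\<alpha> \<noteq> 0" using chi yc chi_comb[OF Z(2) Z(2)] by auto
  ultimately show "h (comb \<zeta> 0 0 0 1) \<noteq> 0" by (simp add: comb_eq_zero)
qed

lemma iso_E_imp_eq: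
  assumes Z: "\<zeta> \<in> Z" "\<xi> \<in> Z" and "lmod_iso A (E \<zeta>) (E \<xi>)" shows "\<zeta> = \<xi>"
  using assms(3) hom_E_onto_E(1)[OF Z] unfolding lmod_iso_def bij_betw_def by blast

text \<open>The map \<open>s\<close> from \<open>E \<zeta>\<close> to \<open>P\<close> is onto because the cover is essential. A nonzero kernel would
  contain the socle, which survives in the composite with a surjection of \<open>P\<close> onto some \<open>E \<xi>\<close>.\<close>

lemma projective_cover_iso_E:
  assumes Z: "\<zeta> \<in> Z" and cover: "projective_cover A P (S \<zeta>)"
  shows "lmod_iso A (E \<zeta>) P"
proof -
  have P: "left_module A P" and proj: "projective_lmod A P"
    using cover by (auto simp: projective_cover_def)
  interpret P: left_module A P by (rule P)
  interpret E: left_module A "E \<zeta>" by (rule left_module_E[OF Z])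
  obtain f where f: "f \<in> lmod_hom A P (S \<zeta>)" "f ` carrier P = carrier (S \<zeta>)"
    and ess: "\<And>U. submodule U A P \<Longrightarrow> f ` U = carrier (S \<zeta>) \<Longrightarrow> U = carrier P"
    using cover by (auto simp: projective_cover_def essential_epi_def)
  have f0: "f \<zero>\<^bsub>P\<^esub> = 0" using lmod_hom_zero[OF P left_module_S[OF Z] f(1)] by simp
  have "1 \<in> f ` carrier P" using f(2) by simp
  then obtain m where m: "m \<in> carrier P" "f m = 1" by auto
  define s where "s = (\<lambda>x. x \<odot>\<^bsub>P\<^esub> m)"
  have s: "s \<in> lmod_hom A (E \<zeta>) P" unfolding s_def by (rule hom_from_E[OF Z P m(1)])
  have I: "submodule (s ` carrier (E \<zeta>)) A P"
    by (rule lmod_hom_image_submodule[OF E.left_module_axioms P s E.submodule_carrier])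
  have fs: "f (s x) = chi \<zeta> x" if "x \<in> carrier (E \<zeta>)" for x
    using lmod_homD(3)[OF f(1) E_kA4[OF that] m(1)] m(2) by (simp add: s_def)
  have "r \<in> f ` s ` carrier (E \<zeta>)" for r
    using fs[OF comb_mem_E, of r 0 0 0] chi_comb[OF Z Z] comb_mem_E[of \<zeta> r 0 0 0] by (metis imageI)
  then have surj: "s ` carrier (E \<zeta>) = carrier P" by (intro ess[OF I]) auto
  have "carrier P \<noteq> {\<zero>\<^bsub>P\<^esub>}" using m f0 by force
  then obtain \<xi> g where X: "\<xi> \<in> Z" and g: "g \<in> lmod_hom A P (E \<xi>)" "g ` carrier P = carrier (E \<xi>)"
    using projective_onto_E[OF P proj] by metis
  have "g (s (comb \<zeta> 0 0 0 1)) \<noteq> 0"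
    using hom_E_onto_E(2)[OF Z X lmod_hom_comp[OF s g(1)]] surj g(2) by (metis image_image)
  then have socle: "s (comb \<zeta> 0 0 0 1) \<noteq> \<zero>\<^bsub>P\<^esub>"
    using lmod_hom_zero[OF P left_module_E[OF X] g(1)] by auto
  have "{x \<in> carrier (E \<zeta>). s x = \<zero>\<^bsub>P\<^esub>} = {0}"
    using submodule_E_socle[OF Z lmod_hom_kernel_submodule[OF E.left_module_axioms P s], of 1] socle by blast
  then have "inj_on s (carrier (E \<zeta>))"
    by (intro lmod_hom_inj_on[OF E.left_module_axioms P s]) (simp only: E_simps(3), blast)
  then show ?thesis using s surj unfolding lmod_iso_def bij_betw_def by blast
qed

section \<open>Radical layers\<close>

lemma maximal_kernel:
  assumes M: "left_module A M" and Z: "\<xi> \<in> Z" and f: "f \<in> lmod_hom A M (S \<xi>)"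
    and ne: "m \<in> carrier M" "f m \<noteq> 0"
  shows "maximal_submodule A M {x \<in> carrier M. f x = 0}"
  unfolding maximal_submodule_def
proof (intro conjI allI impI)
  interpret M: left_module A M by (rule M)
  let ?K = "{x \<in> carrier M. f x = 0}"
  show "submodule ?K A M" using lmod_hom_kernel_submodule[OF M left_module_S[OF Z] f] by simp
  show "?K \<noteq> carrier M" using ne by blast
  fix L assume L: "submodule L A M \<and> ?K \<subseteq> L"
  note LD = M.submoduleD[OF conjunct1[OF L]]
  show "L = ?K \<or> L = carrier M"
  proof (cases "L \<subseteq> ?K")
    case False
    then obtain y where y: "y \<in> L" "f y \<noteq> 0" "y \<in> carrier M" using LD(1) by blast
    have "x \<in> L" if x: "x \<in> carrier M" for x
    proof -
      define a where "a = scale (f x / f y) (ge id)"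
      have a: "a \<in> carrier A" unfolding a_def by (intro kA4_closed A4_mem)
      have chi: "chi \<xi> a = f x / f y" by (simp add: a_def chi_scale chi_one[OF Z])
      have ay: "a \<odot>\<^bsub>M\<^esub> y \<in> L" "a \<odot>\<^bsub>M\<^esub> y \<in> carrier M" using LD(4)[OF a y(1)] LD(1) by blast+
      have "f (x \<ominus>\<^bsub>M\<^esub> a \<odot>\<^bsub>M\<^esub> y) = f x \<ominus>\<^bsub>S \<xi>\<^esub> f (a \<odot>\<^bsub>M\<^esub> y)"
        unfolding a_minus_def using lmod_homD(2)[OF f x M.M.a_inv_closed[OF ay(2)]]
          lmod_hom_minus[OF M left_module_S[OF Z] f ay(2)] by simp
      moreover have "f (a \<odot>\<^bsub>M\<^esub> y) = f x" using lmod_homD(3)[OF f a y(3)] y(2) chi by simp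
      moreover have "r \<ominus>\<^bsub>S \<xi>\<^esub> r = 0" for r
        using abelian_group.r_neg[OF left_module.axioms(2)[OF left_module_S[OF Z]], of r] by (simp add: a_minus_def)
      ultimately have "x \<ominus>\<^bsub>M\<^esub> a \<odot>\<^bsub>M\<^esub> y \<in> L" using L x ay(2) by auto
      then have "(x \<ominus>\<^bsub>M\<^esub> a \<odot>\<^bsub>M\<^esub> y) \<oplus>\<^bsub>M\<^esub> a \<odot>\<^bsub>M\<^esub> y \<in> L" using LD(3) ay(1) by blast
      then show ?thesis using x ay(2) by (simp add: a_minus_def M.M.a_assoc M.M.l_neg)
    qed
    then show ?thesis using LD(1) by blast
  qed (use L in blast)
qed

lemma rad_subset_kernel:
  assumes "left_module A M" "\<xi> \<in> Z" "f \<in> lmod_hom A M (S \<xi>)" "m \<in> carrier M" "f m \<noteq> 0"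
  shows "rad A M \<subseteq> {x \<in> carrier M. f x = 0}"
  using maximal_kernel[OF assms] by (auto simp: rad_def)

text \<open>Multiplication by \<open>q\<close> or \<open>p\<close> moves a middle coordinate to the socle, where it is the coefficient at
  the identity by \<open>pqe_id\<close>.\<close>

lemma comb_coordinates:
  "(q \<star> comb \<zeta> 0 \<beta> \<gamma> \<delta>) id = \<beta>" "(p \<star> comb \<zeta> 0 \<beta> \<gamma> \<delta>) id = \<gamma>" "comb \<zeta> 0 0 0 \<delta> id = \<delta>"
proof -
  have 1: "comb \<zeta> 0 0 0 r id = r" for r
  proof -
    have "scale r (comb \<zeta> 0 0 0 1) = comb \<zeta> 0 0 0 r" by (simp only: comb_scale) simp
    then have "comb \<zeta> 0 0 0 r id = r * comb \<zeta> 0 0 0 1 id" by (metis scale_apply)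
    then show ?thesis by (simp only: pqe_comb[symmetric] pqe_id mult_1_right)
  qed
  show "(q \<star> comb \<zeta> 0 \<beta> \<gamma> \<delta>) id = \<beta>" "(p \<star> comb \<zeta> 0 \<beta> \<gamma> \<delta>) id = \<gamma>" "comb \<zeta> 0 0 0 \<delta> id = \<delta>"
    by (simp_all only: q_comb p_comb 1)
qed

definition J1 where "J1 \<zeta> = {f. \<exists>\<beta> \<gamma> \<delta>. f = comb \<zeta> 0 \<beta> \<gamma> \<delta>}"
definition J2 where "J2 \<zeta> = {f. \<exists>\<delta>. f = comb \<zeta> 0 0 0 \<delta>}"

lemma J1_eq: assumes Z: "\<zeta> \<in> Z" shows "J1 \<zeta> = {x \<in> carrier (E \<zeta>). chi \<zeta> x = 0}"
proof (intro equalityI subsetI)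
  fix x assume "x \<in> {x \<in> carrier (E \<zeta>). chi \<zeta> x = 0}"
  then obtain \<alpha> \<beta> \<gamma> \<delta> where "x = comb \<zeta> \<alpha> \<beta> \<gamma> \<delta>" "chi \<zeta> x = 0" using E_cases by blast
  then show "x \<in> J1 \<zeta>" using chi_comb[OF Z Z] by (auto simp: J1_def)
next
  fix x assume "x \<in> J1 \<zeta>"
  then obtain \<beta> \<gamma> \<delta> where "x = comb \<zeta> 0 \<beta> \<gamma> \<delta>" unfolding J1_def by blast
  then show "x \<in> {x \<in> carrier (E \<zeta>). chi \<zeta> x = 0}" using chi_comb[OF Z Z] comb_mem_E by simp
qed

lemma submodule_J1: assumes Z: "\<zeta> \<in> Z" shows "submodule (J1 \<zeta>) A (E \<zeta>)"
  using lmod_hom_kernel_submodule[OF left_module_E[OF Z] left_module_S[OF Z] chi_hom[OF Z]]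
  by (simp only: J1_eq[OF Z] S_simps)

lemma rad_E: assumes Z: "\<zeta> \<in> Z" shows "rad A (E \<zeta>) = J1 \<zeta>"
proof
  have e: "e \<zeta> \<in> carrier (E \<zeta>)" "chi \<zeta> (e \<zeta>) \<noteq> 0" using comb_mem_E e_comb chi_e[OF Z Z] by (metis, simp)
  show "rad A (E \<zeta>) \<subseteq> J1 \<zeta>"
    unfolding J1_eq[OF Z] by (rule rad_subset_kernel[OF left_module_E[OF Z] Z chi_hom[OF Z] e(1)]) (rule e(2))
  have "J1 \<zeta> \<subseteq> N" if N: "maximal_submodule A (E \<zeta>) N" for N
  proof -
    have sub: "submodule N A (E \<zeta>)" "N \<noteq> carrier (E \<zeta>)" using N by (auto simp only: maximal_submodule_def)
    have "N \<subseteq> carrier (E \<zeta>)" using left_module.submoduleD(1)[OF left_module_E[OF Z] sub(1)] .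
    then have "N \<subseteq> J1 \<zeta>" using submodule_E_full[OF Z sub(1)] sub(2) unfolding J1_eq[OF Z] by blast
    then have "J1 \<zeta> = N \<or> J1 \<zeta> = carrier (E \<zeta>)"
      using N submodule_J1[OF Z] unfolding maximal_submodule_def by blast
    moreover have "J1 \<zeta> \<noteq> carrier (E \<zeta>)" using e unfolding J1_eq[OF Z] by blast
    ultimately show ?thesis by blast
  qed
  moreover have "J1 \<zeta> \<subseteq> carrier (E \<zeta>)" unfolding J1_eq[OF Z] by blast
  ultimately show "J1 \<zeta> \<subseteq> rad A (E \<zeta>)" unfolding rad_def by blast
qed

abbreviation EJ1 where "EJ1 \<zeta> \<equiv> (E \<zeta>)\<lparr>carrier := J1 \<zeta>\<rparr>"
abbreviation EJ2 where "EJ2 \<zeta> \<equiv> (E \<zeta>)\<lparr>carrier := J2 \<zeta>\<rparr>"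

lemma left_module_EJ1: "\<zeta> \<in> Z \<Longrightarrow> left_module A (EJ1 \<zeta>)"
  using left_module.submodule_left_module[OF left_module_E submodule_J1] .

definition "coord x = ((q \<star> x) id, (p \<star> x) id)"

lemma coord_hom:
  assumes Z: "\<zeta> \<in> Z"
  shows "coord \<in> lmod_hom A (EJ1 \<zeta>) (dsum (S (\<omega> * \<zeta>)) (S (\<omega>\<^sup>2 * \<zeta>)))"
proof (rule lmod_homI)
  show "coord (a \<odot>\<^bsub>EJ1 \<zeta>\<^esub> x) = a \<odot>\<^bsub>dsum (S (\<omega> * \<zeta>)) (S (\<omega>\<^sup>2 * \<zeta>))\<^esub> coord x"
    if a: "a \<in> carrier A" and x: "x \<in> carrier (EJ1 \<zeta>)" for a x
  proof -
    obtain \<beta> \<gamma> \<delta> where xc: "x = comb \<zeta> 0 \<beta> \<gamma> \<delta>" using x by (auto simp: J1_def)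
    obtain \<delta>' where "a \<star> x = comb \<zeta> 0 (chi (\<omega> * \<zeta>) a * \<beta>) (chi (\<omega>\<^sup>2 * \<zeta>) a * \<gamma>) \<delta>'"
      unfolding xc using conv_radical[OF Z a] .
    then show ?thesis by (simp add: dsum_def coord_def xc comb_coordinates)
  qed
qed (simp_all add: dsum_def coord_def conv_simps)

lemma coord_components:
  assumes Z: "\<zeta> \<in> Z"
  shows "(\<lambda>x. fst (coord x)) \<in> lmod_hom A (EJ1 \<zeta>) (S (\<omega> * \<zeta>))"
    and "(\<lambda>x. snd (coord x)) \<in> lmod_hom A (EJ1 \<zeta>) (S (\<omega>\<^sup>2 * \<zeta>))"
    and "(\<lambda>x. prod.swap (coord x)) \<in> lmod_hom A (EJ1 \<zeta>) (dsum (S (\<omega>\<^sup>2 * \<zeta>)) (S (\<omega> * \<zeta>)))"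
  by (rule lmod_hom_comp[OF coord_hom[OF Z]], rule lmod_homI, auto simp: dsum_def)+

lemma J2_eq: "J2 \<zeta> = {x \<in> J1 \<zeta>. coord x = (0, 0)}"
proof (intro equalityI subsetI)
  fix x assume "x \<in> J2 \<zeta>"
  then obtain \<delta> where "x = comb \<zeta> 0 0 0 \<delta>" by (auto simp: J2_def)
  then show "x \<in> {x \<in> J1 \<zeta>. coord x = (0, 0)}"
    using comb_coordinates(1,2)[of \<zeta> 0 0 \<delta>] by (auto simp: J1_def coord_def)
qed (auto simp: J1_def J2_def coord_def comb_coordinates)

lemma submodule_J2: assumes Z: "\<zeta> \<in> Z" shows "submodule (J2 \<zeta>) A (E \<zeta>)"
proof -
  have "submodule (J2 \<zeta>) A (EJ1 \<zeta>)"
    using lmod_hom_kernel_submodule[OF left_module_EJ1[OF Z]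
        left_module_dsum[OF left_module_S[OF Z_closed(1)[OF Z]] left_module_S[OF Z_closed(2)[OF Z]]] coord_hom[OF Z]]
    by (simp add: J2_eq dsum_def)
  then show ?thesis
    using left_module.submodule_restrict_iff[OF left_module_E[OF Z] submodule_J1[OF Z]] by blast
qed

text \<open>The two coordinates of \<open>coord\<close> give two maximal submodules that meet in \<open>J2 \<zeta>\<close>. Conversely a
  maximal submodule is nonzero, as \<open>J2 \<zeta>\<close> lies strictly between 0 and \<open>J1 \<zeta>\<close>, and so contains the
  socle.\<close>

lemma rad_EJ1: assumes Z: "\<zeta> \<in> Z" shows "rad A (EJ1 \<zeta>) = J2 \<zeta>"
proof
  have mem: "comb \<zeta> 0 \<beta> \<gamma> \<delta> \<in> carrier (EJ1 \<zeta>)" for \<beta> \<gamma> \<delta> by (auto simp: J1_def)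
  have c: "coord (comb \<zeta> 0 \<beta> \<gamma> \<delta>) = (\<beta>, \<gamma>)" for \<beta> \<gamma> \<delta> by (simp add: coord_def comb_coordinates)
  have "rad A (EJ1 \<zeta>) \<subseteq> {x \<in> carrier (EJ1 \<zeta>). fst (coord x) = 0}"
    by (rule rad_subset_kernel[OF left_module_EJ1[OF Z] Z_closed(1)[OF Z] coord_components(1)[OF Z] mem[of 1 0 0]])
      (simp add: c)
  moreover have "rad A (EJ1 \<zeta>) \<subseteq> {x \<in> carrier (EJ1 \<zeta>). snd (coord x) = 0}"
    by (rule rad_subset_kernel[OF left_module_EJ1[OF Z] Z_closed(2)[OF Z] coord_components(2)[OF Z] mem[of 0 1 0]])
      (simp add: c)
  ultimately show "rad A (EJ1 \<zeta>) \<subseteq> J2 \<zeta>" by (auto simp: J2_eq prod_eq_iff)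
  have J21: "J2 \<zeta> \<subseteq> J1 \<zeta>" unfolding J2_eq by blast
  have restrict: "submodule V A (EJ1 \<zeta>) \<longleftrightarrow> submodule V A (E \<zeta>) \<and> V \<subseteq> J1 \<zeta>" for V
    by (rule left_module.submodule_restrict_iff[OF left_module_E[OF Z] submodule_J1[OF Z]])
  have "J2 \<zeta> \<subseteq> N" if N: "maximal_submodule A (EJ1 \<zeta>) N" for N
  proof -
    have sub: "submodule N A (E \<zeta>)" using N restrict by (auto simp only: maximal_submodule_def)
    have "N \<noteq> {0}"
    proof
      assume N0: "N = {0}"
      have "0 \<in> J2 \<zeta>" using left_module.submoduleD(2)[OF left_module_E[OF Z] submodule_J2[OF Z]] by simp
      then have "J2 \<zeta> = N \<or> J2 \<zeta> = J1 \<zeta>"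
        using N restrict[of "J2 \<zeta>"] submodule_J2[OF Z] J21 N0 unfolding maximal_submodule_def by auto
      moreover have "comb \<zeta> 0 0 0 1 \<in> J2 \<zeta>" "comb \<zeta> 0 0 0 1 \<notin> N"
        by (auto simp: J2_def N0 comb_eq_zero)
      moreover have "comb \<zeta> 0 1 0 0 \<in> J1 \<zeta>" "comb \<zeta> 0 1 0 0 \<notin> J2 \<zeta>"
        by (auto simp: J1_def J2_def comb_inject)
      ultimately show False by blast
    qed
    then show ?thesis using submodule_E_socle[OF Z sub] by (auto simp: J2_def)
  qed
  then show "J2 \<zeta> \<subseteq> rad A (EJ1 \<zeta>)" using J21 unfolding rad_def by auto
qed

lemma left_module_EJ2: "\<zeta> \<in> Z \<Longrightarrow> left_module A (EJ2 \<zeta>)"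
  using left_module.submodule_left_module[OF left_module_E submodule_J2] .

lemma socle_hom: assumes Z: "\<zeta> \<in> Z" shows "(\<lambda>x. x id) \<in> lmod_hom A (EJ2 \<zeta>) (S \<zeta>)"
  by (rule lmod_homI) (auto simp: J2_def conv_pqe[OF Z] comb_coordinates)

lemma rad_EJ2: assumes Z: "\<zeta> \<in> Z" shows "rad A (EJ2 \<zeta>) = {0}"
proof
  have "comb \<zeta> 0 0 0 1 \<in> carrier (EJ2 \<zeta>)" by (auto simp: J2_def)
  then have "rad A (EJ2 \<zeta>) \<subseteq> {x \<in> carrier (EJ2 \<zeta>). x id = 0}"
    by (rule rad_subset_kernel[OF left_module_EJ2[OF Z] Z socle_hom[OF Z]]) (simp add: comb_coordinates)
  then show "rad A (EJ2 \<zeta>) \<subseteq> {0}" by (auto simp: J2_def comb_coordinates comb_zero)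
  show "{0} \<subseteq> rad A (EJ2 \<zeta>)"
    using left_module.submoduleD(2)[OF left_module_EJ2[OF Z] left_module.submodule_rad[OF left_module_EJ2[OF Z]]] by simp
qed

lemma rad_pow_E:
  assumes Z: "\<zeta> \<in> Z"
  shows "rad_pow A (E \<zeta>) (Suc 0) = J1 \<zeta>" "rad_pow A (E \<zeta>) (Suc (Suc 0)) = J2 \<zeta>"
    "rad_pow A (E \<zeta>) (Suc (Suc (Suc 0))) = {0}"
proof -
  have "E \<zeta>\<lparr>carrier := carrier (E \<zeta>)\<rparr> = E \<zeta>" by simp
  then show 1: "rad_pow A (E \<zeta>) (Suc 0) = J1 \<zeta>" using rad_E[OF Z] by (simp del: E_simps(1))
  show 2: "rad_pow A (E \<zeta>) (Suc (Suc 0)) = J2 \<zeta>" by (simp only: rad_pow.simps(2)[of _ _ "Suc 0"] 1 rad_EJ1[OF Z])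
  show "rad_pow A (E \<zeta>) (Suc (Suc (Suc 0))) = {0}"
    by (simp only: rad_pow.simps(2)[of _ _ "Suc (Suc 0)"] 2 rad_EJ2[OF Z])
qed

text \<open>Both orders of the summands of the middle layer occur in the theorem: the products \<open>\<omega> \<zeta>\<close> and
  \<open>\<omega>\<^sup>2 \<zeta>\<close> are \<open>\<omega>\<close>, \<open>\<omega>\<^sup>2\<close> for \<open>\<zeta> = 1\<close>, but \<open>\<omega>\<^sup>2\<close>, \<open>1\<close> for \<open>\<zeta> = \<omega>\<close>.\<close>

lemma radical_layers:
  assumes Z: "\<zeta> \<in> Z" and Q: "left_module A Q" and iso: "lmod_iso A (E \<zeta>) Q"
  shows "has_radical_layers A Q (S \<zeta>) (dsum (S (\<omega> * \<zeta>)) (S (\<omega>\<^sup>2 * \<zeta>))) (S \<zeta>)"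
    and "has_radical_layers A Q (S \<zeta>) (dsum (S (\<omega>\<^sup>2 * \<zeta>)) (S (\<omega> * \<zeta>))) (S \<zeta>)"
proof -
  note E = left_module_E[OF Z]
  note layer = radical_layer_iso_transport[OF E Q iso]
  note S = left_module_S[OF Z] left_module_S[OF Z_closed(1)[OF Z]] left_module_S[OF Z_closed(2)[OF Z]]
  have E0: "E \<zeta>\<lparr>carrier := carrier (E \<zeta>)\<rparr> = E \<zeta>" by simp
  have "essential_epi A (E \<zeta>) (S \<zeta>) (chi \<zeta>)" using essential_chi[OF Z] .
  then have surj: "chi \<zeta> ` carrier (E \<zeta>) = carrier (S \<zeta>)" by (simp only: essential_epi_def)
  have 1: "lmod_iso A (radical_layer A Q (Suc 0)) (S \<zeta>)"
    using chi_hom[OF Z] surj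
    by (intro layer[OF S(1), where f = "chi \<zeta>"]) (simp_all only: rad_pow_E[OF Z] rad_pow.simps(1) E0 J1_eq[OF Z] S_simps)
  have c: "coord (comb \<zeta> 0 \<beta> \<gamma> \<delta>) = (\<beta>, \<gamma>)" for \<beta> \<gamma> \<delta> by (simp add: coord_def comb_coordinates)
  have mem: "comb \<zeta> 0 \<beta> \<gamma> \<delta> \<in> J1 \<zeta>" for \<beta> \<gamma> \<delta> by (auto simp: J1_def)
  have "z \<in> coord ` J1 \<zeta>" for z
    using c[of "fst z" "snd z" 0] mem[of "fst z" "snd z" 0] by (metis image_eqI prod.collapse)
  then have coord_surj: "coord ` J1 \<zeta> = UNIV" by blast
  then have swap_surj: "(\<lambda>x. prod.swap (coord x)) ` J1 \<zeta> = UNIV" by (metis image_image surj_swap)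
  have 2: "lmod_iso A (radical_layer A Q (Suc (Suc 0))) (dsum (S (\<omega> * \<zeta>)) (S (\<omega>\<^sup>2 * \<zeta>)))"
    using coord_hom[OF Z] coord_surj
    by (intro layer[OF left_module_dsum[OF S(2,3)], where f = coord]) (simp_all add: rad_pow_E[OF Z] J2_eq dsum_def del: rad_pow.simps)
  have swapped: "lmod_iso A (radical_layer A Q (Suc (Suc 0))) (dsum (S (\<omega>\<^sup>2 * \<zeta>)) (S (\<omega> * \<zeta>)))"
    using coord_components(3)[OF Z] swap_surj
    by (intro layer[OF left_module_dsum[OF S(3,2)], where f = "\<lambda>x. prod.swap (coord x)"])
      (auto simp add: rad_pow_E[OF Z] J2_eq dsum_def prod_eq_iff simp del: rad_pow.simps)
  have "(\<lambda>x. x id) ` J2 \<zeta> = UNIV"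
  proof -
    have "r \<in> (\<lambda>x. x id) ` J2 \<zeta>" for r
      by (rule image_eqI[of _ _ "comb \<zeta> 0 0 0 r"]) (auto simp: comb_coordinates J2_def)
    then show ?thesis by blast
  qed
  moreover have "{0} = {x \<in> J2 \<zeta>. x id = 0}"
    using comb_zero[of \<zeta>] by (auto simp: J2_def comb_coordinates)
  ultimately have 3: "lmod_iso A (radical_layer A Q (Suc (Suc (Suc 0)))) (S \<zeta>)"
    using socle_hom[OF Z]
    by (intro layer[OF S(1), where f = "\<lambda>x. x id"]) (simp_all add: rad_pow_E[OF Z] del: rad_pow.simps)
  obtain f g where f: "f \<in> lmod_hom A (E \<zeta>) Q" "g \<in> lmod_hom A Q (E \<zeta>)"
    "\<And>x. x \<in> carrier (E \<zeta>) \<Longrightarrow> g (f x) = x" "\<And>y. y \<in> carrier Q \<Longrightarrow> f (g y) = y"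
    using lmod_iso_sym[OF E Q iso] by blast
  have 4: "rad_pow A Q (Suc (Suc (Suc 0))) = {\<zero>\<^bsub>Q\<^esub>}"
    using rad_pow_image[where f = f and g = g, OF E Q f, of "Suc (Suc (Suc 0))"] lmod_hom_zero[OF E Q f(1)]
    by (simp only: rad_pow_E[OF Z] E_simps image_insert image_empty)
  show "has_radical_layers A Q (S \<zeta>) (dsum (S (\<omega> * \<zeta>)) (S (\<omega>\<^sup>2 * \<zeta>))) (S \<zeta>)"
    "has_radical_layers A Q (S \<zeta>) (dsum (S (\<omega>\<^sup>2 * \<zeta>)) (S (\<omega> * \<zeta>))) (S \<zeta>)"
    unfolding has_radical_layers_def using 1 2 swapped 3 4
    by (simp_all only: One_nat_def numeral_2_eq_2 numeral_3_eq_3 simp_thms)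
qed

section \<open>The decomposition of \<open>kA\<^sub>4\<close>\<close>

lemma projective_cover_indecomposable:
  assumes Z: "\<zeta> \<in> Z" and cover: "projective_cover A P (S \<zeta>)"
  shows "proj_indecomposable A P"
proof -
  have "left_module A P" "fin_gen A P" "projective_lmod A P"
    using cover by (auto simp: projective_cover_def)
  then show ?thesis
    using indecomposable_transport[OF left_module_E[OF Z] _ projective_cover_iso_E[OF Z cover] indecomposable_E[OF Z]]
    by (simp add: proj_indecomposable_def)
qed

text \<open>The isomorphism is \<open>x \<mapsto> (x e 1, x e \<omega>, x e \<omega>\<^sup>2)\<close> followed by the given ones.\<close>

lemma regular_decomposition:
  assumes "lmod_iso A (E 1) M1" "lmod_iso A (E \<omega>) M2" "lmod_iso A (E (\<omega>\<^sup>2)) M3"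
  shows "lmod_iso A (regular_lmod A) (dsum M1 (dsum M2 M3))"
proof -
  have Z: "1 \<in> Z" "\<omega> \<in> Z" "\<omega>\<^sup>2 \<in> Z" by (auto simp: Z_def)
  obtain f1 f2 f3 where f: "f1 \<in> lmod_hom A (E 1) M1" "bij_betw f1 (carrier (E 1)) (carrier M1)"
    "f2 \<in> lmod_hom A (E \<omega>) M2" "bij_betw f2 (carrier (E \<omega>)) (carrier M2)"
    "f3 \<in> lmod_hom A (E (\<omega>\<^sup>2)) M3" "bij_betw f3 (carrier (E (\<omega>\<^sup>2))) (carrier M3)"
    using assms unfolding lmod_iso_def by blast
  note f1 = lmod_homD[OF f(1)] and f2 = lmod_homD[OF f(3)] and f3 = lmod_homD[OF f(5)]
  define F where "F x = (f1 (x \<star> e 1), f2 (x \<star> e \<omega>), f3 (x \<star> e (\<omega>\<^sup>2)))" for x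
  have "F \<in> lmod_hom A (regular_lmod A) (dsum M1 (dsum M2 M3))"
  proof (rule lmod_homI)
    fix x y assume "x \<in> carrier (regular_lmod A)" "y \<in> carrier (regular_lmod A)"
    then have xy: "x \<in> carrier A" "y \<in> carrier A" by simp_all
    show "F x \<in> carrier (dsum M1 (dsum M2 M3))"
      using f1(1) f2(1) f3(1) E_mult[OF _ xy(1)] Z by (simp add: dsum_def F_def del: E_simps(1))
    show "F (x \<oplus>\<^bsub>regular_lmod A\<^esub> y) = F x \<oplus>\<^bsub>dsum M1 (dsum M2 M3)\<^esub> F y"
      using f1(2) f2(2) f3(2) E_mult[OF _ xy(1)] E_mult[OF _ xy(2)] Z
      by (simp add: dsum_def F_def group_algebra_simps(2) conv_simps del: E_simps(1) plus_fun_apply)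
  next
    fix a x assume "a \<in> carrier A" "x \<in> carrier (regular_lmod A)"
    then show "F (a \<odot>\<^bsub>regular_lmod A\<^esub> x) = a \<odot>\<^bsub>dsum M1 (dsum M2 M3)\<^esub> F x"
      using f1(3) f2(3) f3(3) E_mult Z
      by (simp add: dsum_def F_def A4.conv_assoc del: E_simps(1))
  qed
  moreover have "inj_on F (carrier A)"
  proof (rule inj_onI)
    fix x y assume xy: "x \<in> carrier A" "y \<in> carrier A" "F x = F y"
    have eqs: "f1 (x \<star> e 1) = f1 (y \<star> e 1)" "f2 (x \<star> e \<omega>) = f2 (y \<star> e \<omega>)"
      "f3 (x \<star> e (\<omega>\<^sup>2)) = f3 (y \<star> e (\<omega>\<^sup>2))" using xy(3) by (simp_all add: F_def)
    have "x \<star> e 1 = y \<star> e 1"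
      by (rule inj_onD[OF bij_betw_imp_inj_on[OF f(2)] eqs(1) E_mult[OF Z(1) xy(1)] E_mult[OF Z(1) xy(2)]])
    moreover have "x \<star> e \<omega> = y \<star> e \<omega>"
      by (rule inj_onD[OF bij_betw_imp_inj_on[OF f(4)] eqs(2) E_mult[OF Z(2) xy(1)] E_mult[OF Z(2) xy(2)]])
    moreover have "x \<star> e (\<omega>\<^sup>2) = y \<star> e (\<omega>\<^sup>2)"
      by (rule inj_onD[OF bij_betw_imp_inj_on[OF f(6)] eqs(3) E_mult[OF Z(3) xy(1)] E_mult[OF Z(3) xy(2)]])
    ultimately show "x = y" using decompose[OF xy(1)] decompose[OF xy(2)] by metis
  qed
  moreover have "m \<in> F ` carrier A" if m: "m \<in> carrier (dsum M1 (dsum M2 M3))" for m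
  proof -
    obtain m1 m2 m3 where mm: "m = (m1, m2, m3)" "m1 \<in> carrier M1" "m2 \<in> carrier M2" "m3 \<in> carrier M3"
      using m by (auto simp: dsum_def)
    have "m1 \<in> f1 ` carrier (E 1)" using mm(2) by (simp only: bij_betw_imp_surj_on[OF f(2)])
    then obtain x1 where x1: "x1 \<in> carrier (E 1)" "m1 = f1 x1" by (rule imageE)
    have "m2 \<in> f2 ` carrier (E \<omega>)" using mm(3) by (simp only: bij_betw_imp_surj_on[OF f(4)])
    then obtain x2 where x2: "x2 \<in> carrier (E \<omega>)" "m2 = f2 x2" by (rule imageE)
    have "m3 \<in> f3 ` carrier (E (\<omega>\<^sup>2))" using mm(4) by (simp only: bij_betw_imp_surj_on[OF f(6)])
    then obtain x3 where x3: "x3 \<in> carrier (E (\<omega>\<^sup>2))" "m3 = f3 x3" by (rule imageE)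
    have other: "x \<star> e \<xi> = 0" if "x \<in> carrier (E \<zeta>)" "\<zeta> \<in> Z" "\<xi> \<in> Z" "\<zeta> \<noteq> \<xi>" for x \<zeta> \<xi>
      using that by (auto simp: comb_e)
    note ne = omega_distinct omega_distinct(1-3)[symmetric]
    have "(x1 + x2 + x3) \<star> e 1 = x1" "(x1 + x2 + x3) \<star> e \<omega> = x2" "(x1 + x2 + x3) \<star> e (\<omega>\<^sup>2) = x3"
      using E_e[OF Z(1) x1(1)] E_e[OF Z(2) x2(1)] E_e[OF Z(3) x3(1)]
        other[OF x1(1) Z(1) Z(2)] other[OF x1(1) Z(1) Z(3)] other[OF x2(1) Z(2) Z(1)]
        other[OF x2(1) Z(2) Z(3)] other[OF x3(1) Z(3) Z(1)] other[OF x3(1) Z(3) Z(2)] ne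
      by (simp_all only: conv_simps not_False_eq_True simp_thms add_0 add_0_right)
    then have "F (x1 + x2 + x3) = m" using x1(2) x2(2) x3(2) mm(1) by (simp add: F_def)
    moreover have "x1 + x2 + x3 \<in> carrier A"
      using E_kA4[OF x1(1)] E_kA4[OF x2(1)] E_kA4[OF x3(1)] by (intro kA4_closed)
    ultimately show ?thesis by blast
  qed
  moreover have "F ` carrier A \<subseteq> carrier (dsum M1 (dsum M2 M3))"
    using lmod_homD(1)[OF \<open>F \<in> lmod_hom A _ _\<close>] by (intro image_subsetI) simp
  ultimately have "F \<in> lmod_hom A (regular_lmod A) (dsum M1 (dsum M2 M3))"
    "bij_betw F (carrier (regular_lmod A)) (carrier (dsum M1 (dsum M2 M3)))"
    unfolding bij_betw_def regular_lmod_simps by blast+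
  then show ?thesis unfolding lmod_iso_def by blast
qed

end

theorem mainTheorem3:
  fixes \<omega> :: "'k::alg_closed_field"
  assumes "CHAR('k) = 2"
    and "\<omega>\<^sup>2 + \<omega> + 1 = 0"
  shows
    "(\<forall>i\<in>{1, 2, 3}. \<exists>P :: ((nat \<Rightarrow> nat) \<Rightarrow> 'k, (nat \<Rightarrow> nat) \<Rightarrow> 'k) module.
        projective_cover kA4 P (T \<omega> i)) \<and>
     (\<forall>Q :: nat \<Rightarrow> ((nat \<Rightarrow> nat) \<Rightarrow> 'k, (nat \<Rightarrow> nat) \<Rightarrow> 'k) module.
        (\<forall>i\<in>{1, 2, 3}. projective_cover kA4 (Q i) (T \<omega> i)) \<longrightarrow>
          (\<forall>i\<in>{1, 2, 3}. proj_indecomposable kA4 (Q i)) \<and>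
          (\<forall>i\<in>{1, 2, 3}. \<forall>j\<in>{1, 2, 3}. lmod_iso kA4 (Q i) (Q j) \<longrightarrow> i = j) \<and>
          (\<forall>P :: ((nat \<Rightarrow> nat) \<Rightarrow> 'k, 'p) module. proj_indecomposable kA4 P \<longrightarrow>
            (\<exists>i\<in>{1, 2, 3}. lmod_iso kA4 P (Q i))) \<and>
          lmod_iso kA4 (regular_lmod kA4) (dsum (Q 1) (dsum (Q 2) (Q 3))) \<and>
          has_radical_layers kA4 (Q 1) (T \<omega> 1) (dsum (T \<omega> 2) (T \<omega> 3)) (T \<omega> 1) \<and>
          has_radical_layers kA4 (Q 2) (T \<omega> 2) (dsum (T \<omega> 1) (T \<omega> 3)) (T \<omega> 2) \<and>
          has_radical_layers kA4 (Q 3) (T \<omega> 3) (dsum (T \<omega> 1) (T \<omega> 2)) (T \<omega> 3))"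
proof -
  have "(1::'k) + 1 = 0" using of_nat_CHAR[where 'a = 'k] assms(1) by simp
  then interpret kA4_char2 \<omega> using assms(2) by unfold_locales
  have Z: "1 \<in> Z" "\<omega> \<in> Z" "\<omega>\<^sup>2 \<in> Z" by (auto simp: Z_def)
  define z where "z i = \<omega> ^ (i - 1)" for i :: nat
  have z: "z 1 = 1" "z 2 = \<omega>" "z 3 = \<omega>\<^sup>2" by (simp_all add: z_def)
  have T: "T \<omega> i = S (z i)" for i by (simp add: T_def S_def z_def)
  have zZ: "z i \<in> Z" if "i \<in> {1, 2, 3}" for i using that z Z by auto
  have z_inj: "i = j" if "i \<in> {1, 2, 3}" "j \<in> {1, 2, 3}" "z i = z j" for i j
    using that z omega_distinct omega_distinct(1-3)[symmetric] by (elim insertE emptyE) (simp_all del: One_nat_def)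
  have z_surj: "\<exists>i\<in>{1, 2, 3}. \<zeta> = z i" if "\<zeta> \<in> Z" for \<zeta> using that z by (auto simp: Z_def)
  show ?thesis
  proof (intro conjI ballI allI impI)
    fix i :: nat assume "i \<in> {1, 2, 3}"
    then show "\<exists>P :: ((nat \<Rightarrow> nat) \<Rightarrow> 'k, (nat \<Rightarrow> nat) \<Rightarrow> 'k) module. projective_cover kA4 P (T \<omega> i)"
      using projective_cover_E zZ T by metis
  next
    fix Q :: "nat \<Rightarrow> ((nat \<Rightarrow> nat) \<Rightarrow> 'k, (nat \<Rightarrow> nat) \<Rightarrow> 'k) module"
    assume Q: "\<forall>i\<in>{1, 2, 3}. projective_cover kA4 (Q i) (T \<omega> i)"
    have lm: "left_module kA4 (Q i)" if "i \<in> {1, 2, 3}" for i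
      using Q that unfolding projective_cover_def by blast
    have iso: "lmod_iso kA4 (E (z i)) (Q i)" if "i \<in> {1, 2, 3}" for i
      using projective_cover_iso_E[OF zZ[OF that]] Q that unfolding T by blast
    have layers: "has_radical_layers kA4 (Q i) (S (z i)) (dsum (S (\<omega> * z i)) (S (\<omega>\<^sup>2 * z i))) (S (z i))"
      "has_radical_layers kA4 (Q i) (S (z i)) (dsum (S (\<omega>\<^sup>2 * z i)) (S (\<omega> * z i))) (S (z i))"
      if "i \<in> {1, 2, 3}" for i
      using radical_layers[OF zZ lm iso] that by blast+
    show "proj_indecomposable kA4 (Q i)" if "i \<in> {1, 2, 3}" for i
      using projective_cover_indecomposable[OF zZ[OF that]] Q that unfolding T by blast
    show "i = j" if ij: "i \<in> {1, 2, 3}" "j \<in> {1, 2, 3}" "lmod_iso kA4 (Q i) (Q j)" for i j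
    proof -
      have "lmod_iso kA4 (E (z i)) (E (z j))"
        using lmod_iso_trans[OF lmod_iso_trans[OF iso[OF ij(1)] ij(3)]
            lmod_iso_commute[OF left_module_E[OF zZ[OF ij(2)]] lm[OF ij(2)] iso[OF ij(2)]]] .
      then show ?thesis using iso_E_imp_eq[OF zZ[OF ij(1)] zZ[OF ij(2)]] z_inj[OF ij(1,2)] by blast
    qed
    show "\<exists>i\<in>{1, 2, 3}. lmod_iso kA4 P (Q i)" if P: "proj_indecomposable kA4 P"
      for P :: "((nat \<Rightarrow> nat) \<Rightarrow> 'k, 'p) module"
    proof -
      obtain \<zeta> where "\<zeta> \<in> Z" "lmod_iso kA4 P (E \<zeta>)" using proj_indecomposable_iso_E[OF P] by blast
      then show ?thesis using z_surj iso lmod_iso_trans by blast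
    qed
    show "lmod_iso kA4 (regular_lmod kA4) (dsum (Q 1) (dsum (Q 2) (Q 3)))"
      using regular_decomposition iso[of 1] iso[of 2] iso[of 3] z by (simp del: One_nat_def)
    show "has_radical_layers kA4 (Q 1) (T \<omega> 1) (dsum (T \<omega> 2) (T \<omega> 3)) (T \<omega> 1)"
      using layers(1)[of 1] z by (simp add: T del: One_nat_def)
    show "has_radical_layers kA4 (Q 2) (T \<omega> 2) (dsum (T \<omega> 1) (T \<omega> 3)) (T \<omega> 2)"
      using layers(2)[of 2] z omega_powers by (simp add: T del: One_nat_def)
    show "has_radical_layers kA4 (Q 3) (T \<omega> 3) (dsum (T \<omega> 1) (T \<omega> 2)) (T \<omega> 3)"
      using layers(1)[of 3] z omega_powers by (simp add: T del: One_nat_def)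
  qed
qed

end
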